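(* If $\min_{i\in\{1,\dots,N\}}\alpha_i$ is sufficiently large (that is, larger than some threshold depending only on $\Omega,T,\Gamma_1,\Gamma_2,N$ and the $\omega_i,\rho_i,\eta_i$, $i\in\{1,\dots,N\}$), then there exists a unique Nash equilibrium for the functionals $J_1,\dots,J_N$, i.e. a unique $u=(u_1,\dots,u_N)\in{\mathcal U}$ such that, for every $i\in\{1,\dots,N\}$, $$J_i(u_1,\dots,u_N)\le J_i(u_1,\dots,u_{i-1},v_i,u_{i+1},\dots,u_N)\qquad\text{for all } v_i\in{\mathcal U}_i.$$
   Context: Let $T>0$, $d\in\{1,2,3\}$, $\Omega\subset\mathbb{R}^d$ a bounded and smooth open set, $\Gamma_1,\Gamma_2\subset\partial\Omega$ (measurable) with $\partial\Omega=\Gamma_1\cup\Gamma_2$. Put $Q=\Omega\times(0,T)$, $\Sigma_1=\Gamma_1\times(0,T)$, $\Sigma_2=\Gamma_2\times(0,T)$. Let $N\in\mathbb{N}$, $N\geq 1$, and for $i\in\{1,\dots,N\}$ let $\omega_i\subset\Omega$ be (measurable) sets with $\omega_i\cap\omega_j=\emptyset$ if $i\ne j$. The control Hilbert spaces are ${\mathcal U}_i=L^2(\omega_i\times(0,T))$ and ${\mathcal U}={\mathcal U}_1\times\cdots\times{\mathcal U}_N$. For each $i$ let $\alpha_i>0$ and $\rho_i,\eta_i\in L^\infty(\Omega)$ with $\rho_i,\eta_i\ge 0$. For $v=(v_1,\dots,v_N)\in{\mathcal U}$, $y=y(v)$ is the solution of $$\frac{\partial y}{\partial t}-\Delta y=f+\sum_{i=1}^N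 v_i\chi_{\omega_i}\ \text{in }Q,\quad y(0)=y_0\ \text{in }\Omega,\quad y=g_1\ \text{on }\Sigma_1,\quad \frac{\partial y}{\partial n}=g_2\ \text{on }\Sigma_2,$$ where $v_i\chi_{\omega_i}$ is the extension of $v_i$ by zero to $Q$ and $\partial/\partial n$ is the outward normal derivative. The data $f,g_1,g_2,y_0$ and the targets $y_{i,{\rm d}}$ (defined on $Q$), $y_{i,{\rm T}}$ (defined on $\Omega$) are smooth enough functions: in particular $y_{i,{\rm d}}\in L^2(Q)$, $y_{i,{\rm T}}\in L^2(\Omega)$, and the problem for $y$ has a unique solution $y(v)\in C([0,T];L^2(\Omega))$ for each $v\in{\mathcal U}$. Solutions are understood in the standard weak (variational) sense, with test functions in $V=\{\varphi\in H^1(\Omega):\varphi=0\text{ on }\Gamma_1\}$; the difference $y(v)-y(0)$ is the weak solution, in $\{z\in L^2(0,T;V):\partial_t z\in L^2(0,T;V')\}$, of the same problem with $f=0$, $y_0=0$, $g_1=0$, $g_2=0$. The functionals $J_i:{\mathcal U}\to\mathbb{R}$, $i\in\{1,\dots,N\}$, are $$J_i(v)=\frac{\alpha_i}{2}\int_{\omega_i\times(0,T)}|v_i|^2\,dx\,dt+\frac12\int_Q\rho_i(x)|y(v)-y_{i,{\rm d}}|^2\,dx\,dt+\frac12\int_\Omega\eta_i(x)|y(T;v)-y_{i,{\rm T}}|^2\,dx,$$ where $y(T;v)$ denotes $y(v)$ at time $T$. *)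

theory Defs
  imports "HOL-Analysis.Analysis"
begin

(* Elements of Lebesgue spaces are represented by functions; equality in the space is equality
   almost everywhere.  A point of the cylinder is a pair (x, t). *)

definition L2 :: "'a measure \<Rightarrow> ('a \<Rightarrow> 'b::euclidean_space) set" where
  "L2 M = {f \<in> borel_measurable M. integrable M (\<lambda>x. (norm (f x))\<^sup>2)}"

definition L2_dist_sq :: "'a measure \<Rightarrow> ('a \<Rightarrow> 'b::euclidean_space) \<Rightarrow> ('a \<Rightarrow> 'b) \<Rightarrow> ennreal" where
  "L2_dist_sq M f g = (\<integral>\<^sup>+x. ennreal ((norm (f x - g x))\<^sup>2) \<partial>M)"

definition Linfty :: "'a measure \<Rightarrow> ('a \<Rightarrow> real) set" where
  "Linfty M = {f \<in> borel_measurable M. \<exists>C. AE x in M. \<bar>f x\<bar> \<le> C}"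

(* The L2 space of this product measure is that of Lebesgue measure on A x (0,T): every Lebesgue
   measurable function agrees almost everywhere with a Borel measurable one. *)
definition cylinder :: "'a::euclidean_space set \<Rightarrow> real \<Rightarrow> ('a \<times> real) measure" where
  "cylinder A T = lebesgue_on A \<Otimes>\<^sub>M lebesgue_on {0<..<T}"


primrec Ck_on :: "nat \<Rightarrow> ('a::euclidean_space \<Rightarrow> real) \<Rightarrow> 'a set \<Rightarrow> bool" where
  "Ck_on 0 f S \<longleftrightarrow> continuous_on S f"
| "Ck_on (Suc k) f S \<longleftrightarrow> (\<forall>x\<in>S. f differentiable (at x)) \<and>
     (\<forall>b\<in>Basis. Ck_on k (\<lambda>x. frechet_derivative f (at x) b) S)"

definition smooth_on :: "('a::euclidean_space \<Rightarrow> real) \<Rightarrow> 'a set \<Rightarrow> bool" where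
  "smooth_on f S \<longleftrightarrow> (\<forall>k. Ck_on k f S)"

definition grad :: "('a::euclidean_space \<Rightarrow> real) \<Rightarrow> 'a \<Rightarrow> 'a" where
  "grad f x = (\<Sum>b\<in>Basis. frechet_derivative f (at x) b *\<^sub>R b)"

definition test_functions :: "'a::euclidean_space set \<Rightarrow> ('a \<Rightarrow> real) set" where
  "test_functions S =
     {\<phi>. smooth_on \<phi> UNIV \<and> (\<exists>K. compact K \<and> K \<subseteq> S \<and> (\<forall>x. x \<notin> K \<longrightarrow> \<phi> x = 0))}"

(* Near each boundary point the set is, in suitable orthonormal coordinates, the strict epigraph
   of a smooth function of the coordinates orthogonal to the unit vector e. *)
definition smooth_boundary :: "'a::euclidean_space set \<Rightarrow> bool" where
  "smooth_boundary \<Omega> \<longleftrightarrow>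
     (\<forall>p\<in>frontier \<Omega>. \<exists>r>0. \<exists>e \<gamma>. norm e = 1 \<and> smooth_on \<gamma> UNIV \<and>
        \<Omega> \<inter> ball p r = {x \<in> ball p r. \<gamma> (x - (x \<bullet> e) *\<^sub>R e) < x \<bullet> e})"


(* The n-dimensional Hausdorff outer measure, normalised to agree with Lebesgue measure on
   n-dimensional subspaces; for n = 0 it is the counting measure.  The empty set is treated
   separately because 0 ^ 0 = 1. *)
definition hausdorff_gauge :: "nat \<Rightarrow> 'a::euclidean_space set \<Rightarrow> ennreal" where
  "hausdorff_gauge n E =
     (if E = {} then 0 else ennreal (unit_ball_vol (real n) * (diameter E / 2) ^ n))"

definition hausdorff_outer :: "nat \<Rightarrow> 'a::euclidean_space set \<Rightarrow> ennreal" where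
  "hausdorff_outer n A =
     (SUP \<delta>\<in>{0<..}. INF E\<in>{E :: nat \<Rightarrow> 'a set. A \<subseteq> (\<Union>k. E k) \<and>
        (\<forall>k. bounded (E k) \<and> diameter (E k) \<le> \<delta>)}. \<Sum>k. hausdorff_gauge n (E k))"

(* Being a metric outer measure, hausdorff_outer is countably additive on the Borel sets, so that
   measure_of does not degenerate to the null measure here. *)
definition surface_measure :: "'a::euclidean_space set \<Rightarrow> 'a measure" where
  "surface_measure \<Omega> =
     completion (restrict_space (measure_of UNIV (sets borel) (hausdorff_outer (DIM('a) - 1)))
       (frontier \<Omega>))"

definition boundary_cylinder ::
  "'a::euclidean_space set \<Rightarrow> 'a set \<Rightarrow> real \<Rightarrow> ('a \<times> real) measure" where
  "boundary_cylinder \<Omega> \<Gamma> T =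
     restrict_space (surface_measure \<Omega>) \<Gamma> \<Otimes>\<^sub>M lebesgue_on {0<..<T}"


definition is_weak_grad ::
  "'a::euclidean_space set \<Rightarrow> ('a \<Rightarrow> real) \<Rightarrow> ('a \<Rightarrow> 'a) \<Rightarrow> bool" where
  "is_weak_grad \<Omega> u G \<longleftrightarrow> G \<in> L2 (lebesgue_on \<Omega>) \<and>
     (\<forall>\<phi>\<in>test_functions \<Omega>. \<forall>b\<in>Basis.
        (LINT x|lebesgue_on \<Omega>. u x * frechet_derivative \<phi> (at x) b) =
        - (LINT x|lebesgue_on \<Omega>. (G x \<bullet> b) * \<phi> x))"

definition H1 :: "'a::euclidean_space set \<Rightarrow> ('a \<Rightarrow> real) set" where
  "H1 \<Omega> = {u \<in> L2 (lebesgue_on \<Omega>). \<exists>G. is_weak_grad \<Omega> u G}"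

definition weak_grad :: "'a::euclidean_space set \<Rightarrow> ('a \<Rightarrow> real) \<Rightarrow> 'a \<Rightarrow> 'a" where
  "weak_grad \<Omega> u = (SOME G. is_weak_grad \<Omega> u G)"

definition H1_norm :: "'a::euclidean_space set \<Rightarrow> ('a \<Rightarrow> real) \<Rightarrow> real" where
  "H1_norm \<Omega> u = sqrt ((LINT x|lebesgue_on \<Omega>. (u x)\<^sup>2) +
     (LINT x|lebesgue_on \<Omega>. (norm (weak_grad \<Omega> u x))\<^sup>2))"

(* The boundary trace: the continuous extension to H1 of the restriction to the boundary of
   functions that are smooth up to the boundary. *)
definition has_trace :: "'a::euclidean_space set \<Rightarrow> ('a \<Rightarrow> real) \<Rightarrow> ('a \<Rightarrow> real) \<Rightarrow> bool" where
  "has_trace \<Omega> u \<tau> \<longleftrightarrow> u \<in> H1 \<Omega> \<and> \<tau> \<in> L2 (surface_measure \<Omega>) \<and>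
     (\<exists>w :: nat \<Rightarrow> 'a \<Rightarrow> real. (\<forall>k. smooth_on (w k) UNIV) \<and>
        (\<lambda>k. L2_dist_sq (lebesgue_on \<Omega>) (w k) u) \<longlonglongrightarrow> 0 \<and>
        (\<lambda>k. L2_dist_sq (lebesgue_on \<Omega>) (grad (w k)) (weak_grad \<Omega> u)) \<longlonglongrightarrow> 0 \<and>
        (\<lambda>k. L2_dist_sq (surface_measure \<Omega>) (w k) \<tau>) \<longlonglongrightarrow> 0)"

definition boundary_trace :: "'a::euclidean_space set \<Rightarrow> ('a \<Rightarrow> real) \<Rightarrow> 'a \<Rightarrow> real" where
  "boundary_trace \<Omega> u = (SOME \<tau>. has_trace \<Omega> u \<tau>)"

definition trace_eq_on ::
  "'a::euclidean_space set \<Rightarrow> 'a set \<Rightarrow> ('a \<Rightarrow> real) \<Rightarrow> ('a \<Rightarrow> real) \<Rightarrow> bool" where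
  "trace_eq_on \<Omega> \<Gamma> u g \<longleftrightarrow>
     (\<exists>\<tau>. has_trace \<Omega> u \<tau> \<and> (AE x in surface_measure \<Omega>. x \<in> \<Gamma> \<longrightarrow> \<tau> x = g x))"

definition V_space :: "'a::euclidean_space set \<Rightarrow> 'a set \<Rightarrow> ('a \<Rightarrow> real) set" where
  "V_space \<Omega> \<Gamma>1 = {\<phi> \<in> H1 \<Omega>. trace_eq_on \<Omega> \<Gamma>1 \<phi> (\<lambda>_. 0)}"


definition C_L2 :: "'a::euclidean_space set \<Rightarrow> real \<Rightarrow> (real \<Rightarrow> 'a \<Rightarrow> real) set" where
  "C_L2 \<Omega> T = {y. \<forall>t\<in>{0..T}. y t \<in> L2 (lebesgue_on \<Omega>) \<and>
     ((\<lambda>s. L2_dist_sq (lebesgue_on \<Omega>) (y s) (y t)) \<longlongrightarrow> 0) (at t within {0..T})}"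

(* L2(0,T;H1), identified with the square integrable functions on the cylinder whose gradient
   in x is square integrable on the cylinder. *)
definition L2_H1 :: "'a::euclidean_space set \<Rightarrow> real \<Rightarrow> (real \<Rightarrow> 'a \<Rightarrow> real) set" where
  "L2_H1 \<Omega> T = {y. (\<lambda>(x, t). y t x) \<in> L2 (cylinder \<Omega> T) \<and>
     (\<exists>G :: 'a \<times> real \<Rightarrow> 'a. G \<in> L2 (cylinder \<Omega> T) \<and>
        (AE t in lebesgue_on {0<..<T}. y t \<in> H1 \<Omega> \<and> is_weak_grad \<Omega> (y t) (\<lambda>x. G (x, t))))}"

(* L2(0,T;V'), where V' is the dual of V_space; m bounds the dual norm. *)
definition L2_Vdual ::
  "'a::euclidean_space set \<Rightarrow> 'a set \<Rightarrow> real \<Rightarrow> (real \<Rightarrow> ('a \<Rightarrow> real) \<Rightarrow> real) set" where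
  "L2_Vdual \<Omega> \<Gamma>1 T = {h.
     (\<forall>\<phi>\<in>V_space \<Omega> \<Gamma>1. (\<lambda>t. h t \<phi>) \<in> borel_measurable (lebesgue_on {0<..<T})) \<and>
     (\<exists>m :: real \<Rightarrow> real. m \<in> L2 (lebesgue_on {0<..<T}) \<and> (AE t in lebesgue_on {0<..<T}.
        (\<forall>\<phi>\<in>V_space \<Omega> \<Gamma>1. \<forall>\<theta>\<in>V_space \<Omega> \<Gamma>1. \<forall>a b.
           h t (\<lambda>x. a * \<phi> x + b * \<theta> x) = a * h t \<phi> + b * h t \<theta>) \<and>
        (\<forall>\<phi>\<in>V_space \<Omega> \<Gamma>1. \<bar>h t \<phi>\<bar> \<le> m t * H1_norm \<Omega> \<phi>)))}"

(* The distributional derivative in time, with values in V', for the usual embedding of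
   square integrable functions into V'. *)
definition is_time_derivative ::
  "'a::euclidean_space set \<Rightarrow> 'a set \<Rightarrow> real \<Rightarrow> (real \<Rightarrow> 'a \<Rightarrow> real) \<Rightarrow>
     (real \<Rightarrow> ('a \<Rightarrow> real) \<Rightarrow> real) \<Rightarrow> bool" where
  "is_time_derivative \<Omega> \<Gamma>1 T y h \<longleftrightarrow>
     (\<forall>\<phi>\<in>V_space \<Omega> \<Gamma>1. \<forall>\<psi>\<in>test_functions {0<..<T}.
        (LINT t|lebesgue_on {0<..<T}. (LINT x|lebesgue_on \<Omega>. y t x * \<phi> x) * deriv \<psi> t) =
        - (LINT t|lebesgue_on {0<..<T}. h t \<phi> * \<psi> t))"

(* Weak solutions of  y_t - Laplace y = F  with y = y0 at time 0, y = g1 on Gamma1 and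
   dy/dn = g2 on Gamma2.  The Neumann condition enters through the boundary integral that
   Green's formula produces for test functions vanishing on Gamma1. *)
definition weak_solution ::
  "'a::euclidean_space set \<Rightarrow> 'a set \<Rightarrow> 'a set \<Rightarrow> real \<Rightarrow> ('a \<times> real \<Rightarrow> real) \<Rightarrow>
     ('a \<Rightarrow> real) \<Rightarrow> ('a \<times> real \<Rightarrow> real) \<Rightarrow> ('a \<times> real \<Rightarrow> real) \<Rightarrow>
     (real \<Rightarrow> 'a \<Rightarrow> real) \<Rightarrow> bool" where
  "weak_solution \<Omega> \<Gamma>1 \<Gamma>2 T F y0 g1 g2 y \<longleftrightarrow>
     y \<in> C_L2 \<Omega> T \<and> y \<in> L2_H1 \<Omega> T \<and>
     (AE x in lebesgue_on \<Omega>. y 0 x = y0 x) \<and>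
     (AE t in lebesgue_on {0<..<T}. trace_eq_on \<Omega> \<Gamma>1 (y t) (\<lambda>x. g1 (x, t))) \<and>
     (\<exists>h\<in>L2_Vdual \<Omega> \<Gamma>1 T. is_time_derivative \<Omega> \<Gamma>1 T y h \<and>
        (AE t in lebesgue_on {0<..<T}. \<forall>\<phi>\<in>V_space \<Omega> \<Gamma>1.
           h t \<phi> + (LINT x|lebesgue_on \<Omega>. weak_grad \<Omega> (y t) x \<bullet> weak_grad \<Omega> \<phi> x) =
           (LINT x|lebesgue_on \<Omega>. F (x, t) * \<phi> x) +
           (LINT x:\<Gamma>2|surface_measure \<Omega>. g2 (x, t) * boundary_trace \<Omega> \<phi> x)))"


definition controls ::
  "nat \<Rightarrow> (nat \<Rightarrow> 'a::euclidean_space set) \<Rightarrow> real \<Rightarrow> (nat \<Rightarrow> 'a \<times> real \<Rightarrow> real) set" where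
  "controls N \<omega> T = (\<Pi>\<^sub>E i\<in>{1..N}. L2 (cylinder (\<omega> i) T))"

definition source ::
  "nat \<Rightarrow> (nat \<Rightarrow> 'a set) \<Rightarrow> ('a \<times> real \<Rightarrow> real) \<Rightarrow> (nat \<Rightarrow> 'a \<times> real \<Rightarrow> real) \<Rightarrow>
     'a \<times> real \<Rightarrow> real" where
  "source N \<omega> f v = (\<lambda>(x, t). f (x, t) + (\<Sum>i=1..N. indicator (\<omega> i) x * v i (x, t)))"

(* y is the state of the control v: a weak solution, and the only one. *)
definition is_state ::
  "'a::euclidean_space set \<Rightarrow> 'a set \<Rightarrow> 'a set \<Rightarrow> real \<Rightarrow> nat \<Rightarrow> (nat \<Rightarrow> 'a set) \<Rightarrow>
     ('a \<times> real \<Rightarrow> real) \<Rightarrow> ('a \<Rightarrow> real) \<Rightarrow> ('a \<times> real \<Rightarrow> real) \<Rightarrow> ('a \<times> real \<Rightarrow> real) \<Rightarrow>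
     (nat \<Rightarrow> 'a \<times> real \<Rightarrow> real) \<Rightarrow> (real \<Rightarrow> 'a \<Rightarrow> real) \<Rightarrow> bool" where
  "is_state \<Omega> \<Gamma>1 \<Gamma>2 T N \<omega> f y0 g1 g2 v y \<longleftrightarrow>
     weak_solution \<Omega> \<Gamma>1 \<Gamma>2 T (source N \<omega> f v) y0 g1 g2 y \<and>
     (\<forall>z. weak_solution \<Omega> \<Gamma>1 \<Gamma>2 T (source N \<omega> f v) y0 g1 g2 z \<longrightarrow>
        (\<forall>t\<in>{0..T}. AE x in lebesgue_on \<Omega>. z t x = y t x))"

(* The functional J_i, where y maps each control to its state. *)
definition cost ::
  "'a::euclidean_space set \<Rightarrow> real \<Rightarrow> (nat \<Rightarrow> 'a set) \<Rightarrow> (nat \<Rightarrow> 'a \<Rightarrow> real) \<Rightarrow>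
     (nat \<Rightarrow> 'a \<Rightarrow> real) \<Rightarrow> (nat \<Rightarrow> real) \<Rightarrow> (nat \<Rightarrow> 'a \<times> real \<Rightarrow> real) \<Rightarrow>
     (nat \<Rightarrow> 'a \<Rightarrow> real) \<Rightarrow> ((nat \<Rightarrow> 'a \<times> real \<Rightarrow> real) \<Rightarrow> real \<Rightarrow> 'a \<Rightarrow> real) \<Rightarrow>
     nat \<Rightarrow> (nat \<Rightarrow> 'a \<times> real \<Rightarrow> real) \<Rightarrow> real" where
  "cost \<Omega> T \<omega> \<rho> \<eta> \<alpha> yd yT y i v =
     \<alpha> i / 2 * (LINT p|cylinder (\<omega> i) T. \<bar>v i p\<bar>\<^sup>2) +
     1 / 2 * (LINT (x, t)|cylinder \<Omega> T. \<rho> i x * \<bar>y v t x - yd i (x, t)\<bar>\<^sup>2) +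
     1 / 2 * (LINT x|lebesgue_on \<Omega>. \<eta> i x * \<bar>y v T x - yT i x\<bar>\<^sup>2)"

definition is_Nash_equilibrium ::
  "nat \<Rightarrow> (nat \<Rightarrow> 'b set) \<Rightarrow> (nat \<Rightarrow> (nat \<Rightarrow> 'b) \<Rightarrow> real) \<Rightarrow> (nat \<Rightarrow> 'b) \<Rightarrow> bool" where
  "is_Nash_equilibrium N X J u \<longleftrightarrow> u \<in> (\<Pi>\<^sub>E i\<in>{1..N}. X i) \<and>
     (\<forall>i\<in>{1..N}. \<forall>w\<in>X i. J i u \<le> J i (u(i := w)))"

end

theory Submission
  imports Defs
begin

text \<open>
  The state depends affinely on the controls, so each cost is a quadratic functional.  The argument
  rests on two properties of these functionals.  As a function of the own control \<open>v i\<close> alone, the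
  \<open>i\<close>-th cost is strongly convex with modulus \<open>\<alpha> i\<close>, because the two observation terms are convex.
  And the mixed second difference of the \<open>i\<close>-th cost, with respect to a change of \<open>v i\<close> and a change
  of all controls, is bounded by a constant \<open>K\<close> times the product of the two changes, where \<open>K\<close> depends
  neither on \<open>\<alpha>\<close> nor on the data: the quadratic control cost does not contribute to it, and in a
  second difference of the observation terms the data cancel.  Strong convexity gives each player
  exactly one best response to the others, up to null sets, and comparison of two best responses shows
  that the best response map is Lipschitz continuous with a constant of order \<open>K * N / \<alpha>\<close>.  For large
  \<open>\<alpha>\<close> it is a contraction of the complete space of controls, and the Nash equilibria are its fixed points
  (\<open>unique_Nash_equilibrium_of_contraction\<close>).

  The constant \<open>K\<close> comes from the energy estimate for the difference \<open>z\<close> of two states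
  (\<open>energy_estimate\<close>): if \<open>z\<close> has vanishing data and source \<open>F\<close>, then the square of the norm of \<open>z t\<close>
  is at most \<open>4 * T\<close> times the square of the norm of \<open>F\<close>.  Formally one tests the equation with \<open>z\<close>
  itself and drops the Dirichlet integral, which has the right sign.  To make this rigorous for weak
  solutions, the equation at time \<open>r\<close> is tested with \<open>z s\<close> for a different time \<open>s\<close>, which is
  admissible for almost every \<open>s\<close>.  This gives the partial derivatives, in the sense of distributions,
  of the continuous kernel \<open>k r s = (z r, z s)\<close>.  If both variables are averaged with the same
  mollifier, the Dirichlet term becomes the squared norm of an average of the gradient of \<open>z\<close>, so that
  its sign is kept (\<open>mollified_energy_identity\<close>).  The average of \<open>k\<close> is differentiable along the
  diagonal and tends to the squared norm of \<open>z t\<close> (\<open>diagonal_growth_bound\<close>).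

  Differences of states are solutions with vanishing data only if the weak gradient and the trace are
  linear.  The weak gradient is a chosen representative and enters the definition of the trace, so both
  facts follow from its uniqueness almost everywhere, that is, from the fundamental lemma of the
  calculus of variations, applied to smooth bumps on boxes.\<close>

section \<open>Square integrable functions\<close>

definition L2_norm :: "'a measure \<Rightarrow> ('a \<Rightarrow> 'b::euclidean_space) \<Rightarrow> real" where
  "L2_norm M f = sqrt (LINT x|M. (norm (f x))\<^sup>2)"

lemma L2_measurable: "f \<in> L2 M \<Longrightarrow> f \<in> borel_measurable M"
  by (simp add: L2_def)

lemma L2_integrable: "f \<in> L2 M \<Longrightarrow> integrable M (\<lambda>x. (norm (f x))\<^sup>2)"
  by (simp add: L2_def)

lemma L2_zero [simp]: "(\<lambda>x. 0) \<in> L2 M"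
  by (simp add: L2_def)

lemma L2_dominated:
  fixes f :: "'a \<Rightarrow> 'b::euclidean_space" and g :: "'a \<Rightarrow> 'c::euclidean_space"
  assumes "g \<in> L2 M" "f \<in> borel_measurable M" "AE x in M. norm (f x) \<le> C * norm (g x)"
  shows "f \<in> L2 M"
proof -
  have "integrable M (\<lambda>x. C\<^sup>2 * (norm (g x))\<^sup>2)"
    using L2_integrable[OF assms(1)] by simp
  then have "integrable M (\<lambda>x. (norm (f x))\<^sup>2)"
  proof (rule Bochner_Integration.integrable_bound)
    show "(\<lambda>x. (norm (f x))\<^sup>2) \<in> borel_measurable M" using assms(2) by measurable
    show "AE x in M. norm ((norm (f x))\<^sup>2) \<le> norm (C\<^sup>2 * (norm (g x))\<^sup>2)"
      using assms(3)
    proof eventually_elim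
      case (elim x)
      then have "(norm (f x))\<^sup>2 \<le> (C * norm (g x))\<^sup>2" by (rule power_mono) simp
      then show ?case by (simp add: power_mult_distrib)
    qed
  qed
  then show ?thesis using assms(2) by (simp add: L2_def)
qed

lemma L2_norm_integrable:
  fixes f :: "'a \<Rightarrow> 'b::euclidean_space" and g :: "'a \<Rightarrow> 'c::euclidean_space"
  assumes "f \<in> L2 M" "g \<in> L2 M"
  shows "integrable M (\<lambda>x. norm (f x) * norm (g x))"
proof (rule Bochner_Integration.integrable_bound)
  show "integrable M (\<lambda>x. (norm (f x))\<^sup>2 + (norm (g x))\<^sup>2)"
    using assms by (auto simp: L2_def)
  show "(\<lambda>x. norm (f x) * norm (g x)) \<in> borel_measurable M"
    using assms[THEN L2_measurable] by measurable
  have "\<bar>a * b\<bar> \<le> \<bar>a\<^sup>2 + b\<^sup>2\<bar>" if "0 \<le> a" "0 \<le> b" for a b :: real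
    using sum_squares_bound[of a b] mult_nonneg_nonneg[OF that] zero_le_power2[of a] zero_le_power2[of b]
    by linarith
  then show "AE x in M. norm (norm (f x) * norm (g x)) \<le> norm ((norm (f x))\<^sup>2 + (norm (g x))\<^sup>2)"
    by auto
qed

lemma L2_inner_integrable:
  fixes f g :: "'a \<Rightarrow> 'b::euclidean_space"
  assumes "f \<in> L2 M" "g \<in> L2 M"
  shows "integrable M (\<lambda>x. f x \<bullet> g x)"
proof (rule Bochner_Integration.integrable_bound[OF L2_norm_integrable[OF assms]])
  show "(\<lambda>x. f x \<bullet> g x) \<in> borel_measurable M"
    using assms[THEN L2_measurable] by measurable
  show "AE x in M. norm (f x \<bullet> g x) \<le> norm (norm (f x) * norm (g x))"
    by (simp add: Cauchy_Schwarz_ineq2)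
qed

lemma L2_mult_integrable:
  fixes f g :: "'a \<Rightarrow> real"
  assumes "f \<in> L2 M" "g \<in> L2 M"
  shows "integrable M (\<lambda>x. f x * g x)"
  using L2_inner_integrable[OF assms] by simp

lemma L2_add:
  fixes f g :: "'a \<Rightarrow> 'b::euclidean_space"
  assumes "f \<in> L2 M" "g \<in> L2 M"
  shows "(\<lambda>x. f x + g x) \<in> L2 M"
proof -
  have "integrable M (\<lambda>x. (norm (f x))\<^sup>2 + (norm (g x))\<^sup>2 + 2 * (f x \<bullet> g x))"
    using assms L2_inner_integrable[OF assms] by (auto simp: L2_def)
  moreover have "(norm (f x + g x))\<^sup>2 = (norm (f x))\<^sup>2 + (norm (g x))\<^sup>2 + 2 * (f x \<bullet> g x)" for x
    by (simp add: power2_norm_eq_inner algebra_simps inner_commute)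
  moreover have "(\<lambda>x. f x + g x) \<in> borel_measurable M"
    using assms[THEN L2_measurable] by measurable
  ultimately show ?thesis by (simp add: L2_def)
qed

lemma L2_scaleR:
  fixes f :: "'a \<Rightarrow> 'b::euclidean_space"
  shows "f \<in> L2 M \<Longrightarrow> (\<lambda>x. c *\<^sub>R f x) \<in> L2 M"
  by (rule L2_dominated[where C="\<bar>c\<bar>" and g=f]) (auto simp: L2_def)

lemma L2_cmult:
  fixes f :: "'a \<Rightarrow> real"
  shows "f \<in> L2 M \<Longrightarrow> (\<lambda>x. c * f x) \<in> L2 M"
  using L2_scaleR[of f M c] by simp

lemma L2_diff:
  fixes f g :: "'a \<Rightarrow> 'b::euclidean_space"
  assumes "f \<in> L2 M" "g \<in> L2 M"
  shows "(\<lambda>x. f x - g x) \<in> L2 M"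
  using L2_add[OF assms(1) L2_scaleR[OF assms(2), of "-1"]] by simp

lemma L2_component:
  fixes f :: "'a \<Rightarrow> 'b::euclidean_space"
  assumes "f \<in> L2 M" "b \<in> Basis"
  shows "(\<lambda>x. f x \<bullet> b) \<in> L2 M"
  by (rule L2_dominated[OF assms(1), where C=1])
    (use L2_measurable[OF assms(1)] assms(2) in \<open>auto intro!: AE_I2 simp: Basis_le_norm\<close>)

lemma L2_sum:
  fixes f :: "'i \<Rightarrow> 'a \<Rightarrow> 'b::euclidean_space"
  assumes "\<And>i. i \<in> I \<Longrightarrow> f i \<in> L2 M"
  shows "(\<lambda>x. \<Sum>i\<in>I. f i x) \<in> L2 M"
  using assms by (induction I rule: infinite_finite_induct) (auto intro: L2_add)

lemma L2_norm_nonneg [simp]: "0 \<le> L2_norm M f"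
  by (simp add: L2_norm_def)

lemma L2_norm_sq: "(L2_norm M f)\<^sup>2 = (LINT x|M. (norm (f x))\<^sup>2)"
  by (simp add: L2_norm_def)

lemma L2_norm_minus_commute:
  "L2_norm M (\<lambda>x. f x - g x) = L2_norm M (\<lambda>x. g x - f x)"
  by (simp add: L2_norm_def norm_minus_commute)

lemma L2_norm_zero [simp]: "L2_norm M (\<lambda>x. 0) = 0"
  by (simp add: L2_norm_def)

lemma L2_norm_scaleR: "L2_norm M (\<lambda>x. c *\<^sub>R f x) = \<bar>c\<bar> * L2_norm M f"
  by (simp add: L2_norm_def power_mult_distrib real_sqrt_mult)

lemma L2_norm_eq_0D:
  assumes "f \<in> L2 M" "L2_norm M f = 0"
  shows "AE x in M. f x = 0"
proof -
  have "(LINT x|M. (norm (f x))\<^sup>2) = 0" using assms(2) by (simp add: L2_norm_def)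
  then have "AE x in M. (norm (f x))\<^sup>2 = 0"
    by (subst (asm) integral_nonneg_eq_0_iff_AE) (use L2_integrable[OF assms(1)] in auto)
  then show ?thesis by simp
qed

text \<open>The polynomial \<open>t \<mapsto> \<integral> (norm f - t * norm g)\<^sup>2\<close> is nonnegative, so its discriminant is at most \<open>0\<close>.\<close>

lemma L2_norm_mult_le:
  fixes f :: "'a \<Rightarrow> 'b::euclidean_space" and g :: "'a \<Rightarrow> 'c::euclidean_space"
  assumes "f \<in> L2 M" "g \<in> L2 M"
  shows "(LINT x|M. norm (f x) * norm (g x)) \<le> L2_norm M f * L2_norm M g"
proof -
  define a where "a = (LINT x|M. (norm (f x))\<^sup>2)"
  define b where "b = (LINT x|M. (norm (g x))\<^sup>2)"
  define c where "c = (LINT x|M. norm (f x) * norm (g x))"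
  note int = L2_integrable[OF assms(1)] L2_integrable[OF assms(2)] L2_norm_integrable[OF assms]
  have quad: "0 \<le> a - 2 * t * c + t\<^sup>2 * b" for t
  proof -
    have "0 \<le> (LINT x|M. (norm (f x) - t * norm (g x))\<^sup>2)" by simp
    also have "\<dots> = (LINT x|M. (norm (f x))\<^sup>2 - 2 * t * (norm (f x) * norm (g x)) + t\<^sup>2 * (norm (g x))\<^sup>2)"
      by (simp add: power2_diff power_mult_distrib algebra_simps)
    also have "\<dots> = a - 2 * t * c + t\<^sup>2 * b"
      using int by (simp add: a_def b_def c_def)
    finally show ?thesis .
  qed
  have ab: "0 \<le> a" "0 \<le> b" by (auto simp: a_def b_def)
  have "c \<le> sqrt a * sqrt b"
  proof (cases "b = 0")
    case True
    have "c \<le> 0"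
    proof (rule ccontr)
      assume "\<not> c \<le> 0"
      then show False using quad[of "(a + 1) / (2 * c)"] True by (simp add: field_simps)
    qed
    then show ?thesis using True by simp
  next
    case False
    then have "0 < b" using ab by simp
    then have "c\<^sup>2 \<le> a * b" using quad[of "c / b"] by (simp add: field_simps power2_eq_square)
    then have "c \<le> sqrt (a * b)" by (rule real_le_rsqrt)
    then show ?thesis by (simp add: real_sqrt_mult)
  qed
  then show ?thesis by (simp add: a_def b_def c_def L2_norm_def)
qed

lemma L2_Cauchy_Schwarz:
  fixes f g :: "'a \<Rightarrow> 'b::euclidean_space"
  assumes "f \<in> L2 M" "g \<in> L2 M"
  shows "\<bar>LINT x|M. f x \<bullet> g x\<bar> \<le> L2_norm M f * L2_norm M g"
proof -
  have "\<bar>LINT x|M. f x \<bullet> g x\<bar> \<le> (LINT x|M. \<bar>f x \<bullet> g x\<bar>)"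
    by (rule integral_abs_bound)
  also have "\<dots> \<le> (LINT x|M. norm (f x) * norm (g x))"
    by (intro integral_mono integrable_abs L2_inner_integrable L2_norm_integrable assms)
      (simp add: Cauchy_Schwarz_ineq2)
  finally show ?thesis using L2_norm_mult_le[OF assms] by linarith
qed

lemma L2_norm_triangle:
  fixes f g :: "'a \<Rightarrow> 'b::euclidean_space"
  assumes "f \<in> L2 M" "g \<in> L2 M"
  shows "L2_norm M (\<lambda>x. f x + g x) \<le> L2_norm M f + L2_norm M g"
proof (rule power2_le_imp_le)
  have "(L2_norm M (\<lambda>x. f x + g x))\<^sup>2
      = (LINT x|M. (norm (f x))\<^sup>2 + (norm (g x))\<^sup>2 + 2 * (f x \<bullet> g x))"
    by (simp add: L2_norm_sq power2_norm_eq_inner algebra_simps inner_commute)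
  also have "\<dots> = (L2_norm M f)\<^sup>2 + (L2_norm M g)\<^sup>2 + 2 * (LINT x|M. f x \<bullet> g x)"
    using assms L2_inner_integrable[OF assms] by (simp add: L2_norm_sq L2_integrable)
  also have "\<dots> \<le> (L2_norm M f + L2_norm M g)\<^sup>2"
    using L2_Cauchy_Schwarz[OF assms] by (simp add: power2_sum)
  finally show "(L2_norm M (\<lambda>x. f x + g x))\<^sup>2 \<le> (L2_norm M f + L2_norm M g)\<^sup>2" .
qed simp

lemma L2_norm_diff_triangle:
  fixes f g h :: "'a \<Rightarrow> 'b::euclidean_space"
  assumes "f \<in> L2 M" "g \<in> L2 M" "h \<in> L2 M"
  shows "L2_norm M (\<lambda>x. f x - h x) \<le> L2_norm M (\<lambda>x. f x - g x) + L2_norm M (\<lambda>x. g x - h x)"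
  using L2_norm_triangle[OF L2_diff[OF assms(1,2)] L2_diff[OF assms(2,3)]] by simp

lemma L2_norm_sum_le:
  fixes f :: "'i \<Rightarrow> 'a \<Rightarrow> 'b::euclidean_space"
  assumes "\<And>i. i \<in> I \<Longrightarrow> f i \<in> L2 M"
  shows "L2_norm M (\<lambda>x. \<Sum>i\<in>I. f i x) \<le> (\<Sum>i\<in>I. L2_norm M (f i))"
  using assms
proof (induction I rule: infinite_finite_induct)
  case (insert i I)
  have "L2_norm M (\<lambda>x. f i x + (\<Sum>i\<in>I. f i x)) \<le> L2_norm M (f i) + L2_norm M (\<lambda>x. \<Sum>i\<in>I. f i x)"
    by (intro L2_norm_triangle L2_sum insert) auto
  then show ?case using insert by auto
qed auto

lemma L2_dist_sq_eq:
  assumes "(\<lambda>x. f x - g x) \<in> L2 M"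
  shows "L2_dist_sq M f g = ennreal ((L2_norm M (\<lambda>x. f x - g x))\<^sup>2)"
  unfolding L2_dist_sq_def L2_norm_sq
  by (rule nn_integral_eq_integral) (use L2_integrable[OF assms] in auto)

lemma L2I_nn_integral:
  assumes "f \<in> borel_measurable M" "(\<integral>\<^sup>+x. ennreal ((norm (f x))\<^sup>2) \<partial>M) < \<infinity>"
  shows "f \<in> L2 M"
  using assms unfolding L2_def by (auto intro!: integrableI_bounded)

text \<open>The Riesz-Fischer theorem.  Along a subsequence whose consecutive distances are at most \<open>(1/4)^k\<close>,
  the series of the functions \<open>4^k * d k\<close> has a finite integral, where \<open>d k\<close> is the square of the
  consecutive difference; so at almost every point its terms are bounded, the differences are at
  most a multiple of \<open>(1/2)^k\<close>, and the subsequence converges.  Fatou's lemma shows that the pointwise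
  limit is the limit in norm.\<close>

lemma L2_complete:
  fixes f :: "nat \<Rightarrow> 'a \<Rightarrow> 'b::euclidean_space"
  assumes f: "\<And>n. f n \<in> L2 M"
    and Cauchy: "\<And>e. 0 < e \<Longrightarrow> \<exists>N. \<forall>m\<ge>N. \<forall>n\<ge>N. L2_norm M (\<lambda>x. f m x - f n x) < e"
  shows "\<exists>g\<in>L2 M. (\<lambda>n. L2_norm M (\<lambda>x. f n x - g x)) \<longlonglongrightarrow> 0"
proof -
  note [measurable] = f[THEN L2_measurable]
  have "\<forall>k. \<exists>N. \<forall>m\<ge>N. \<forall>n\<ge>N. L2_norm M (\<lambda>x. f m x - f n x) < (1/4)^k"
    using Cauchy by auto
  then obtain N where N: "\<And>k m n. N k \<le> m \<Longrightarrow> N k \<le> n \<Longrightarrow> L2_norm M (\<lambda>x. f m x - f n x) < (1/4)^k"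
    by metis
  define r where "r k = k + (\<Sum>j\<le>k. N j)" for k
  have rN: "N k \<le> r k" "k \<le> r k" "N k \<le> r (Suc k)" for k
  proof -
    have "N k \<le> (\<Sum>j\<le>k. N j)" by (rule member_le_sum) auto
    then show "N k \<le> r k" "k \<le> r k" "N k \<le> r (Suc k)" by (auto simp: r_def)
  qed
  define d where "d k x = (norm (f (r (Suc k)) x - f (r k) x))\<^sup>2" for k x
  have [measurable]: "d k \<in> borel_measurable M" for k unfolding d_def by measurable
  \<comment> \<open>The exponents leave room: the weight \<open>4^k\<close> of the squared differences, whose
    integrals are at most \<open>(1/16)^k\<close>, still gives a convergent series.\<close>
  have d_int: "(\<integral>\<^sup>+x. ennreal (d k x) \<partial>M) \<le> ennreal ((1/16)^k)" for k
  proof -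
    have "(\<integral>\<^sup>+x. ennreal (d k x) \<partial>M) = ennreal ((L2_norm M (\<lambda>x. f (r (Suc k)) x - f (r k) x))\<^sup>2)"
      unfolding d_def using L2_dist_sq_eq[OF L2_diff[OF f f], of "r (Suc k)" "r k"] by (simp add: L2_dist_sq_def)
    also have "\<dots> \<le> ennreal (((1/4)^k)\<^sup>2)"
      by (intro ennreal_leI power_mono less_imp_le[OF N[OF rN(3) rN(1)]]) auto
    also have "((1/4)^k)\<^sup>2 = (1/16::real)^k" by (simp add: power2_eq_square flip: power_mult_distrib)
    finally show ?thesis .
  qed
  have "(\<integral>\<^sup>+x. (\<Sum>k. ennreal (4^k * d k x)) \<partial>M) = (\<Sum>k. \<integral>\<^sup>+x. ennreal (4^k * d k x) \<partial>M)"
    by (rule nn_integral_suminf) measurable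
  also have "\<dots> \<le> (\<Sum>k. ennreal ((1/4)^k))"
  proof (intro suminf_le summableI)
    fix k
    have "(\<integral>\<^sup>+x. ennreal (4^k * d k x) \<partial>M) = ennreal (4^k) * (\<integral>\<^sup>+x. ennreal (d k x) \<partial>M)"
      by (subst nn_integral_cmult[symmetric]) (auto simp: ennreal_mult' d_def)
    also have "\<dots> \<le> ennreal (4^k) * ennreal ((1/16)^k)" by (intro mult_left_mono d_int) simp
    also have "\<dots> = ennreal ((1/4)^k)" by (simp flip: ennreal_mult power_mult_distrib)
    finally show "(\<integral>\<^sup>+x. ennreal (4^k * d k x) \<partial>M) \<le> ennreal ((1/4)^k)" .
  qed
  also have "\<dots> = ennreal (\<Sum>k. (1/4)^k)" by (rule suminf_ennreal2) (auto intro: summable_geometric)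
  also have "\<dots> < \<infinity>" by simp
  finally have "(\<integral>\<^sup>+x. (\<Sum>k. ennreal (4^k * d k x)) \<partial>M) \<noteq> \<infinity>" by auto
  then have "AE x in M. (\<Sum>k. ennreal (4^k * d k x)) \<noteq> \<infinity>"
    by (intro nn_integral_PInf_AE) auto
  then have conv: "AE x in M. (\<lambda>k. f (r k) x) \<longlonglongrightarrow> lim (\<lambda>k. f (r k) x)"
  proof eventually_elim
    case (elim x)
    have bound: "4^k * d k x \<le> enn2real (\<Sum>k. ennreal (4^k * d k x))" for k
    proof -
      have "ennreal (4^k * d k x) \<le> (\<Sum>k. ennreal (4^k * d k x))"
        using sum_le_suminf[OF summableI, of "{k}" "\<lambda>k. ennreal (4^k * d k x)"] by simp
      then have "enn2real (ennreal (4^k * d k x)) \<le> enn2real (\<Sum>k. ennreal (4^k * d k x))"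
        using elim by (intro enn2real_mono) (auto simp: top.not_eq_extremum)
      then show ?thesis by (simp add: d_def)
    qed
    define C where "C = sqrt (enn2real (\<Sum>k. ennreal (4^k * d k x)))"
    have step: "norm (f (r (Suc k)) x - f (r k) x) \<le> C * (1/2)^k" for k
    proof -
      have "sqrt (4^k * d k x) \<le> C" using bound[of k] by (simp add: C_def)
      moreover have "sqrt (4^k * d k x) = 2^k * norm (f (r (Suc k)) x - f (r k) x)"
        by (simp add: d_def real_sqrt_mult real_sqrt_power)
      ultimately show ?thesis by (simp add: field_simps)
    qed
    have "summable (\<lambda>k. C * (1/2)^k)" by (intro summable_mult summable_geometric) auto
    then have "summable (\<lambda>k. f (r (Suc k)) x - f (r k) x)"
      by (rule summable_comparison_test[rotated]) (use step in auto)
    then have "convergent (\<lambda>n. \<Sum>k<n. f (r (Suc k)) x - f (r k) x)"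
      by (simp add: summable_iff_convergent)
    then have "convergent (\<lambda>n. f (r n) x - f (r 0) x)"
      by (simp add: sum_lessThan_telescope[of "\<lambda>k. f (r k) x"])
    then have "convergent (\<lambda>n. (f (r n) x - f (r 0) x) + f (r 0) x)"
      by (intro convergent_add convergent_const)
    then show ?case by (simp add: convergent_LIMSEQ_iff)
  qed
  \<comment> \<open>Where the subsequence diverges, \<open>lim\<close> has some fixed value; this concerns a
    null set only.\<close>
  define g where "g x = lim (\<lambda>k. f (r k) x)" for x
  have [measurable]: "g \<in> borel_measurable M" unfolding g_def by measurable
  have dist: "(\<lambda>x. f n x - g x) \<in> L2 M \<and> L2_norm M (\<lambda>x. f n x - g x) \<le> e"
    if e: "0 < e" and n: "\<forall>m\<ge>n. L2_norm M (\<lambda>x. f n x - f m x) < e" for e n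
  proof -
    have "(\<integral>\<^sup>+x. ennreal ((norm (f n x - g x))\<^sup>2) \<partial>M)
        = (\<integral>\<^sup>+x. liminf (\<lambda>k. ennreal ((norm (f n x - f (r k) x))\<^sup>2)) \<partial>M)"
    proof (rule nn_integral_cong_AE)
      show "AE x in M. ennreal ((norm (f n x - g x))\<^sup>2) = liminf (\<lambda>k. ennreal ((norm (f n x - f (r k) x))\<^sup>2))"
        using conv
      proof eventually_elim
        case (elim x)
        then have "(\<lambda>k. ennreal ((norm (f n x - f (r k) x))\<^sup>2)) \<longlonglongrightarrow> ennreal ((norm (f n x - g x))\<^sup>2)"
          unfolding g_def by (intro tendsto_ennrealI tendsto_intros)
        then show ?case by (rule lim_imp_Liminf[OF trivial_limit_sequentially, symmetric])
      qed
    qed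
    also have "\<dots> \<le> liminf (\<lambda>k. \<integral>\<^sup>+x. ennreal ((norm (f n x - f (r k) x))\<^sup>2) \<partial>M)"
      by (rule nn_integral_liminf) measurable
    also have "\<dots> \<le> ennreal (e\<^sup>2)"
    proof -
      have "eventually (\<lambda>k. (\<integral>\<^sup>+x. ennreal ((norm (f n x - f (r k) x))\<^sup>2) \<partial>M) \<le> ennreal (e\<^sup>2)) sequentially"
        using eventually_ge_at_top[of n]
      proof eventually_elim
        case (elim k)
        then have "n \<le> r k" using rN(2)[of k] by linarith
        then have "(L2_norm M (\<lambda>x. f n x - f (r k) x))\<^sup>2 \<le> e\<^sup>2"
          using n e by (intro power_mono) (auto simp: less_imp_le)
        then show ?case
          using L2_dist_sq_eq[OF L2_diff[OF f f], of n "r k"] by (simp add: L2_dist_sq_def)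
      qed
      then have "Liminf sequentially (\<lambda>k. \<integral>\<^sup>+x. ennreal ((norm (f n x - f (r k) x))\<^sup>2) \<partial>M)
          \<le> Liminf sequentially (\<lambda>k. ennreal (e\<^sup>2))" by (rule Liminf_mono)
      then show ?thesis by (simp add: Liminf_const)
    qed
    finally have le: "(\<integral>\<^sup>+x. ennreal ((norm (f n x - g x))\<^sup>2) \<partial>M) \<le> ennreal (e\<^sup>2)" .
    then have L2: "(\<lambda>x. f n x - g x) \<in> L2 M"
      by (intro L2I_nn_integral) (auto intro: le_less_trans)
    have "(L2_norm M (\<lambda>x. f n x - g x))\<^sup>2 \<le> e\<^sup>2"
      using le L2_dist_sq_eq[OF L2] by (simp add: L2_dist_sq_def)
    then show ?thesis using L2 e by (auto intro: power2_le_imp_le)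
  qed
  have g: "g \<in> L2 M"
  proof -
    obtain n where "\<forall>m\<ge>n. L2_norm M (\<lambda>x. f n x - f m x) < 1" using Cauchy[of 1] by auto
    then have "(\<lambda>x. f n x - g x) \<in> L2 M" using dist[of 1 n] by simp
    from L2_diff[OF f[of n] this] show ?thesis by simp
  qed
  moreover have "(\<lambda>n. L2_norm M (\<lambda>x. f n x - g x)) \<longlonglongrightarrow> 0"
  proof (rule LIMSEQ_I)
    fix e :: real assume "0 < e"
    then obtain n0 where n0: "\<forall>m\<ge>n0. \<forall>n\<ge>n0. L2_norm M (\<lambda>x. f m x - f n x) < e/2"
      using Cauchy[of "e/2"] by auto
    have "norm (L2_norm M (\<lambda>x. f n x - g x) - 0) < e" if "n0 \<le> n" for n
      using dist[of "e/2" n] n0 that \<open>0 < e\<close> by auto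
    then show "\<exists>n0. \<forall>n\<ge>n0. norm (L2_norm M (\<lambda>x. f n x - g x) - 0) < e" by blast
  qed
  ultimately show ?thesis by blast
qed

section \<open>Smooth functions and bumps on boxes\<close>

lemma Ck_on_SucD: "Ck_on (Suc k) f UNIV \<Longrightarrow> Ck_on k f UNIV"
proof (induction k arbitrary: f)
  case 0
  then show ?case
    by (auto intro!: continuous_at_imp_continuous_on differentiable_imp_continuous_within)
next
  case (Suc k)
  from Suc.prems have "Ck_on (Suc k) (\<lambda>x. frechet_derivative f (at x) b) UNIV" if "b \<in> Basis" for b
    using that by (subst (asm) Ck_on.simps) auto
  then show ?case using Suc.prems Suc.IH by (subst Ck_on.simps) auto
qed

lemma Ck_on_const: "Ck_on k (\<lambda>x. c) UNIV"
  by (induction k arbitrary: c) auto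

lemma Ck_on_lincomb:
  fixes f g :: "'a::euclidean_space \<Rightarrow> real"
  assumes "Ck_on k f UNIV" "Ck_on k g UNIV"
  shows "Ck_on k (\<lambda>x. a * f x + b * g x) UNIV"
  using assms
proof (induction k arbitrary: f g)
  case 0
  then show ?case by (auto intro!: continuous_intros)
next
  case (Suc k)
  have D: "((\<lambda>x. a * f x + b * g x) has_derivative
      (\<lambda>h. a * frechet_derivative f (at x) h + b * frechet_derivative g (at x) h)) (at x)" for x
    using Suc.prems by (auto intro!: derivative_intros simp flip: frechet_derivative_works)
  have "frechet_derivative (\<lambda>x. a * f x + b * g x) (at x) =
      (\<lambda>h. a * frechet_derivative f (at x) h + b * frechet_derivative g (at x) h)" for x
    using frechet_derivative_at[OF D] by simp
  moreover have "(\<lambda>x. a * f x + b * g x) differentiable (at x)" for x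
    using D unfolding differentiable_def by blast
  ultimately show ?case using Suc by auto
qed

lemma Ck_on_mult:
  fixes f g :: "'a::euclidean_space \<Rightarrow> real"
  assumes "Ck_on k f UNIV" "Ck_on k g UNIV"
  shows "Ck_on k (\<lambda>x. f x * g x) UNIV"
  using assms
proof (induction k arbitrary: f g)
  case 0
  then show ?case by (auto intro!: continuous_intros)
next
  case (Suc k)
  have D: "((\<lambda>x. f x * g x) has_derivative
      (\<lambda>h. f x * frechet_derivative g (at x) h + frechet_derivative f (at x) h * g x)) (at x)" for x
    using Suc.prems by (auto intro!: has_derivative_mult simp flip: frechet_derivative_works)
  have eq: "frechet_derivative (\<lambda>x. f x * g x) (at x) =
      (\<lambda>h. f x * frechet_derivative g (at x) h + frechet_derivative f (at x) h * g x)" for x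
    using frechet_derivative_at[OF D] by simp
  have "Ck_on k (\<lambda>x. 1 * (f x * frechet_derivative g (at x) b) + 1 * (frechet_derivative f (at x) b * g x)) UNIV"
    if "b \<in> Basis" for b
    by (intro Ck_on_lincomb Suc.IH) (use Suc.prems Ck_on_SucD[OF Suc.prems(1)] Ck_on_SucD[OF Suc.prems(2)] that in auto)
  moreover have "(\<lambda>x. f x * g x) differentiable (at x)" for x
    using D unfolding differentiable_def by blast
  ultimately show ?case by (auto simp: eq)
qed

lemma Ck_on_compose_affine:
  fixes g :: "real \<Rightarrow> real" and v :: "'a::euclidean_space"
  assumes "Ck_on k g UNIV"
  shows "Ck_on k (\<lambda>x. g (x \<bullet> v + d)) UNIV"
  using assms
proof (induction k arbitrary: g)
  case 0
  then show ?case
    by (auto intro!: continuous_intros continuous_on_compose2[of UNIV g])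
next
  case (Suc k)
  have D: "((\<lambda>x. g (x \<bullet> v + d)) has_derivative (\<lambda>h. frechet_derivative g (at (x \<bullet> v + d)) (h \<bullet> v))) (at x within UNIV)" for x
  proof (rule has_derivative_compose[where f="\<lambda>x. x \<bullet> v + d" and f'="\<lambda>h. h \<bullet> v" and g=g])
    show "((\<lambda>x. x \<bullet> v + d) has_derivative (\<lambda>h. h \<bullet> v)) (at x within UNIV)"
      by (auto intro!: derivative_eq_intros)
    show "(g has_derivative frechet_derivative g (at (x \<bullet> v + d))) (at (x \<bullet> v + d))"
      using Suc.prems by (simp flip: frechet_derivative_works)
  qed
  have lin: "frechet_derivative g (at y) (h \<bullet> v) = (h \<bullet> v) * frechet_derivative g (at y) 1" for y h
    using linear_scale[OF linear_frechet_derivative[of g "at y"], of "h \<bullet> v" 1] Suc.prems by simp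
  have "frechet_derivative (\<lambda>x. g (x \<bullet> v + d)) (at x) =
      (\<lambda>h. (h \<bullet> v) * frechet_derivative g (at (x \<bullet> v + d)) 1)" for x
    using frechet_derivative_at[OF D] lin by simp
  moreover have "Ck_on k (\<lambda>x. (b \<bullet> v) * frechet_derivative g (at (x \<bullet> v + d)) 1 + 0 * 0) UNIV" for b
    by (intro Ck_on_lincomb Suc.IH Ck_on_const) (use Suc.prems in auto)
  moreover have "(\<lambda>x. g (x \<bullet> v + d)) differentiable (at x)" for x
    using D unfolding differentiable_def by blast
  ultimately show ?case by auto
qed

lemma Ck_on_prod:
  fixes f :: "'i \<Rightarrow> 'a::euclidean_space \<Rightarrow> real"
  assumes "\<And>i. i \<in> I \<Longrightarrow> Ck_on k (f i) UNIV"
  shows "Ck_on k (\<lambda>x. \<Prod>i\<in>I. f i x) UNIV"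
  using assms by (induction I rule: infinite_finite_induct) (auto intro: Ck_on_const Ck_on_mult)

text \<open>For functions whose derivatives of every order are known explicitly.\<close>

lemma Ck_on_derivatives:
  fixes D :: "nat \<Rightarrow> real \<Rightarrow> real"
  assumes "\<And>n x. (D n has_real_derivative D (Suc n) x) (at x)"
  shows "Ck_on k (D n) UNIV"
proof (induction k arbitrary: n)
  case 0
  have "isCont (D n) x" for x using assms by (rule DERIV_isCont)
  then show ?case by (auto intro!: continuous_at_imp_continuous_on)
next
  case (Suc k)
  have "frechet_derivative (D n) (at x) = (*) (D (Suc n) x)" for x
    using frechet_derivative_at[OF has_field_derivative_imp_has_derivative[OF assms]] by simp
  moreover have "D n differentiable at x" for x
    using assms real_differentiable_def by blast
  ultimately show ?case using Suc by simp
qed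

definition flat :: "real \<Rightarrow> real" where
  "flat x = (if x \<le> 0 then 0 else exp (- (1 / x)))"

text \<open>The \<open>n\<close>-th derivative of \<open>exp (- (1 / x))\<close> is \<open>p (1 / x) * exp (- (1 / x))\<close> for a polynomial \<open>p\<close>.  The
  recursion comes from the product rule, since the derivative of \<open>X = 1 / x\<close> is \<open>- X\<^sup>2\<close>.\<close>

primrec flat_poly :: "nat \<Rightarrow> real poly" where
  "flat_poly 0 = 1"
| "flat_poly (Suc n) = [:0, 0, 1:] * (flat_poly n - pderiv (flat_poly n))"

definition flat_deriv :: "nat \<Rightarrow> real \<Rightarrow> real" where
  "flat_deriv n x = (if x \<le> 0 then 0 else poly (flat_poly n) (1 / x) * exp (- (1 / x)))"

lemma poly_exp_tendsto_0: "((\<lambda>x. poly p x * exp (- x)) \<longlongrightarrow> (0::real)) at_top"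
proof -
  have "((\<lambda>x. \<Sum>i\<le>degree p. coeff p i * (x ^ i / exp x)) \<longlongrightarrow> (\<Sum>i\<le>degree p. coeff p i * 0)) at_top"
    by (intro tendsto_intros tendsto_power_div_exp_0)
  moreover have "(\<Sum>i\<le>degree p. coeff p i * (x ^ i / exp x)) = poly p x * exp (- x)" for x
    by (simp add: poly_altdef sum_distrib_right exp_minus divide_inverse mult.assoc)
  ultimately show ?thesis by simp
qed

text \<open>At \<open>0\<close> the difference quotient from the right is a polynomial in \<open>1 / h\<close> times \<open>exp (- (1 / h))\<close>,
  which tends to \<open>0\<close>.\<close>

lemma flat_deriv_derivative: "(flat_deriv n has_real_derivative flat_deriv (Suc n) x) (at x)"
proof -
  consider "x < 0" | "x = 0" | "0 < x" by linarith
  then show ?thesis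
  proof cases
    case 1
    show ?thesis
      by (rule has_field_derivative_transform_within_open[of "\<lambda>_. 0" _ _ "{..<0}"])
        (use 1 in \<open>auto simp: flat_deriv_def\<close>)
  next
    case 2
    have "((\<lambda>h. poly ([:0, 1:] * flat_poly n) (inverse h) * exp (- inverse h)) \<longlongrightarrow> 0) (at_right 0)"
      by (rule filterlim_compose[OF poly_exp_tendsto_0 filterlim_inverse_at_top_right])
    then have "((\<lambda>h. (flat_deriv n h - flat_deriv n 0) / (h - 0)) \<longlongrightarrow> 0) (at_right 0)"
      by (rule Lim_transform_eventually)
        (auto simp: eventually_at_right_field flat_deriv_def divide_inverse intro!: exI[of _ 1])
    moreover have "((\<lambda>h. (flat_deriv n h - flat_deriv n 0) / (h - 0)) \<longlongrightarrow> 0) (at_left 0)"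
      by (rule Lim_transform_eventually[OF tendsto_const])
        (auto simp: eventually_at_left_field flat_deriv_def intro!: exI[of _ "-1"])
    ultimately show ?thesis
      using 2 by (simp add: has_field_derivative_iff filterlim_split_at flat_deriv_def)
  next
    case 3
    have "((\<lambda>x. poly (flat_poly n) (1 / x) * exp (- (1 / x))) has_real_derivative flat_deriv (Suc n) x) (at x)"
      using 3 by (auto intro!: derivative_eq_intros DERIV_chain2[OF poly_DERIV]
        simp: flat_deriv_def field_simps power2_eq_square)
    then show ?thesis
      by (rule has_field_derivative_transform_within_open[of _ _ _ "{0<..}"])
        (use 3 in \<open>auto simp: flat_deriv_def\<close>)
  qed
qed

lemma smooth_flat: "Ck_on k flat UNIV"
proof -
  have "flat = flat_deriv 0" by (auto simp: flat_def flat_deriv_def)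
  then show ?thesis using Ck_on_derivatives[of flat_deriv, OF flat_deriv_derivative, of k 0] by simp
qed

lemma flat_bounds: "0 \<le> flat x" "flat x \<le> 1" "flat x = 0 \<longleftrightarrow> x \<le> 0"
  by (auto simp: flat_def)

lemma flat_tendsto_1:
  assumes "0 < x"
  shows "(\<lambda>n. flat (real n * x - 1)) \<longlonglongrightarrow> 1"
proof -
  have *: "filterlim (\<lambda>n. real n * x - 1) at_top sequentially"
    using filterlim_tendsto_add_at_top[OF tendsto_const[of "-1"]
        filterlim_at_top_mult_tendsto_pos[OF tendsto_const assms filterlim_real_sequentially]] by simp
  have "((\<lambda>y::real. exp (- (inverse y))) \<longlongrightarrow> exp (- 0)) at_top"
    by (intro tendsto_intros tendsto_inverse_0_at_top filterlim_ident)
  then have "((\<lambda>y. exp (- (1 / y))) \<longlongrightarrow> (1::real)) at_top" by (simp add: inverse_eq_divide)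
  then have "(flat \<longlongrightarrow> 1) at_top"
    by (rule Lim_transform_eventually) (auto simp: flat_def intro!: eventually_mono[OF eventually_gt_at_top[of 0]])
  then show ?thesis using * by (rule filterlim_compose)
qed

text \<open>The shift by \<open>1\<close> keeps the support at distance \<open>1 / c\<close> from the faces of the box, so that it is a
  compact subset of the open box.  As \<open>c\<close> grows, the bumps tend to the indicator of the open box.\<close>

definition box_bump :: "real \<Rightarrow> 'a::euclidean_space \<Rightarrow> 'a \<Rightarrow> 'a \<Rightarrow> real" where
  "box_bump c a b x = (\<Prod>i\<in>Basis. flat (c * ((x - a) \<bullet> i) - 1) * flat (c * ((b - x) \<bullet> i) - 1))"

lemma smooth_box_bump: "smooth_on (box_bump c a b) UNIV"
proof -
  have "Ck_on k (\<lambda>x. \<Prod>i\<in>Basis. flat (x \<bullet> (c *\<^sub>R i) + (- c * (a \<bullet> i) - 1)) *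
      flat (x \<bullet> ((- c) *\<^sub>R i) + (c * (b \<bullet> i) - 1))) UNIV" for k
    by (intro Ck_on_prod Ck_on_mult Ck_on_compose_affine smooth_flat)
  moreover have "box_bump c a b = (\<lambda>x. \<Prod>i\<in>Basis. flat (x \<bullet> (c *\<^sub>R i) + (- c * (a \<bullet> i) - 1)) *
      flat (x \<bullet> ((- c) *\<^sub>R i) + (c * (b \<bullet> i) - 1)))"
    unfolding box_bump_def by (intro ext prod.cong refl arg_cong2[of _ _ _ _ "(*)"] arg_cong[of _ _ flat])
      (auto simp: algebra_simps)
  ultimately show ?thesis by (simp add: smooth_on_def)
qed

lemma box_bump_bounds: "0 \<le> box_bump c a b x" "box_bump c a b x \<le> 1"
  unfolding box_bump_def
  by (auto intro!: prod_nonneg prod_le_1 mult_nonneg_nonneg mult_le_one flat_bounds)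

lemma box_bump_support:
  assumes "0 < c" "box_bump c a b x \<noteq> 0"
  shows "x \<in> cbox (a + (1/c) *\<^sub>R One) (b - (1/c) *\<^sub>R One)"
proof -
  have "0 < c * ((x - a) \<bullet> i) - 1 \<and> 0 < c * ((b - x) \<bullet> i) - 1" if "i \<in> Basis" for i
    using assms(2) that flat_bounds(3) unfolding box_bump_def by (auto simp: not_le)
  then show ?thesis
    using assms(1) by (auto simp: mem_box inner_diff_left inner_add_left field_simps less_imp_le)
qed

lemma box_bump_test_function:
  assumes "0 < c" "box a b \<subseteq> S"
  shows "box_bump c a b \<in> test_functions S"
proof -
  have "cbox (a + (1/c) *\<^sub>R One) (b - (1/c) *\<^sub>R One) \<subseteq> box a b"
    using assms(1) by (auto simp: subset_box inner_diff_left inner_add_left)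
  then show ?thesis
    unfolding test_functions_def using smooth_box_bump[of c a b] box_bump_support[OF assms(1), of a b] assms(2)
      compact_cbox[of "a + (1/c) *\<^sub>R One" "b - (1/c) *\<^sub>R One"]
    by blast
qed

lemma box_bump_tendsto: "(\<lambda>n. box_bump (real (Suc n)) a b x) \<longlonglongrightarrow> indicator (box a b) x"
proof (cases "x \<in> box a b")
  case True
  have "(\<lambda>n. box_bump (real n) a b x) \<longlonglongrightarrow> (\<Prod>i\<in>(Basis::'a set). 1 * 1)"
    unfolding box_bump_def by (intro tendsto_prod tendsto_mult flat_tendsto_1)
      (use True in \<open>auto simp: mem_box inner_diff_left\<close>)
  then show ?thesis using True LIMSEQ_Suc[of "\<lambda>n. box_bump (real n) a b x"] by simp
next
  case False
  have "box_bump (real (Suc n)) a b x = 0" for n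
  proof (rule ccontr)
    assume "\<not> ?thesis"
    then have "x \<in> cbox (a + (1/real (Suc n)) *\<^sub>R One) (b - (1/real (Suc n)) *\<^sub>R One)"
      by (intro box_bump_support) auto
    also have "\<dots> \<subseteq> box a b" by (auto simp: subset_box inner_diff_left inner_add_left)
    finally show False using False by simp
  qed
  then show ?thesis using False by simp
qed

section \<open>Test functions\<close>

lemma smooth_on_continuous: "smooth_on f UNIV \<Longrightarrow> continuous_on UNIV f"
  unfolding smooth_on_def by (metis Ck_on.simps(1))

lemma smooth_on_differentiable: "smooth_on f UNIV \<Longrightarrow> f differentiable (at x)"
  unfolding smooth_on_def by (metis Ck_on.simps(2) UNIV_I)

lemma smooth_on_partial:
  assumes "smooth_on f UNIV" "b \<in> Basis"
  shows "smooth_on (\<lambda>x. frechet_derivative f (at x) b) UNIV"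
  unfolding smooth_on_def
proof
  fix k
  have "Ck_on (Suc k) f UNIV" using assms(1) by (simp add: smooth_on_def)
  then show "Ck_on k (\<lambda>x. frechet_derivative f (at x) b) UNIV" using assms(2) by simp
qed

lemma test_functions_partial:
  assumes "\<phi> \<in> test_functions S" "b \<in> Basis"
  shows "(\<lambda>x. frechet_derivative \<phi> (at x) b) \<in> test_functions S"
proof -
  obtain K where K: "smooth_on \<phi> UNIV" "compact K" "K \<subseteq> S" "\<And>x. x \<notin> K \<Longrightarrow> \<phi> x = 0"
    using assms(1) by (auto simp: test_functions_def)
  have "frechet_derivative \<phi> (at x) b = 0" if "x \<notin> K" for x
  proof -
    have "((\<lambda>_. 0) has_derivative (\<lambda>_. 0)) (at x)" by simp
    then have "(\<phi> has_derivative (\<lambda>_. 0)) (at x)"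
      by (rule has_derivative_transform_within_open[where s="- K"]) (use K that compact_imp_closed in auto)
    then show ?thesis using frechet_derivative_at by metis
  qed
  then show ?thesis
    using K smooth_on_partial[OF K(1) assms(2)] by (auto simp: test_functions_def)
qed

lemma test_functions_bounded:
  assumes "\<phi> \<in> test_functions S"
  obtains C where "\<And>x. \<bar>\<phi> x\<bar> \<le> C"
proof -
  obtain K where K: "smooth_on \<phi> UNIV" "compact K" "\<And>x. x \<notin> K \<Longrightarrow> \<phi> x = 0"
    using assms by (auto simp: test_functions_def)
  have "bounded (\<phi> ` K)"
    using continuous_on_subset[OF smooth_on_continuous[OF K(1)]] K(2)
    by (intro compact_imp_bounded compact_continuous_image) auto
  then obtain C where C: "\<And>x. x \<in> K \<Longrightarrow> \<bar>\<phi> x\<bar> \<le> C" by (auto simp: bounded_iff)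
  then have "\<bar>\<phi> x\<bar> \<le> max C 0" for x using K(3)[of x] C[of x] by (cases "x \<in> K") force+
  then show ?thesis using that by blast
qed

lemma continuous_measurable_lebesgue_on:
  assumes "continuous_on UNIV f"
  shows "f \<in> borel_measurable (lebesgue_on S)"
  using borel_measurable_continuous_onI[OF assms]
  by (intro measurable_restrict_space1) (auto intro: borel_measurable_if_I measurable_completion)

lemma L2_bounded_measurable:
  fixes f :: "'a::euclidean_space \<Rightarrow> 'b::euclidean_space"
  assumes "S \<in> lmeasurable" "f \<in> borel_measurable (lebesgue_on S)" "\<And>x. norm (f x) \<le> C"
  shows "f \<in> L2 (lebesgue_on S)"
proof (rule L2_dominated[where g="\<lambda>_. 1::real" and C=C])
  interpret finite_measure "lebesgue_on S" by (rule finite_measure_lebesgue_on[OF assms(1)])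
  show "(\<lambda>_. 1::real) \<in> L2 (lebesgue_on S)" by (simp add: L2_def)
qed (use assms in auto)

lemma test_functions_L2:
  assumes "\<phi> \<in> test_functions S" "\<Omega> \<in> lmeasurable"
  shows "\<phi> \<in> L2 (lebesgue_on \<Omega>)"
proof -
  obtain C where "\<And>x. \<bar>\<phi> x\<bar> \<le> C" using test_functions_bounded[OF assms(1)] by blast
  then show ?thesis
    using assms smooth_on_continuous continuous_measurable_lebesgue_on
    by (intro L2_bounded_measurable) (auto simp: test_functions_def)
qed

lemma L2_imp_integrable:
  fixes f :: "'a::euclidean_space \<Rightarrow> 'b::euclidean_space"
  assumes "S \<in> lmeasurable" "f \<in> L2 (lebesgue_on S)"
  shows "integrable (lebesgue_on S) f"
proof -
  have "(\<lambda>x. 1 :: real) \<in> L2 (lebesgue_on S)"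
    by (rule L2_bounded_measurable[OF assms(1), where C=1]) auto
  from L2_norm_integrable[OF assms(2) this] have "integrable (lebesgue_on S) (\<lambda>x. norm (f x))" by simp
  then show ?thesis by (rule integrable_norm_cancel) (rule L2_measurable[OF assms(2)])
qed

section \<open>Uniqueness and linearity of the weak gradient\<close>

text \<open>The bumps on a box are bounded by \<open>1\<close> and tend to its indicator, so the integral of \<open>g\<close> over every
  open box in \<open>\<Omega>\<close> vanishes.  The boxes are closed under intersection and generate the Borel sets, so
  the integral over every Borel subset of such a box vanishes.  This applies to the sets where a Borel
  version of \<open>g\<close> is positive or negative.\<close>

lemma fundamental_lemma_calculus_variations:
  fixes \<Omega> :: "'a::euclidean_space set" and g :: "'a \<Rightarrow> real"
  assumes "open \<Omega>" and g: "integrable (lebesgue_on \<Omega>) g"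
    and test: "\<And>\<phi>. \<phi> \<in> test_functions \<Omega> \<Longrightarrow> (LINT x|lebesgue_on \<Omega>. g x * \<phi> x) = 0"
  shows "AE x in lebesgue_on \<Omega>. g x = 0"
proof -
  have \<Omega>: "\<Omega> \<in> sets lebesgue" using assms(1) by (simp add: sets_completionI_sets)
  let ?M = "lebesgue_on \<Omega>"
  have bump_meas: "box_bump c a b \<in> borel_measurable ?M" for c and a b :: 'a
    by (rule continuous_measurable_lebesgue_on[OF smooth_on_continuous[OF smooth_box_bump]])
  have sets: "A \<inter> P \<in> sets ?M" if "A \<in> sets borel" "P \<in> sets borel" "P \<subseteq> \<Omega>" for A P
    using that \<Omega> by (auto simp: sets_restrict_space_iff sets_completionI_sets)
  have sint: "set_integrable ?M A g" if "A \<in> sets ?M" for A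
    unfolding set_integrable_def using that g by (rule integrable_mult_indicator)
  have box0: "(LINT x:box a b|?M. g x) = 0" if "box a b \<subseteq> \<Omega>" for a b
  proof -
    have "(\<lambda>n. LINT x|?M. g x * box_bump (real (Suc n)) a b x) \<longlonglongrightarrow> (LINT x|?M. g x * indicator (box a b) x)"
    proof (rule integral_dominated_convergence[where w="\<lambda>x. \<bar>g x\<bar>"])
      have [measurable]: "box a b \<in> sets ?M" using sets[of UNIV "box a b"] that by simp
      show "(\<lambda>x. g x * indicator (box a b) x) \<in> borel_measurable ?M" using g by measurable
      show "\<And>n. (\<lambda>x. g x * box_bump (real (Suc n)) a b x) \<in> borel_measurable ?M"
        using g bump_meas by auto
      show "AE x in ?M. (\<lambda>n. g x * box_bump (real (Suc n)) a b x) \<longlonglongrightarrow> g x * indicator (box a b) x"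
        by (intro AE_I2 tendsto_intros box_bump_tendsto)
      show "AE x in ?M. norm (g x * box_bump (real (Suc n)) a b x) \<le> \<bar>g x\<bar>" for n
        using box_bump_bounds[of "real (Suc n)" a b]
        by (intro AE_I2) (simp add: abs_mult mult_left_le abs_of_nonneg del: of_nat_Suc)
    qed (use g in auto)
    moreover have "(LINT x|?M. g x * box_bump (real (Suc n)) a b x) = 0" for n
      by (rule test[OF box_bump_test_function]) (use that in auto)
    ultimately have "(LINT x|?M. g x * indicator (box a b) x) = 0" by (simp add: LIMSEQ_const_iff)
    then show ?thesis by (simp add: set_lebesgue_integral_def mult.commute)
  qed
  \<comment> \<open>Complements and disjoint unions are taken inside a fixed box in \<open>\<Omega>\<close>,
    because \<open>\<Omega>\<close> itself need not be a box.\<close>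
  have borel0: "(LINT x:(A \<inter> box p q)|?M. g x) = 0" if P: "box p q \<subseteq> \<Omega>" and A: "A \<in> sets borel" for A p q
  proof -
    have "Int_stable (range (\<lambda>(a, b::'a). box a b))"
      by (auto simp: Int_stable_def box_Int_box)
    moreover have "range (\<lambda>(a, b::'a). box a b) \<subseteq> Pow UNIV" by auto
    moreover have "A \<in> sigma_sets UNIV (range (\<lambda>(a, b). box a b))"
      using A unfolding borel_eq_box by simp
    ultimately show ?thesis
    proof (induction rule: sigma_sets_induct_disjoint)
      case (basic A)
      then obtain a b where "A = box a b" by auto
      moreover obtain a' b' where "box a b \<inter> box p q = box a' b'"
        using box_Int_box[of a b p q] by blast
      moreover have "box a b \<inter> box p q \<subseteq> \<Omega>" using P by auto
      ultimately show ?case by (simp add: box0)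
    next
      case empty
      then show ?case by (simp add: set_lebesgue_integral_def)
    next
      case (compl A)
      then have A: "A \<in> sets borel" by (simp add: borel_eq_box)
      have "(LINT x:box p q|?M. g x) = (LINT x:(A \<inter> box p q) \<union> ((UNIV - A) \<inter> box p q)|?M. g x)"
        by (rule arg_cong[where f="\<lambda>S. LINT x:S|?M. g x"]) auto
      also have "\<dots> = (LINT x:(A \<inter> box p q)|?M. g x) + (LINT x:((UNIV - A) \<inter> box p q)|?M. g x)"
        by (rule set_integral_Un) (use A P in \<open>auto intro!: sint sets\<close>)
      finally show ?case using compl box0[OF P] by simp
    next
      case (union F)
      then have F: "F i \<in> sets borel" for i by (auto simp: borel_eq_box)
      have "(LINT x:(\<Union>i. F i \<inter> box p q)|?M. g x) = (\<Sum>i. LINT x:(F i \<inter> box p q)|?M. g x)"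
      proof (rule lebesgue_integral_countable_add)
        show "F i \<inter> box p q \<in> sets ?M" for i using sets[OF F _ P] by simp
        then have "(\<Union>i. F i \<inter> box p q) \<in> sets ?M" by blast
        then show "set_integrable ?M (\<Union>i. F i \<inter> box p q) g" by (rule sint)
      qed (use union(1) in \<open>auto simp: disjoint_family_on_def\<close>)
      then show ?case using union by simp
    qed
  qed
  have "(\<lambda>x. if x \<in> \<Omega> then g x else 0) \<in> borel_measurable lebesgue"
    using g \<Omega> by (simp add: borel_measurable_if borel_measurable_integrable)
  from completion_ex_borel_measurable_real[OF this] obtain g' where "g' \<in> borel_measurable lborel"
    and eq: "AE x in lborel. (if x \<in> \<Omega> then g x else 0) = g' x"
    by blast
  then have [measurable]: "g' \<in> borel_measurable borel" by simp
  have eq': "AE x in ?M. g x = g' x"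
  proof (subst AE_restrict_space_iff)
    show "\<Omega> \<inter> space lebesgue \<in> sets lebesgue" using \<Omega> by simp
    show "AE x in lebesgue. x \<in> \<Omega> \<longrightarrow> g x = g' x"
      using AE_completion[OF eq] by eventually_elim (auto split: if_splits)
  qed
  have on_box: "AE x in ?M. x \<in> box p q \<longrightarrow> g x = 0" if P: "box p q \<subseteq> \<Omega>" for p q
  proof -
    have sign: "AE x in ?M. x \<in> box p q \<longrightarrow> \<not> (0 < s * g x)" if s: "s = 1 \<or> s = -1" for s :: real
    proof -
      let ?A = "{x. 0 < s * g' x}"
      have A: "?A \<in> sets borel" by measurable
      then have AP: "?A \<inter> box p q \<in> sets ?M" using sets[OF A _ P] by simp
      let ?f = "\<lambda>x. s * (indicator (?A \<inter> box p q) x * g x)"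
      have int: "integrable ?M ?f"
        using sint[OF AP] by (simp add: set_integrable_def)
      have "integral\<^sup>L ?M ?f = s * (LINT x:(?A \<inter> box p q)|?M. g x)"
        by (simp add: set_lebesgue_integral_def)
      then have "integral\<^sup>L ?M ?f = 0" using borel0[OF P A] by simp
      moreover have "AE x in ?M. 0 \<le> ?f x"
        using eq'
      proof eventually_elim
        case (elim x)
        then show ?case by (cases "x \<in> ?A \<inter> box p q") (simp_all add: less_imp_le)
      qed
      ultimately have "AE x in ?M. ?f x = 0" using integral_nonneg_eq_0_iff_AE[OF int] by blast
      then show ?thesis using eq'
      proof eventually_elim
        case (elim x)
        then show ?case by (cases "x \<in> ?A \<inter> box p q") auto
      qed
    qed
    show ?thesis using sign[OF disjI1[OF refl]] sign[OF disjI2[OF refl]] by eventually_elim auto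
  qed
  obtain \<D> where \<D>: "countable \<D>" "\<And>X. X \<in> \<D> \<Longrightarrow> X \<subseteq> \<Omega>" "\<And>X. X \<in> \<D> \<Longrightarrow> \<exists>a b. X = box a b" "\<Union>\<D> = \<Omega>"
    by (rule open_countable_Union_open_box[OF assms(1)]) blast
  have "AE x in ?M. \<forall>X\<in>\<D>. x \<in> X \<longrightarrow> g x = 0"
  proof (subst AE_ball_countable[OF \<D>(1)], rule ballI)
    fix X assume "X \<in> \<D>"
    then obtain a b where "X = box a b" "box a b \<subseteq> \<Omega>" using \<D>(2,3) by blast
    then show "AE x in ?M. x \<in> X \<longrightarrow> g x = 0" using on_box by simp
  qed
  moreover have "AE x in ?M. x \<in> \<Omega>" using \<Omega> by (intro AE_I2) simp
  ultimately show ?thesis by eventually_elim (use \<D>(4) in blast)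
qed

text \<open>Hence statements about \<open>weak_grad\<close>, which is some weak gradient, can be checked on any other one.\<close>

lemma weak_grad_unique:
  assumes "open \<Omega>" "bounded \<Omega>" "is_weak_grad \<Omega> u G" "is_weak_grad \<Omega> u H"
  shows "AE x in lebesgue_on \<Omega>. G x = H x"
proof -
  have \<Omega>: "\<Omega> \<in> lmeasurable" using assms(2,1) by (rule lmeasurable_open)
  have L2: "G \<in> L2 (lebesgue_on \<Omega>)" "H \<in> L2 (lebesgue_on \<Omega>)" using assms(3,4) by (auto simp: is_weak_grad_def)
  have "AE x in lebesgue_on \<Omega>. (G x - H x) \<bullet> b = 0" if b: "b \<in> Basis" for b
  proof (rule fundamental_lemma_calculus_variations[OF assms(1)])
    show "integrable (lebesgue_on \<Omega>) (\<lambda>x. (G x - H x) \<bullet> b)"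
      by (rule L2_imp_integrable[OF \<Omega> L2_component[OF L2_diff[OF L2] b]])
    fix \<phi> assume \<phi>: "\<phi> \<in> test_functions \<Omega>"
    have int: "integrable (lebesgue_on \<Omega>) (\<lambda>x. (F x \<bullet> b) * \<phi> x)" if "F \<in> L2 (lebesgue_on \<Omega>)" for F
      by (rule L2_mult_integrable[OF L2_component[OF that b] test_functions_L2[OF \<phi> \<Omega>]])
    have "(LINT x|lebesgue_on \<Omega>. (G x \<bullet> b) * \<phi> x) = (LINT x|lebesgue_on \<Omega>. (H x \<bullet> b) * \<phi> x)"
      using assms(3,4) \<phi> b by (auto simp: is_weak_grad_def)
    then show "(LINT x|lebesgue_on \<Omega>. ((G x - H x) \<bullet> b) * \<phi> x) = 0"
      using int[OF L2(1)] int[OF L2(2)] by (simp add: inner_diff_left left_diff_distrib)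
  qed
  then have "AE x in lebesgue_on \<Omega>. \<forall>b\<in>Basis. (G x - H x) \<bullet> b = 0"
    by (subst AE_ball_countable) (auto simp: countable_finite)
  then show ?thesis by eventually_elim (metis euclidean_all_zero_iff right_minus_eq)
qed

lemma is_weak_grad_lincomb:
  assumes "\<Omega> \<in> lmeasurable" "u \<in> L2 (lebesgue_on \<Omega>)" "v \<in> L2 (lebesgue_on \<Omega>)"
    and "is_weak_grad \<Omega> u G" "is_weak_grad \<Omega> v H"
  shows "is_weak_grad \<Omega> (\<lambda>x. a * u x + b * v x) (\<lambda>x. a *\<^sub>R G x + b *\<^sub>R H x)"
proof -
  have L2: "G \<in> L2 (lebesgue_on \<Omega>)" "H \<in> L2 (lebesgue_on \<Omega>)" using assms(4,5) by (auto simp: is_weak_grad_def)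
  show ?thesis
    unfolding is_weak_grad_def
  proof (intro conjI ballI)
    show "(\<lambda>x. a *\<^sub>R G x + b *\<^sub>R H x) \<in> L2 (lebesgue_on \<Omega>)" by (intro L2_add L2_scaleR L2)
    fix \<phi> and c :: 'a assume \<phi>: "\<phi> \<in> test_functions \<Omega>" and c: "c \<in> Basis"
    note int = L2_mult_integrable[OF L2_component[OF L2(1) c] test_functions_L2[OF \<phi> assms(1)]]
      L2_mult_integrable[OF L2_component[OF L2(2) c] test_functions_L2[OF \<phi> assms(1)]]
      L2_mult_integrable[OF assms(2) test_functions_L2[OF test_functions_partial[OF \<phi> c] assms(1)]]
      L2_mult_integrable[OF assms(3) test_functions_L2[OF test_functions_partial[OF \<phi> c] assms(1)]]
    have "(LINT x|lebesgue_on \<Omega>. (a * u x + b * v x) * frechet_derivative \<phi> (at x) c)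
        = a * (LINT x|lebesgue_on \<Omega>. u x * frechet_derivative \<phi> (at x) c)
          + b * (LINT x|lebesgue_on \<Omega>. v x * frechet_derivative \<phi> (at x) c)"
      using int by (simp add: distrib_right mult.assoc)
    also have "\<dots> = - (LINT x|lebesgue_on \<Omega>. ((a *\<^sub>R G x + b *\<^sub>R H x) \<bullet> c) * \<phi> x)"
      using assms(4,5) \<phi> c int by (simp add: is_weak_grad_def distrib_right mult.assoc inner_add_left)
    finally show "(LINT x|lebesgue_on \<Omega>. (a * u x + b * v x) * frechet_derivative \<phi> (at x) c)
        = - (LINT x|lebesgue_on \<Omega>. ((a *\<^sub>R G x + b *\<^sub>R H x) \<bullet> c) * \<phi> x)" .
  qed
qed

lemma weak_grad_works: "u \<in> H1 \<Omega> \<Longrightarrow> is_weak_grad \<Omega> u (weak_grad \<Omega> u)"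
  unfolding H1_def weak_grad_def by (metis (mono_tags, lifting) mem_Collect_eq someI_ex)

lemma weak_grad_eq:
  assumes "open \<Omega>" "bounded \<Omega>" "u \<in> H1 \<Omega>" "is_weak_grad \<Omega> u G"
  shows "AE x in lebesgue_on \<Omega>. weak_grad \<Omega> u x = G x"
  using weak_grad_unique[OF assms(1,2) weak_grad_works[OF assms(3)] assms(4)] .

lemma weak_grad_L2: "u \<in> H1 \<Omega> \<Longrightarrow> weak_grad \<Omega> u \<in> L2 (lebesgue_on \<Omega>)"
  using weak_grad_works by (auto simp: is_weak_grad_def)

lemma H1_lincomb:
  assumes "open \<Omega>" "bounded \<Omega>" "u \<in> H1 \<Omega>" "v \<in> H1 \<Omega>"
  shows "(\<lambda>x. a * u x + b * v x) \<in> H1 \<Omega>"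
    and "AE x in lebesgue_on \<Omega>.
      weak_grad \<Omega> (\<lambda>x. a * u x + b * v x) x = a *\<^sub>R weak_grad \<Omega> u x + b *\<^sub>R weak_grad \<Omega> v x"
proof -
  have \<Omega>: "\<Omega> \<in> lmeasurable" using assms(2,1) by (rule lmeasurable_open)
  have L2: "u \<in> L2 (lebesgue_on \<Omega>)" "v \<in> L2 (lebesgue_on \<Omega>)" using assms(3,4) by (auto simp: H1_def)
  note wg = is_weak_grad_lincomb[OF \<Omega> L2 weak_grad_works[OF assms(3)] weak_grad_works[OF assms(4)]]
  show H1: "(\<lambda>x. a * u x + b * v x) \<in> H1 \<Omega>"
    using wg L2_add[OF L2_cmult[OF L2(1)] L2_cmult[OF L2(2)]] by (auto simp: H1_def)
  show "AE x in lebesgue_on \<Omega>.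
      weak_grad \<Omega> (\<lambda>x. a * u x + b * v x) x = a *\<^sub>R weak_grad \<Omega> u x + b *\<^sub>R weak_grad \<Omega> v x"
    using weak_grad_eq[OF assms(1,2) H1 wg] .
qed

section \<open>Superposition of weak solutions\<close>

lemma lmeasurable_open_interval: "{0<..<T::real} \<in> lmeasurable"
  by (rule lmeasurable_open) auto

lemma pair_sigma_finite_cylinder:
  assumes "A \<in> lmeasurable"
  shows "pair_sigma_finite (lebesgue_on A) (lebesgue_on {0<..<T::real})"
proof -
  interpret M1: finite_measure "lebesgue_on A" by (rule finite_measure_lebesgue_on[OF assms])
  interpret M2: finite_measure "lebesgue_on {0<..<T}"
    by (rule finite_measure_lebesgue_on[OF lmeasurable_open_interval])
  show ?thesis ..
qed

text \<open>Stated for measurable functions and distances that may be infinite: the smooth functions which define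
  a trace are close to it in \<open>L2\<close> of the boundary, but only eventually at a finite distance.\<close>

lemma L2_dist_sq_lincomb_le:
  fixes f g f' g' :: "'a \<Rightarrow> 'b::euclidean_space"
  assumes [measurable]: "f \<in> borel_measurable M" "g \<in> borel_measurable M"
    "f' \<in> borel_measurable M" "g' \<in> borel_measurable M"
  shows "L2_dist_sq M (\<lambda>x. a *\<^sub>R f x + b *\<^sub>R f' x) (\<lambda>x. a *\<^sub>R g x + b *\<^sub>R g' x)
    \<le> ennreal (2 * a\<^sup>2) * L2_dist_sq M f g + ennreal (2 * b\<^sup>2) * L2_dist_sq M f' g'"
proof -
  have *: "(norm (a *\<^sub>R X + b *\<^sub>R Y))\<^sup>2 \<le> 2 * a\<^sup>2 * (norm X)\<^sup>2 + 2 * b\<^sup>2 * (norm Y)\<^sup>2" for X Y :: 'b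
  proof -
    have "(norm (a *\<^sub>R X + b *\<^sub>R Y))\<^sup>2 \<le> (norm (a *\<^sub>R X) + norm (b *\<^sub>R Y))\<^sup>2"
      by (intro power_mono norm_triangle_ineq) simp
    also have "\<dots> \<le> 2 * (norm (a *\<^sub>R X))\<^sup>2 + 2 * (norm (b *\<^sub>R Y))\<^sup>2"
      using sum_squares_bound[of "norm (a *\<^sub>R X)" "norm (b *\<^sub>R Y)"] by (simp add: power2_sum)
    finally show ?thesis by (simp add: power_mult_distrib)
  qed
  have "L2_dist_sq M (\<lambda>x. a *\<^sub>R f x + b *\<^sub>R f' x) (\<lambda>x. a *\<^sub>R g x + b *\<^sub>R g' x)
      \<le> (\<integral>\<^sup>+x. ennreal (2 * a\<^sup>2) * ennreal ((norm (f x - g x))\<^sup>2)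
           + ennreal (2 * b\<^sup>2) * ennreal ((norm (f' x - g' x))\<^sup>2) \<partial>M)"
    unfolding L2_dist_sq_def
  proof (rule nn_integral_mono)
    fix x
    have eq: "a *\<^sub>R f x + b *\<^sub>R f' x - (a *\<^sub>R g x + b *\<^sub>R g' x) = a *\<^sub>R (f x - g x) + b *\<^sub>R (f' x - g' x)"
      by (simp add: algebra_simps)
    have "ennreal ((norm (a *\<^sub>R f x + b *\<^sub>R f' x - (a *\<^sub>R g x + b *\<^sub>R g' x)))\<^sup>2)
        \<le> ennreal (2 * a\<^sup>2 * (norm (f x - g x))\<^sup>2 + 2 * b\<^sup>2 * (norm (f' x - g' x))\<^sup>2)"
      unfolding eq by (rule ennreal_leI[OF *])
    then show "ennreal ((norm (a *\<^sub>R f x + b *\<^sub>R f' x - (a *\<^sub>R g x + b *\<^sub>R g' x)))\<^sup>2)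
        \<le> ennreal (2 * a\<^sup>2) * ennreal ((norm (f x - g x))\<^sup>2)
          + ennreal (2 * b\<^sup>2) * ennreal ((norm (f' x - g' x))\<^sup>2)"
      by (simp add: ennreal_mult')
  qed
  also have "\<dots> = ennreal (2 * a\<^sup>2) * L2_dist_sq M f g + ennreal (2 * b\<^sup>2) * L2_dist_sq M f' g'"
    unfolding L2_dist_sq_def
    by (subst nn_integral_add) (auto simp: nn_integral_cmult)
  finally show ?thesis .
qed

lemma L2_dist_sq_lincomb_tendsto:
  fixes f f' :: "'s \<Rightarrow> 'a \<Rightarrow> 'b::euclidean_space" and g g' :: "'a \<Rightarrow> 'b"
  assumes "\<forall>\<^sub>F k in F. f k \<in> borel_measurable M \<and> f' k \<in> borel_measurable M"
    and "g \<in> borel_measurable M" "g' \<in> borel_measurable M"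
    and lim: "((\<lambda>k. L2_dist_sq M (f k) g) \<longlongrightarrow> 0) F" "((\<lambda>k. L2_dist_sq M (f' k) g') \<longlongrightarrow> 0) F"
  shows "((\<lambda>k. L2_dist_sq M (\<lambda>x. a *\<^sub>R f k x + b *\<^sub>R f' k x) (\<lambda>x. a *\<^sub>R g x + b *\<^sub>R g' x)) \<longlongrightarrow> 0) F"
proof (rule tendsto_sandwich[OF _ _ tendsto_const])
  have "((\<lambda>k. ennreal (2 * a\<^sup>2) * L2_dist_sq M (f k) g + ennreal (2 * b\<^sup>2) * L2_dist_sq M (f' k) g')
      \<longlongrightarrow> ennreal (2 * a\<^sup>2) * 0 + ennreal (2 * b\<^sup>2) * 0) F"
    by (intro tendsto_add ennreal_tendsto_cmult lim) auto
  then show "((\<lambda>k. ennreal (2 * a\<^sup>2) * L2_dist_sq M (f k) g + ennreal (2 * b\<^sup>2) * L2_dist_sq M (f' k) g')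
      \<longlongrightarrow> 0) F" by simp
  show "\<forall>\<^sub>F k in F. L2_dist_sq M (\<lambda>x. a *\<^sub>R f k x + b *\<^sub>R f' k x) (\<lambda>x. a *\<^sub>R g x + b *\<^sub>R g' x)
      \<le> ennreal (2 * a\<^sup>2) * L2_dist_sq M (f k) g + ennreal (2 * b\<^sup>2) * L2_dist_sq M (f' k) g'"
    using assms(1) by eventually_elim (intro L2_dist_sq_lincomb_le, use assms(2,3) in auto)
qed auto

lemma C_L2_L2: "\<lbrakk>y \<in> C_L2 \<Omega> T; t \<in> {0..T}\<rbrakk> \<Longrightarrow> y t \<in> L2 (lebesgue_on \<Omega>)"
  by (simp add: C_L2_def)

lemma C_L2_tendsto:
  assumes "y \<in> C_L2 \<Omega> T" "t \<in> {0..T}"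
  shows "((\<lambda>s. L2_norm (lebesgue_on \<Omega>) (\<lambda>x. y s x - y t x)) \<longlongrightarrow> 0) (at t within {0..T})"
proof -
  have ev: "\<forall>\<^sub>F s in at t within {0..T}. L2_dist_sq (lebesgue_on \<Omega>) (y s) (y t)
      = ennreal ((L2_norm (lebesgue_on \<Omega>) (\<lambda>x. y s x - y t x))\<^sup>2)"
    unfolding eventually_at_filter
    by (auto intro!: always_eventually L2_dist_sq_eq L2_diff C_L2_L2[OF assms(1)] assms(2))
  have "((\<lambda>s. L2_dist_sq (lebesgue_on \<Omega>) (y s) (y t)) \<longlongrightarrow> 0) (at t within {0..T})"
    using assms by (auto simp: C_L2_def)
  then have "((\<lambda>s. ennreal ((L2_norm (lebesgue_on \<Omega>) (\<lambda>x. y s x - y t x))\<^sup>2)) \<longlongrightarrow> ennreal 0) (at t within {0..T})"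
    by (simp add: tendsto_cong[OF ev])
  then have "((\<lambda>s. (L2_norm (lebesgue_on \<Omega>) (\<lambda>x. y s x - y t x))\<^sup>2) \<longlongrightarrow> 0) (at t within {0..T})"
    by (subst (asm) tendsto_ennreal_iff) auto
  then have "((\<lambda>s. sqrt ((L2_norm (lebesgue_on \<Omega>) (\<lambda>x. y s x - y t x))\<^sup>2)) \<longlongrightarrow> sqrt 0) (at t within {0..T})"
    by (rule tendsto_real_sqrt)
  then show ?thesis by simp
qed

lemma C_L2_lincomb:
  assumes "y \<in> C_L2 \<Omega> T" "z \<in> C_L2 \<Omega> T"
  shows "(\<lambda>t x. a * y t x + b * z t x) \<in> C_L2 \<Omega> T"
  unfolding C_L2_def
proof (intro CollectI ballI conjI)
  fix t assume t: "t \<in> {0..T}"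
  note L2 = C_L2_L2[OF assms(1)] C_L2_L2[OF assms(2)]
  show "(\<lambda>x. a * y t x + b * z t x) \<in> L2 (lebesgue_on \<Omega>)"
    by (intro L2_add L2_cmult L2 t)
  have "((\<lambda>s. L2_dist_sq (lebesgue_on \<Omega>) (\<lambda>x. a *\<^sub>R y s x + b *\<^sub>R z s x) (\<lambda>x. a *\<^sub>R y t x + b *\<^sub>R z t x)) \<longlongrightarrow> 0)
      (at t within {0..T})"
  proof (rule L2_dist_sq_lincomb_tendsto)
    show "\<forall>\<^sub>F s in at t within {0..T}. y s \<in> borel_measurable (lebesgue_on \<Omega>) \<and> z s \<in> borel_measurable (lebesgue_on \<Omega>)"
      unfolding eventually_at_filter by (auto intro!: always_eventually L2_measurable L2)
  qed (use assms t L2_measurable[OF L2(1)[OF t]] L2_measurable[OF L2(2)[OF t]] in \<open>auto simp: C_L2_def\<close>)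
  then show "((\<lambda>s. L2_dist_sq (lebesgue_on \<Omega>) (\<lambda>x. a * y s x + b * z s x) (\<lambda>x. a * y t x + b * z t x)) \<longlongrightarrow> 0)
      (at t within {0..T})" by simp
qed

lemma C_L2_inner_continuous:
  assumes "y \<in> C_L2 \<Omega> T" "\<phi> \<in> L2 (lebesgue_on \<Omega>)"
  shows "continuous_on {0..T} (\<lambda>t. LINT x|lebesgue_on \<Omega>. y t x * \<phi> x)"
  unfolding continuous_on_def
proof
  fix t assume t: "t \<in> {0..T}"
  let ?M = "lebesgue_on \<Omega>"
  have "((\<lambda>s. (LINT x|?M. y s x * \<phi> x) - (LINT x|?M. y t x * \<phi> x)) \<longlongrightarrow> 0) (at t within {0..T})"
  proof (rule Lim_null_comparison)
    show "((\<lambda>s. L2_norm ?M (\<lambda>x. y s x - y t x) * L2_norm ?M \<phi>) \<longlongrightarrow> 0) (at t within {0..T})"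
      by (rule tendsto_mult_left_zero[OF C_L2_tendsto[OF assms(1) t]])
    have "norm ((LINT x|?M. y s x * \<phi> x) - (LINT x|?M. y t x * \<phi> x)) \<le> L2_norm ?M (\<lambda>x. y s x - y t x) * L2_norm ?M \<phi>"
      if s: "s \<in> {0..T}" for s
    proof -
      have "(LINT x|?M. y s x * \<phi> x) - (LINT x|?M. y t x * \<phi> x) = (LINT x|?M. (y s x - y t x) * \<phi> x)"
        using L2_mult_integrable[OF C_L2_L2[OF assms(1) s] assms(2)]
          L2_mult_integrable[OF C_L2_L2[OF assms(1) t] assms(2)]
        by (simp add: left_diff_distrib)
      then show ?thesis
        using L2_Cauchy_Schwarz[OF L2_diff[OF C_L2_L2[OF assms(1) s] C_L2_L2[OF assms(1) t]] assms(2)]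
        by simp
    qed
    then show "\<forall>\<^sub>F s in at t within {0..T}. norm ((LINT x|?M. y s x * \<phi> x) - (LINT x|?M. y t x * \<phi> x))
        \<le> L2_norm ?M (\<lambda>x. y s x - y t x) * L2_norm ?M \<phi>"
      unfolding eventually_at_filter by (auto intro!: always_eventually)
  qed
  then show "((\<lambda>t. LINT x|?M. y t x * \<phi> x) \<longlongrightarrow> (LINT x|?M. y t x * \<phi> x)) (at t within {0..T})"
    by (rule LIM_zero_cancel)
qed

lemma continuous_on_interval_L2:
  fixes f :: "real \<Rightarrow> real"
  assumes "continuous_on {0..T} f"
  shows "f \<in> L2 (lebesgue_on {0<..<T})"
proof -
  have "bounded (f ` {0..T})"
    by (intro compact_imp_bounded compact_continuous_image assms) auto
  then obtain C where C: "\<And>x. x \<in> {0..T} \<Longrightarrow> \<bar>f x\<bar> \<le> C" by (force simp: bounded_iff)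
  show ?thesis
  proof (rule L2_dominated[where C=C])
    show "(\<lambda>_. 1::real) \<in> L2 (lebesgue_on {0<..<T})"
      by (rule L2_bounded_measurable[OF lmeasurable_open_interval, where C=1]) auto
    show "f \<in> borel_measurable (lebesgue_on {0<..<T})"
      by (intro continuous_imp_measurable_on_sets_lebesgue continuous_on_subset[OF assms]) auto
    show "AE x in lebesgue_on {0<..<T}. norm (f x) \<le> C * norm (1::real)"
      using C by (intro AE_I2) auto
  qed
qed

lemma test_function_deriv:
  assumes "\<psi> \<in> test_functions S"
  shows "deriv \<psi> \<in> test_functions S" "(\<psi> has_real_derivative deriv \<psi> t) (at t)"
proof -
  have D: "(\<psi> has_real_derivative deriv \<psi> t) (at t)" for t
    using assms smooth_on_differentiable[of \<psi> t]
    by (simp add: test_functions_def DERIV_deriv_iff_real_differentiable)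
  then show "(\<psi> has_real_derivative deriv \<psi> t) (at t)" .
  have "deriv \<psi> = (\<lambda>t. frechet_derivative \<psi> (at t) 1)"
    using frechet_derivative_at[OF has_field_derivative_imp_has_derivative[OF D]] by (metis mult.right_neutral)
  then show "deriv \<psi> \<in> test_functions S" using test_functions_partial[OF assms, of 1] by simp
qed

lemma test_function_L2_interval: "\<psi> \<in> test_functions S \<Longrightarrow> \<psi> \<in> L2 (lebesgue_on {0<..<T::real})"
  by (rule test_functions_L2[OF _ lmeasurable_open_interval])

lemma continuous_measurable_surface:
  assumes "continuous_on UNIV f"
  shows "f \<in> borel_measurable (surface_measure \<Omega>)"
proof -
  have "f \<in> borel_measurable (measure_of UNIV (sets borel) (hausdorff_outer (DIM('a) - 1)))"
    using borel_measurable_continuous_onI[OF assms] by (simp add: measurable_def space_measure_of_conv)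
  then show ?thesis
    unfolding surface_measure_def by (intro measurable_completion measurable_restrict_space1)
qed

text \<open>The smooth approximations are combined in the same way.  Their gradients converge to the combination
  of the weak gradients, which is the weak gradient of the combination by uniqueness.\<close>

lemma has_trace_lincomb:
  fixes \<Omega> :: "'a::euclidean_space set"
  assumes \<Omega>: "open \<Omega>" "bounded \<Omega>" and tr: "has_trace \<Omega> u \<tau>" "has_trace \<Omega> v \<sigma>"
  shows "has_trace \<Omega> (\<lambda>x. a * u x + b * v x) (\<lambda>x. a * \<tau> x + b * \<sigma> x)"
proof -
  let ?M = "lebesgue_on \<Omega>" and ?S = "surface_measure \<Omega>"
  obtain w where w: "\<And>k::nat. smooth_on (w k) UNIV"
      "(\<lambda>k. L2_dist_sq ?M (w k) u) \<longlonglongrightarrow> 0" "(\<lambda>k. L2_dist_sq ?M (grad (w k)) (weak_grad \<Omega> u)) \<longlonglongrightarrow> 0"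
      "(\<lambda>k. L2_dist_sq ?S (w k) \<tau>) \<longlonglongrightarrow> 0"
    using tr(1) by (auto simp: has_trace_def)
  obtain w' where w': "\<And>k::nat. smooth_on (w' k) UNIV"
      "(\<lambda>k. L2_dist_sq ?M (w' k) v) \<longlonglongrightarrow> 0" "(\<lambda>k. L2_dist_sq ?M (grad (w' k)) (weak_grad \<Omega> v)) \<longlonglongrightarrow> 0"
      "(\<lambda>k. L2_dist_sq ?S (w' k) \<sigma>) \<longlonglongrightarrow> 0"
    using tr(2) by (auto simp: has_trace_def)
  have H1: "u \<in> H1 \<Omega>" "v \<in> H1 \<Omega>" and L2S: "\<tau> \<in> L2 ?S" "\<sigma> \<in> L2 ?S"
    using tr by (auto simp: has_trace_def)
  have L2: "u \<in> L2 ?M" "v \<in> L2 ?M" using H1 by (auto simp: H1_def)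
  have grad_meas: "grad f \<in> borel_measurable ?M" if "smooth_on f UNIV" for f :: "'a \<Rightarrow> real"
    unfolding grad_def
    by (intro borel_measurable_sum borel_measurable_scaleR borel_measurable_const
        continuous_measurable_lebesgue_on smooth_on_continuous smooth_on_partial that)
  have grad_lin: "grad (\<lambda>x. a * w k x + b * w' k x) = (\<lambda>x. a *\<^sub>R grad (w k) x + b *\<^sub>R grad (w' k) x)" for k
  proof
    fix x
    have "((\<lambda>x. a * w k x + b * w' k x) has_derivative
        (\<lambda>h. a * frechet_derivative (w k) (at x) h + b * frechet_derivative (w' k) (at x) h)) (at x)"
      using smooth_on_differentiable[OF w(1)] smooth_on_differentiable[OF w'(1)]
      by (auto intro!: derivative_intros simp flip: frechet_derivative_works)
    from frechet_derivative_at[OF this, symmetric]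
    show "grad (\<lambda>x. a * w k x + b * w' k x) x = a *\<^sub>R grad (w k) x + b *\<^sub>R grad (w' k) x"
      by (simp add: grad_def scaleR_sum_right sum.distrib scaleR_add_left)
  qed
  have wg: "L2_dist_sq ?M f (weak_grad \<Omega> (\<lambda>x. a * u x + b * v x))
      = L2_dist_sq ?M f (\<lambda>x. a *\<^sub>R weak_grad \<Omega> u x + b *\<^sub>R weak_grad \<Omega> v x)" for f
    unfolding L2_dist_sq_def
    by (rule nn_integral_cong_AE) (use H1_lincomb(2)[OF \<Omega> H1, of a b] in \<open>eventually_elim, simp\<close>)
  have lim: "(\<lambda>k. L2_dist_sq ?M (\<lambda>x. a *\<^sub>R w k x + b *\<^sub>R w' k x) (\<lambda>x. a *\<^sub>R u x + b *\<^sub>R v x)) \<longlonglongrightarrow> 0"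
    by (rule L2_dist_sq_lincomb_tendsto[OF _ L2_measurable[OF L2(1)] L2_measurable[OF L2(2)] w(2) w'(2)])
      (intro always_eventually allI conjI continuous_measurable_lebesgue_on smooth_on_continuous w w')
  have limg: "(\<lambda>k. L2_dist_sq ?M (\<lambda>x. a *\<^sub>R grad (w k) x + b *\<^sub>R grad (w' k) x)
      (\<lambda>x. a *\<^sub>R weak_grad \<Omega> u x + b *\<^sub>R weak_grad \<Omega> v x)) \<longlonglongrightarrow> 0"
    by (rule L2_dist_sq_lincomb_tendsto[OF _ L2_measurable[OF weak_grad_L2[OF H1(1)]]
          L2_measurable[OF weak_grad_L2[OF H1(2)]] w(3) w'(3)])
      (intro always_eventually allI conjI grad_meas w w')
  have limS: "(\<lambda>k. L2_dist_sq ?S (\<lambda>x. a *\<^sub>R w k x + b *\<^sub>R w' k x) (\<lambda>x. a *\<^sub>R \<tau> x + b *\<^sub>R \<sigma> x)) \<longlonglongrightarrow> 0"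
    by (rule L2_dist_sq_lincomb_tendsto[OF _ L2_measurable[OF L2S(1)] L2_measurable[OF L2S(2)] w(4) w'(4)])
      (intro always_eventually allI conjI continuous_measurable_surface smooth_on_continuous w w')
  show ?thesis
    unfolding has_trace_def
  proof (intro conjI exI[of _ "\<lambda>k x. a * w k x + b * w' k x"] allI)
    show "(\<lambda>x. a * u x + b * v x) \<in> H1 \<Omega>" by (rule H1_lincomb(1)[OF \<Omega> H1])
    show "(\<lambda>x. a * \<tau> x + b * \<sigma> x) \<in> L2 ?S" by (intro L2_add L2_cmult L2S)
    show "smooth_on (\<lambda>x. a * w k x + b * w' k x) UNIV" for k
      using w(1) w'(1) by (auto simp: smooth_on_def intro: Ck_on_lincomb)
  qed (use lim limg limS in \<open>simp_all add: grad_lin wg\<close>)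
qed

lemma trace_eq_on_lincomb:
  assumes "open \<Omega>" "bounded \<Omega>" "trace_eq_on \<Omega> \<Gamma> u g" "trace_eq_on \<Omega> \<Gamma> v h"
  shows "trace_eq_on \<Omega> \<Gamma> (\<lambda>x. a * u x + b * v x) (\<lambda>x. a * g x + b * h x)"
proof -
  obtain \<tau> \<sigma> where *: "has_trace \<Omega> u \<tau>" "AE x in surface_measure \<Omega>. x \<in> \<Gamma> \<longrightarrow> \<tau> x = g x"
      "has_trace \<Omega> v \<sigma>" "AE x in surface_measure \<Omega>. x \<in> \<Gamma> \<longrightarrow> \<sigma> x = h x"
    using assms by (auto simp: trace_eq_on_def)
  from *(2,4) have "AE x in surface_measure \<Omega>. x \<in> \<Gamma> \<longrightarrow> a * \<tau> x + b * \<sigma> x = a * g x + b * h x"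
    by eventually_elim auto
  then show ?thesis
    using has_trace_lincomb[OF assms(1,2) *(1,3)] by (auto simp: trace_eq_on_def)
qed

lemma V_space_H1: "\<phi> \<in> V_space \<Omega> \<Gamma>1 \<Longrightarrow> \<phi> \<in> H1 \<Omega>"
  by (simp add: V_space_def)

lemma H1_L2: "\<phi> \<in> H1 \<Omega> \<Longrightarrow> \<phi> \<in> L2 (lebesgue_on \<Omega>)"
  by (simp add: H1_def)

lemma L2_cylinder_AE_section:
  fixes F :: "'a::euclidean_space \<times> real \<Rightarrow> 'b::euclidean_space"
  assumes "A \<in> lmeasurable" "F \<in> L2 (cylinder A T)"
  shows "AE t in lebesgue_on {0<..<T}. (\<lambda>x. F (x, t)) \<in> L2 (lebesgue_on A)"
proof -
  interpret pair_sigma_finite "lebesgue_on A" "lebesgue_on {0<..<T}"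
    by (rule pair_sigma_finite_cylinder[OF assms(1)])
  have "integrable (lebesgue_on A \<Otimes>\<^sub>M lebesgue_on {0<..<T}) (\<lambda>(x, t). (norm (F (x, t)))\<^sup>2)"
    using L2_integrable[OF assms(2)] by (simp add: cylinder_def case_prod_unfold)
  from AE_integrable_snd[OF this]
  show ?thesis using AE_space
  proof eventually_elim
    case (elim t)
    have "(\<lambda>x. F (x, t)) \<in> borel_measurable (lebesgue_on A)"
      using measurable_Pair1[OF L2_measurable[OF assms(2), unfolded cylinder_def] elim(2)] by simp
    then show ?case using elim(1) by (simp add: L2_def)
  qed
qed

text \<open>A weak solution in which the integral of the Neumann datum against the trace is replaced by an
  arbitrary functional \<open>l t\<close>.  Superposition then combines these functionals as numbers, whether or
  not the boundary integrals exist, and in the difference of two states they cancel.\<close>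

definition variational_solution ::
  "'a::euclidean_space set \<Rightarrow> 'a set \<Rightarrow> real \<Rightarrow> ('a \<times> real \<Rightarrow> real) \<Rightarrow> (real \<Rightarrow> ('a \<Rightarrow> real) \<Rightarrow> real) \<Rightarrow>
     ('a \<Rightarrow> real) \<Rightarrow> ('a \<times> real \<Rightarrow> real) \<Rightarrow> (real \<Rightarrow> 'a \<Rightarrow> real) \<Rightarrow> bool" where
  "variational_solution \<Omega> \<Gamma>1 T F l y0 g1 y \<longleftrightarrow>
     y \<in> C_L2 \<Omega> T \<and> y \<in> L2_H1 \<Omega> T \<and>
     (AE x in lebesgue_on \<Omega>. y 0 x = y0 x) \<and>
     (AE t in lebesgue_on {0<..<T}. trace_eq_on \<Omega> \<Gamma>1 (y t) (\<lambda>x. g1 (x, t))) \<and>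
     (\<exists>h\<in>L2_Vdual \<Omega> \<Gamma>1 T. is_time_derivative \<Omega> \<Gamma>1 T y h \<and>
        (AE t in lebesgue_on {0<..<T}. \<forall>\<phi>\<in>V_space \<Omega> \<Gamma>1.
           h t \<phi> + (LINT x|lebesgue_on \<Omega>. weak_grad \<Omega> (y t) x \<bullet> weak_grad \<Omega> \<phi> x) =
           (LINT x|lebesgue_on \<Omega>. F (x, t) * \<phi> x) + l t \<phi>))"

lemma weak_solution_imp_variational:
  assumes "weak_solution \<Omega> \<Gamma>1 \<Gamma>2 T F y0 g1 g2 y"
  shows "variational_solution \<Omega> \<Gamma>1 T F
    (\<lambda>t \<phi>. LINT x:\<Gamma>2|surface_measure \<Omega>. g2 (x, t) * boundary_trace \<Omega> \<phi> x) y0 g1 y"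
  using assms unfolding weak_solution_def variational_solution_def by blast

lemma L2_H1_lincomb:
  assumes \<Omega>: "open \<Omega>" "bounded \<Omega>" and y: "y \<in> L2_H1 \<Omega> T" "z \<in> L2_H1 \<Omega> T"
  shows "(\<lambda>t x. a * y t x + b * z t x) \<in> L2_H1 \<Omega> T"
proof -
  have lm: "\<Omega> \<in> lmeasurable" using \<Omega> by (simp add: lmeasurable_open)
  obtain G where G: "G \<in> L2 (cylinder \<Omega> T)"
      "AE t in lebesgue_on {0<..<T}. y t \<in> H1 \<Omega> \<and> is_weak_grad \<Omega> (y t) (\<lambda>x. G (x, t))"
    using y(1) by (auto simp: L2_H1_def)
  obtain H where H: "H \<in> L2 (cylinder \<Omega> T)"
      "AE t in lebesgue_on {0<..<T}. z t \<in> H1 \<Omega> \<and> is_weak_grad \<Omega> (z t) (\<lambda>x. H (x, t))"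
    using y(2) by (auto simp: L2_H1_def)
  have "(\<lambda>p. a * (\<lambda>(x, t). y t x) p + b * (\<lambda>(x, t). z t x) p) \<in> L2 (cylinder \<Omega> T)"
    using y by (intro L2_add L2_cmult) (auto simp: L2_H1_def)
  moreover have "(\<lambda>p. a * (\<lambda>(x, t). y t x) p + b * (\<lambda>(x, t). z t x) p) = (\<lambda>(x, t). a * y t x + b * z t x)"
    by auto
  moreover have "(\<lambda>p. a *\<^sub>R G p + b *\<^sub>R H p) \<in> L2 (cylinder \<Omega> T)"
    by (intro L2_add L2_scaleR G H)
  moreover have "AE t in lebesgue_on {0<..<T}. (\<lambda>x. a * y t x + b * z t x) \<in> H1 \<Omega> \<and>
      is_weak_grad \<Omega> (\<lambda>x. a * y t x + b * z t x) (\<lambda>x. a *\<^sub>R G (x, t) + b *\<^sub>R H (x, t))"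
    using G(2) H(2)
    by eventually_elim (intro conjI H1_lincomb(1)[OF \<Omega>] is_weak_grad_lincomb[OF lm]; simp add: H1_L2)
  ultimately show ?thesis unfolding L2_H1_def by (intro CollectI conjI exI[of _ "\<lambda>p. a *\<^sub>R G p + b *\<^sub>R H p"]) auto
qed

lemma L2_Vdual_lincomb:
  assumes "h \<in> L2_Vdual \<Omega> \<Gamma>1 T" "k \<in> L2_Vdual \<Omega> \<Gamma>1 T"
  shows "(\<lambda>t \<phi>. a * h t \<phi> + b * k t \<phi>) \<in> L2_Vdual \<Omega> \<Gamma>1 T"
proof -
  let ?I = "lebesgue_on {0<..<T}" and ?V = "V_space \<Omega> \<Gamma>1"
  let ?lin = "\<lambda>h t. \<forall>\<phi>\<in>?V. \<forall>\<theta>\<in>?V. \<forall>a b. h t (\<lambda>x. a * \<phi> x + b * \<theta> x) = a * h t \<phi> + b * h t \<theta>"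
  obtain m where m: "m \<in> L2 ?I" "AE t in ?I. ?lin h t \<and> (\<forall>\<phi>\<in>?V. \<bar>h t \<phi>\<bar> \<le> m t * H1_norm \<Omega> \<phi>)"
    using assms(1) unfolding L2_Vdual_def by blast
  obtain n where n: "n \<in> L2 ?I" "AE t in ?I. ?lin k t \<and> (\<forall>\<phi>\<in>?V. \<bar>k t \<phi>\<bar> \<le> n t * H1_norm \<Omega> \<phi>)"
    using assms(2) unfolding L2_Vdual_def by blast
  have meas: "(\<lambda>t. a * h t \<phi> + b * k t \<phi>) \<in> borel_measurable ?I" if "\<phi> \<in> ?V" for \<phi>
    using assms that by (auto simp: L2_Vdual_def intro!: borel_measurable_add borel_measurable_times)
  have L2: "(\<lambda>t. \<bar>a\<bar> * m t + \<bar>b\<bar> * n t) \<in> L2 ?I" by (intro L2_add L2_cmult m n)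
  have ae: "AE t in ?I. ?lin (\<lambda>t \<phi>. a * h t \<phi> + b * k t \<phi>) t \<and>
      (\<forall>\<phi>\<in>?V. \<bar>a * h t \<phi> + b * k t \<phi>\<bar> \<le> (\<bar>a\<bar> * m t + \<bar>b\<bar> * n t) * H1_norm \<Omega> \<phi>)"
    using m(2) n(2)
  proof eventually_elim
    case (elim t)
    have "\<bar>a * h t \<phi> + b * k t \<phi>\<bar> \<le> (\<bar>a\<bar> * m t + \<bar>b\<bar> * n t) * H1_norm \<Omega> \<phi>" if \<phi>: "\<phi> \<in> ?V" for \<phi>
    proof -
      have "\<bar>a * h t \<phi> + b * k t \<phi>\<bar> \<le> \<bar>a\<bar> * \<bar>h t \<phi>\<bar> + \<bar>b\<bar> * \<bar>k t \<phi>\<bar>"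
        by (metis abs_mult abs_triangle_ineq)
      also have "\<dots> \<le> \<bar>a\<bar> * (m t * H1_norm \<Omega> \<phi>) + \<bar>b\<bar> * (n t * H1_norm \<Omega> \<phi>)"
        using elim \<phi> by (intro add_mono mult_left_mono) auto
      finally show ?thesis by (simp add: algebra_simps)
    qed
    moreover have "?lin (\<lambda>t \<phi>. a * h t \<phi> + b * k t \<phi>) t"
      using elim by (simp add: algebra_simps)
    ultimately show ?case by blast
  qed
  show ?thesis unfolding L2_Vdual_def using meas L2 ae by blast
qed

lemma L2_Vdual_L2:
  assumes "h \<in> L2_Vdual \<Omega> \<Gamma>1 T" "\<phi> \<in> V_space \<Omega> \<Gamma>1"
  shows "(\<lambda>t. h t \<phi>) \<in> L2 (lebesgue_on {0<..<T})"
proof -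
  let ?I = "lebesgue_on {0<..<T}"
  obtain m where m: "m \<in> L2 ?I" "AE t in ?I. \<forall>\<phi>\<in>V_space \<Omega> \<Gamma>1. \<bar>h t \<phi>\<bar> \<le> m t * H1_norm \<Omega> \<phi>"
    using assms(1) unfolding L2_Vdual_def by (force elim: AE_mp)
  show ?thesis
  proof (rule L2_dominated[OF m(1), where C="H1_norm \<Omega> \<phi>"])
    show "(\<lambda>t. h t \<phi>) \<in> borel_measurable ?I" using assms by (simp add: L2_Vdual_def)
    show "AE t in ?I. norm (h t \<phi>) \<le> H1_norm \<Omega> \<phi> * norm (m t)"
      using m(2)
    proof eventually_elim
      case (elim t)
      then have "\<bar>h t \<phi>\<bar> \<le> m t * H1_norm \<Omega> \<phi>" using assms(2) by blast
      also have "\<dots> \<le> \<bar>m t\<bar> * H1_norm \<Omega> \<phi>" by (intro mult_right_mono) (auto simp: H1_norm_def)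
      finally show ?case by (simp add: mult.commute)
    qed
  qed
qed

lemma is_time_derivative_lincomb:
  assumes y: "y \<in> C_L2 \<Omega> T" "z \<in> C_L2 \<Omega> T"
    and h: "h \<in> L2_Vdual \<Omega> \<Gamma>1 T" "k \<in> L2_Vdual \<Omega> \<Gamma>1 T"
    and D: "is_time_derivative \<Omega> \<Gamma>1 T y h" "is_time_derivative \<Omega> \<Gamma>1 T z k"
  shows "is_time_derivative \<Omega> \<Gamma>1 T (\<lambda>t x. a * y t x + b * z t x) (\<lambda>t \<phi>. a * h t \<phi> + b * k t \<phi>)"
  unfolding is_time_derivative_def
proof (intro ballI)
  fix \<phi> \<psi> assume \<phi>: "\<phi> \<in> V_space \<Omega> \<Gamma>1" and \<psi>: "\<psi> \<in> test_functions {0<..<T}"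
  let ?I = "lebesgue_on {0<..<T}" and ?M = "lebesgue_on \<Omega>"
  have \<phi>L2: "\<phi> \<in> L2 ?M" using \<phi> by (simp add: V_space_H1 H1_L2)
  have int: "integrable ?I (\<lambda>t. (LINT x|?M. y t x * \<phi> x) * deriv \<psi> t)" if "y \<in> C_L2 \<Omega> T" for y
    by (rule L2_mult_integrable[OF continuous_on_interval_L2[OF C_L2_inner_continuous[OF that \<phi>L2]]
          test_function_L2_interval[OF test_function_deriv(1)[OF \<psi>]]])
  have int': "integrable ?I (\<lambda>t. h t \<phi> * \<psi> t)" if "h \<in> L2_Vdual \<Omega> \<Gamma>1 T" for h
    by (rule L2_mult_integrable[OF L2_Vdual_L2[OF that \<phi>] test_function_L2_interval[OF \<psi>]])
  have "(LINT t|?I. (LINT x|?M. (a * y t x + b * z t x) * \<phi> x) * deriv \<psi> t)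
      = (LINT t|?I. a * ((LINT x|?M. y t x * \<phi> x) * deriv \<psi> t) + b * ((LINT x|?M. z t x * \<phi> x) * deriv \<psi> t))"
  proof (rule Bochner_Integration.integral_cong[OF refl])
    fix t assume "t \<in> space ?I"
    then have t: "t \<in> {0..T}" by simp
    have "(LINT x|?M. (a * y t x + b * z t x) * \<phi> x) = a * (LINT x|?M. y t x * \<phi> x) + b * (LINT x|?M. z t x * \<phi> x)"
      using L2_mult_integrable[OF C_L2_L2[OF y(1) t] \<phi>L2] L2_mult_integrable[OF C_L2_L2[OF y(2) t] \<phi>L2]
      by (simp add: distrib_right mult.assoc)
    then show "(LINT x|?M. (a * y t x + b * z t x) * \<phi> x) * deriv \<psi> t
        = a * ((LINT x|?M. y t x * \<phi> x) * deriv \<psi> t) + b * ((LINT x|?M. z t x * \<phi> x) * deriv \<psi> t)"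
      by (simp add: algebra_simps)
  qed
  also have "\<dots> = a * (LINT t|?I. (LINT x|?M. y t x * \<phi> x) * deriv \<psi> t)
      + b * (LINT t|?I. (LINT x|?M. z t x * \<phi> x) * deriv \<psi> t)"
    using int[OF y(1)] int[OF y(2)] by simp
  also have "\<dots> = a * (- (LINT t|?I. h t \<phi> * \<psi> t)) + b * (- (LINT t|?I. k t \<phi> * \<psi> t))"
    using D \<phi> \<psi> unfolding is_time_derivative_def by simp
  also have "\<dots> = - (LINT t|?I. (a * h t \<phi> + b * k t \<phi>) * \<psi> t)"
    using int'[OF h(1)] int'[OF h(2)] by (simp add: distrib_right mult.assoc)
  finally show "(LINT t|?I. (LINT x|?M. (a * y t x + b * z t x) * \<phi> x) * deriv \<psi> t)
      = - (LINT t|?I. (a * h t \<phi> + b * k t \<phi>) * \<psi> t)" .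
qed

lemma variational_solution_superposition:
  fixes \<Omega> :: "'a::euclidean_space set"
  assumes \<Omega>: "open \<Omega>" "bounded \<Omega>"
    and F: "F \<in> L2 (cylinder \<Omega> T)" "F' \<in> L2 (cylinder \<Omega> T)"
    and y: "variational_solution \<Omega> \<Gamma>1 T F l y0 g1 y"
    and z: "variational_solution \<Omega> \<Gamma>1 T F' l' z0 g1' z"
  shows "variational_solution \<Omega> \<Gamma>1 T (\<lambda>p. a * F p + b * F' p) (\<lambda>t \<phi>. a * l t \<phi> + b * l' t \<phi>)
    (\<lambda>x. a * y0 x + b * z0 x) (\<lambda>p. a * g1 p + b * g1' p) (\<lambda>t x. a * y t x + b * z t x)"
proof -
  let ?I = "lebesgue_on {0<..<T}" and ?M = "lebesgue_on \<Omega>" and ?V = "V_space \<Omega> \<Gamma>1"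
  have lm: "\<Omega> \<in> lmeasurable" using \<Omega> by (simp add: lmeasurable_open)
  obtain h where h: "h \<in> L2_Vdual \<Omega> \<Gamma>1 T" "is_time_derivative \<Omega> \<Gamma>1 T y h"
    and heq: "AE t in ?I. \<forall>\<phi>\<in>?V. h t \<phi> + (LINT x|?M. weak_grad \<Omega> (y t) x \<bullet> weak_grad \<Omega> \<phi> x)
        = (LINT x|?M. F (x, t) * \<phi> x) + l t \<phi>"
    using y unfolding variational_solution_def by blast
  obtain k where k: "k \<in> L2_Vdual \<Omega> \<Gamma>1 T" "is_time_derivative \<Omega> \<Gamma>1 T z k"
    and keq: "AE t in ?I. \<forall>\<phi>\<in>?V. k t \<phi> + (LINT x|?M. weak_grad \<Omega> (z t) x \<bullet> weak_grad \<Omega> \<phi> x)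
        = (LINT x|?M. F' (x, t) * \<phi> x) + l' t \<phi>"
    using z unfolding variational_solution_def by blast
  have C: "y \<in> C_L2 \<Omega> T" "z \<in> C_L2 \<Omega> T" and LH: "y \<in> L2_H1 \<Omega> T" "z \<in> L2_H1 \<Omega> T"
    using y z by (auto simp: variational_solution_def)
  have H1: "AE t in ?I. y t \<in> H1 \<Omega>" "AE t in ?I. z t \<in> H1 \<Omega>"
    using LH by (auto simp: L2_H1_def elim: AE_mp)
  have eq: "AE t in ?I. \<forall>\<phi>\<in>?V. (a * h t \<phi> + b * k t \<phi>)
        + (LINT x|?M. weak_grad \<Omega> (\<lambda>x. a * y t x + b * z t x) x \<bullet> weak_grad \<Omega> \<phi> x)
      = (LINT x|?M. (a * F (x, t) + b * F' (x, t)) * \<phi> x) + (a * l t \<phi> + b * l' t \<phi>)"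
    using heq keq H1 L2_cylinder_AE_section[OF lm F(1)] L2_cylinder_AE_section[OF lm F(2)]
  proof eventually_elim
    case (elim t)
    show ?case
    proof
      fix \<phi> assume \<phi>: "\<phi> \<in> ?V"
      have \<phi>1: "\<phi> \<in> L2 ?M" "weak_grad \<Omega> \<phi> \<in> L2 ?M"
        using V_space_H1[OF \<phi>] by (auto simp: H1_L2 weak_grad_L2)
      note wg = weak_grad_L2[OF elim(3)] weak_grad_L2[OF elim(4)]
      have "(LINT x|?M. weak_grad \<Omega> (\<lambda>x. a * y t x + b * z t x) x \<bullet> weak_grad \<Omega> \<phi> x)
          = (LINT x|?M. (a *\<^sub>R weak_grad \<Omega> (y t) x + b *\<^sub>R weak_grad \<Omega> (z t) x) \<bullet> weak_grad \<Omega> \<phi> x)"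
      proof (rule integral_cong_AE)
        show "AE x in ?M. weak_grad \<Omega> (\<lambda>x. a * y t x + b * z t x) x \<bullet> weak_grad \<Omega> \<phi> x
            = (a *\<^sub>R weak_grad \<Omega> (y t) x + b *\<^sub>R weak_grad \<Omega> (z t) x) \<bullet> weak_grad \<Omega> \<phi> x"
          using H1_lincomb(2)[OF \<Omega> elim(3,4), of a b] by eventually_elim simp
      qed (intro borel_measurable_inner borel_measurable_add borel_measurable_scaleR borel_measurable_const
          L2_measurable wg \<phi>1 weak_grad_L2 H1_lincomb(1) \<Omega> elim)+
      also have "\<dots> = a * (LINT x|?M. weak_grad \<Omega> (y t) x \<bullet> weak_grad \<Omega> \<phi> x)
          + b * (LINT x|?M. weak_grad \<Omega> (z t) x \<bullet> weak_grad \<Omega> \<phi> x)"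
        using L2_inner_integrable[OF wg(1) \<phi>1(2)] L2_inner_integrable[OF wg(2) \<phi>1(2)]
        by (simp add: inner_add_left)
      finally have A: "(LINT x|?M. weak_grad \<Omega> (\<lambda>x. a * y t x + b * z t x) x \<bullet> weak_grad \<Omega> \<phi> x)
          = a * (LINT x|?M. weak_grad \<Omega> (y t) x \<bullet> weak_grad \<Omega> \<phi> x)
          + b * (LINT x|?M. weak_grad \<Omega> (z t) x \<bullet> weak_grad \<Omega> \<phi> x)" .
      have B: "(LINT x|?M. (a * F (x, t) + b * F' (x, t)) * \<phi> x)
          = a * (LINT x|?M. F (x, t) * \<phi> x) + b * (LINT x|?M. F' (x, t) * \<phi> x)"
        using L2_mult_integrable[OF elim(5) \<phi>1(1)] L2_mult_integrable[OF elim(6) \<phi>1(1)]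
        by (simp add: distrib_right mult.assoc)
      have E1: "h t \<phi> = (LINT x|?M. F (x, t) * \<phi> x) + l t \<phi> - (LINT x|?M. weak_grad \<Omega> (y t) x \<bullet> weak_grad \<Omega> \<phi> x)"
        using elim(1) \<phi> by (simp add: eq_diff_eq)
      have E2: "k t \<phi> = (LINT x|?M. F' (x, t) * \<phi> x) + l' t \<phi> - (LINT x|?M. weak_grad \<Omega> (z t) x \<bullet> weak_grad \<Omega> \<phi> x)"
        using elim(2) \<phi> by (simp add: eq_diff_eq)
      show "(a * h t \<phi> + b * k t \<phi>) + (LINT x|?M. weak_grad \<Omega> (\<lambda>x. a * y t x + b * z t x) x \<bullet> weak_grad \<Omega> \<phi> x)
          = (LINT x|?M. (a * F (x, t) + b * F' (x, t)) * \<phi> x) + (a * l t \<phi> + b * l' t \<phi>)"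
        unfolding A B E1 E2 by (simp add: algebra_simps)
    qed
  qed
  have init: "AE x in ?M. a * y 0 x + b * z 0 x = a * y0 x + b * z0 x"
  proof -
    have "AE x in ?M. y 0 x = y0 x" "AE x in ?M. z 0 x = z0 x"
      using y z unfolding variational_solution_def by blast+
    then show ?thesis by eventually_elim simp
  qed
  have bdry: "AE t in ?I. trace_eq_on \<Omega> \<Gamma>1 (\<lambda>x. a * y t x + b * z t x) (\<lambda>x. a * g1 (x, t) + b * g1' (x, t))"
  proof -
    have "AE t in ?I. trace_eq_on \<Omega> \<Gamma>1 (y t) (\<lambda>x. g1 (x, t))" "AE t in ?I. trace_eq_on \<Omega> \<Gamma>1 (z t) (\<lambda>x. g1' (x, t))"
      using y z unfolding variational_solution_def by blast+
    then show ?thesis by eventually_elim (rule trace_eq_on_lincomb[OF \<Omega>])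
  qed
  show ?thesis
    unfolding variational_solution_def
    using C_L2_lincomb[OF C] L2_H1_lincomb[OF \<Omega> LH] init bdry L2_Vdual_lincomb[OF h(1) k(1)]
      is_time_derivative_lincomb[OF C h(1) k(1) h(2) k(2)] eq
    by (intro conjI bexI[of _ "\<lambda>t \<phi>. a * h t \<phi> + b * k t \<phi>"])
qed

section \<open>Growth of a mollified kernel along the diagonal\<close>

lemma lebesgue_on_integral_le_lborel:
  fixes f :: "real \<Rightarrow> real"
  assumes "S \<in> sets lebesgue" "integrable lborel f" "\<And>x. 0 \<le> f x"
  shows "integrable (lebesgue_on S) f" "(LINT x|lebesgue_on S. f x) \<le> (LINT x|lborel. f x)"
    and "(\<And>x. x \<notin> S \<Longrightarrow> f x = 0) \<Longrightarrow> (LINT x|lebesgue_on S. f x) = (LINT x|lborel. f x)"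
proof -
  have leb: "integrable lebesgue f" "(LINT x|lebesgue. f x) = (LINT x|lborel. f x)"
    using assms(2) by (auto simp: integrable_completion integral_completion)
  have ind: "integrable lebesgue (\<lambda>x. indicator S x *\<^sub>R f x)"
    using leb(1) assms(1) by (intro integrable_mult_indicator) auto
  then show "integrable (lebesgue_on S) f"
    using assms(1) by (simp add: integrable_restrict_space)
  have eq: "(LINT x|lebesgue_on S. f x) = (LINT x|lebesgue. indicator S x *\<^sub>R f x)"
    using assms(1) by (simp add: integral_restrict_space)
  have "(LINT x|lebesgue. indicator S x *\<^sub>R f x) \<le> (LINT x|lebesgue. f x)"
    using ind leb(1) assms(3) by (intro integral_mono) (auto simp: indicator_def)
  then show "(LINT x|lebesgue_on S. f x) \<le> (LINT x|lborel. f x)" using eq leb by simp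
  show "(LINT x|lebesgue_on S. f x) = (LINT x|lborel. f x)" if "\<And>x. x \<notin> S \<Longrightarrow> f x = 0"
  proof -
    have "indicator S x *\<^sub>R f x = f x" for x using that[of x] by (cases "x \<in> S") auto
    then show ?thesis using eq leb(2) by (simp only:)
  qed
qed

text \<open>A bump on \<open>{- \<epsilon><..<\<epsilon>}\<close> divided by its integral.  Its integral is not \<open>0\<close>, since a nonnegative
  continuous function with integral \<open>0\<close> vanishes, while the bump is positive at \<open>0\<close>.\<close>

lemma mollifier_exists:
  fixes \<epsilon> :: real
  assumes "0 < \<epsilon>"
  obtains \<beta> :: "real \<Rightarrow> real" where "smooth_on \<beta> UNIV" "\<And>x. 0 \<le> \<beta> x" "\<And>x. \<epsilon> \<le> \<bar>x\<bar> \<Longrightarrow> \<beta> x = 0"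
    "integrable lborel \<beta>" "(LINT x|lborel. \<beta> x) = 1"
    "\<And>t T. \<lbrakk>\<epsilon> \<le> t; t \<le> T - \<epsilon>\<rbrakk> \<Longrightarrow> (\<lambda>r. \<beta> (r - t)) \<in> test_functions {0<..<T}"
proof -
  define b :: "real \<Rightarrow> real" where "b = box_bump (2 / \<epsilon>) (- \<epsilon>) \<epsilon>"
  have smooth: "smooth_on b UNIV" unfolding b_def by (rule smooth_box_bump)
  have cont: "continuous_on UNIV b" by (rule smooth_on_continuous[OF smooth])
  have nonneg: "0 \<le> b x" for x by (simp add: b_def box_bump_bounds)
  have supp: "b x = 0" if "\<epsilon> \<le> \<bar>x\<bar>" for x
  proof (rule ccontr)
    assume "b x \<noteq> 0"
    then have "x \<in> cbox (- \<epsilon> + (1 / (2/\<epsilon>)) *\<^sub>R One) (\<epsilon> - (1 / (2/\<epsilon>)) *\<^sub>R One)"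
      unfolding b_def by (rule box_bump_support[rotated]) (use assms in simp)
    then show False using that assms by (auto simp: abs_if split: if_splits)
  qed
  have "integrable lborel (\<lambda>x. indicator {-\<epsilon>..\<epsilon>} x *\<^sub>R b x)"
    by (rule borel_integrable_compact) (use continuous_on_subset[OF cont] in auto)
  moreover have "(\<lambda>x. indicator {-\<epsilon>..\<epsilon>} x *\<^sub>R b x) = b"
  proof
    show "indicator {-\<epsilon>..\<epsilon>} x *\<^sub>R b x = b x" for x
      using supp[of x] by (cases "\<epsilon> \<le> \<bar>x\<bar>") (auto simp: indicator_def)
  qed
  ultimately have int: "integrable lborel b" by simp
  define m where "m = (LINT x|lborel. b x)"
  have "m \<noteq> 0"
  proof
    assume "m = 0"
    then have "(b has_integral 0) UNIV"
      using has_integral_integral_lborel[OF int] by (simp add: m_def)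
    moreover have "b = (\<lambda>x. if x \<in> cbox (-\<epsilon>) \<epsilon> then b x else 0)"
    proof
      show "b x = (if x \<in> cbox (-\<epsilon>) \<epsilon> then b x else 0)" for x
        using supp[of x] by (cases "\<epsilon> \<le> \<bar>x\<bar>") auto
    qed
    ultimately have "(b has_integral 0) (cbox (-\<epsilon>) \<epsilon>)"
      using has_integral_restrict_UNIV[of "cbox (-\<epsilon>) \<epsilon>" b 0] by simp
    then have "b 0 = 0"
      by (intro has_integral_0_cbox_imp_0[of "-\<epsilon>" \<epsilon> b])
        (use assms nonneg continuous_on_subset[OF cont] in \<open>auto simp: box_real\<close>)
    then show False using assms by (simp add: b_def box_bump_def flat_bounds)
  qed
  moreover have "0 \<le> m" unfolding m_def by (simp add: nonneg)
  ultimately have m: "0 < m" by simp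
  show ?thesis
  proof (rule that[of "\<lambda>x. b x / m"])
    show "smooth_on (\<lambda>x. b x / m) UNIV"
      unfolding smooth_on_def
    proof
      fix k
      have "Ck_on k (\<lambda>x. (1/m) * b x + 0 * b x) UNIV"
        by (intro Ck_on_lincomb) (use smooth in \<open>auto simp: smooth_on_def\<close>)
      then show "Ck_on k (\<lambda>x. b x / m) UNIV" by simp
    qed
    show "(\<lambda>r. b (r - t) / m) \<in> test_functions {0<..<T}" if "\<epsilon> \<le> t" "t \<le> T - \<epsilon>" for t T
    proof -
      have "box_bump (2/\<epsilon>) (t - \<epsilon>) (t + \<epsilon>) \<in> test_functions {0<..<T}"
        by (rule box_bump_test_function) (use that assms in \<open>auto simp: box_real\<close>)
      moreover have shift: "box_bump (2/\<epsilon>) (t - \<epsilon>) (t + \<epsilon>) = (\<lambda>r. b (r - t))"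
        by (simp add: fun_eq_iff b_def box_bump_def algebra_simps)
      moreover have "Ck_on k (\<lambda>r. (1/m) * b (r - t) + 0 * b (r - t)) UNIV" for k
        unfolding shift[symmetric] fun_cong[OF shift, symmetric]
        by (intro Ck_on_lincomb) (use smooth_box_bump in \<open>auto simp: smooth_on_def\<close>)
      ultimately show ?thesis by (auto simp: test_functions_def smooth_on_def)
    qed
  qed (use nonneg supp int m in \<open>auto simp: m_def\<close>)
qed

lemma continuous_on_kernel_compose:
  fixes k :: "'a::topological_space \<Rightarrow> 'a \<Rightarrow> 'b::topological_space"
  assumes "continuous_on (A \<times> A) (\<lambda>(r, s). k r s)" "continuous_on S f" "continuous_on S g"
    and "\<And>x. x \<in> S \<Longrightarrow> f x \<in> A \<and> g x \<in> A"
  shows "continuous_on S (\<lambda>x. k (f x) (g x))"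
proof -
  have "(\<lambda>x. (f x, g x)) ` S \<subseteq> A \<times> A" using assms(4) by blast
  from continuous_on_compose2[OF assms(1) continuous_on_Pair[OF assms(2,3)] this] show ?thesis by simp
qed

text \<open>If \<open>k\<close> consists of the inner products \<open>(z r, z s)\<close>, then the differentiated function is the squared norm
  of the average of \<open>z\<close> around \<open>t\<close>.  The derivative has two terms, one for each factor \<open>\<beta>\<close>; they
  coincide because \<open>k\<close> is symmetric, and the sign comes from the derivative of \<open>r - t\<close> in \<open>t\<close>.\<close>

lemma mollified_diagonal_derivative:
  fixes k :: "real \<Rightarrow> real \<Rightarrow> real" and \<beta> \<beta>' :: "real \<Rightarrow> real"
  assumes cont: "continuous_on ({0..T} \<times> {0..T}) (\<lambda>(r, s). k r s)"
    and sym: "\<And>r s. k r s = k s r"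
    and \<beta>: "\<And>x. (\<beta> has_real_derivative \<beta>' x) (at x)" "continuous_on UNIV \<beta>'"
  shows "((\<lambda>t. integral {0..T} (\<lambda>s. integral {0..T} (\<lambda>r. k s r * (\<beta> (s - t) * \<beta> (r - t)))))
      has_real_derivative
      - 2 * integral {0..T} (\<lambda>s. \<beta> (s - t) * integral {0..T} (\<lambda>r. k r s * \<beta>' (r - t)))) (at t)"
proof -
  let ?Q = "cbox (0, 0) (T, T) :: (real \<times> real) set"
  have Q: "?Q = {0..T} \<times> {0..T}" by (simp add: cbox_Pair_eq)
  have \<beta>c: "continuous_on UNIV \<beta>"
    using \<beta>(1) by (auto intro!: continuous_at_imp_continuous_on DERIV_isCont)
  note [continuous_intros] = continuous_on_compose2[OF \<beta>c] continuous_on_compose2[OF \<beta>(2)]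
  note kc = continuous_on_kernel_compose[OF cont]
  let ?f = "\<lambda>t (s, r). k s r * (\<beta> (s - t) * \<beta> (r - t))"
  let ?f' = "\<lambda>t (s, r). k s r * (- \<beta>' (s - t) * \<beta> (r - t) + \<beta> (s - t) * - \<beta>' (r - t))"
  have cf: "continuous_on ?Q (?f t)" for t
    unfolding case_prod_unfold by (intro continuous_intros kc) (auto simp: Q)
  have "((\<lambda>t. integral ?Q (?f t)) has_real_derivative integral ?Q (?f' t)) (at t within UNIV)"
  proof (rule leibniz_rule_field_derivative[where U=UNIV])
    fix x :: real and p :: "real \<times> real"
    have D: "((\<lambda>x. \<beta> (c - x)) has_real_derivative - \<beta>' (c - x)) (at x within UNIV)" for c
    proof -
      have "((\<lambda>x. c - x) has_real_derivative -1) (at x within UNIV)"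
        by (auto intro!: derivative_eq_intros)
      from DERIV_chain2[OF \<beta>(1) this] show ?thesis by simp
    qed
    show "((\<lambda>x. ?f x p) has_field_derivative ?f' x p) (at x within UNIV)"
      by (cases p) (auto intro!: derivative_eq_intros D)
    show "?f x integrable_on ?Q" by (rule integrable_continuous[OF cf])
    show "continuous_on (UNIV \<times> ?Q) (\<lambda>(x, t). ?f' x t)"
      unfolding case_prod_unfold by (intro continuous_intros kc) (auto simp: Q)
  qed auto
  moreover have "integral ?Q (?f t) = integral {0..T} (\<lambda>s. integral {0..T} (\<lambda>r. k s r * (\<beta> (s - t) * \<beta> (r - t))))" for t
    using integral_prod_continuous[OF cf] by simp
  moreover have "integral ?Q (?f' t) = - 2 * integral {0..T} (\<lambda>s. \<beta> (s - t) * integral {0..T} (\<lambda>r. k r s * \<beta>' (r - t)))"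
  proof -
    let ?g = "\<lambda>(s, r). k s r * (\<beta> (s - t) * \<beta>' (r - t))" and ?h = "\<lambda>(s, r). k s r * (\<beta>' (s - t) * \<beta> (r - t))"
    have cg: "continuous_on ?Q ?g" "continuous_on ?Q ?h"
      unfolding case_prod_unfold by (intro continuous_intros kc; auto simp: Q)+
    have int: "?g integrable_on ?Q" "?h integrable_on ?Q"
      using cg by (auto intro: integrable_continuous)
    have "integral ?Q ?g = integral {0..T} (\<lambda>s. integral {0..T} (\<lambda>r. k s r * (\<beta> (s - t) * \<beta>' (r - t))))"
      using integral_prod_continuous[OF cg(1)] by simp
    also have "\<dots> = integral {0..T} (\<lambda>s. \<beta> (s - t) * integral {0..T} (\<lambda>r. k r s * \<beta>' (r - t)))"
      by (intro integral_cong) (simp add: sym mult.left_commute flip: integral_mult_right)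
    finally have g: "integral ?Q ?g = integral {0..T} (\<lambda>s. \<beta> (s - t) * integral {0..T} (\<lambda>r. k r s * \<beta>' (r - t)))" .
    have "integral ?Q ?h = integral {0..T} (\<lambda>s. integral {0..T} (\<lambda>r. k s r * (\<beta>' (s - t) * \<beta> (r - t))))"
      using integral_prod_continuous[OF cg(2)] by simp
    also have "\<dots> = integral {0..T} (\<lambda>r. integral {0..T} (\<lambda>s. k s r * (\<beta>' (s - t) * \<beta> (r - t))))"
      using integral_swap_continuous[of 0 0 T T "\<lambda>s r. k s r * (\<beta>' (s - t) * \<beta> (r - t))"] cg(2) by simp
    also have "\<dots> = integral {0..T} (\<lambda>s. \<beta> (s - t) * integral {0..T} (\<lambda>r. k r s * \<beta>' (r - t)))"
      by (intro integral_cong) (simp add: mult_ac flip: integral_mult_right)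
    finally have h: "integral ?Q ?h = integral {0..T} (\<lambda>s. \<beta> (s - t) * integral {0..T} (\<lambda>r. k r s * \<beta>' (r - t)))" .
    have "?f' t = (\<lambda>p. - (?g p + ?h p))" by (auto simp: fun_eq_iff algebra_simps)
    then have "integral ?Q (?f' t) = integral ?Q (\<lambda>p. - (?g p + ?h p))" by (rule arg_cong)
    also have "\<dots> = - integral ?Q (\<lambda>p. ?g p + ?h p)" by (rule integral_neg)
    also have "\<dots> = - (integral ?Q ?g + integral ?Q ?h)" by (simp only: integral_add[OF int])
    finally have "integral ?Q (?f' t) = - (integral ?Q ?g + integral ?Q ?h)" .
    then show ?thesis by (simp add: g h)
  qed
  ultimately show ?thesis by simp
qed

lemma continuous_LINT_interval:
  fixes f :: "real \<Rightarrow> real"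
  assumes "continuous_on {0..T} f"
  shows "(LINT x|lebesgue_on {0<..<T}. f x) = integral {0..T} f"
proof -
  have "integrable (lebesgue_on {0<..<T}) f"
    by (rule L2_imp_integrable[OF lmeasurable_open_interval continuous_on_interval_L2[OF assms]])
  then have "(LINT x|lebesgue_on {0<..<T}. f x) = integral {0<..<T} f"
    by (rule lebesgue_integral_eq_integral) auto
  then show ?thesis by (simp add: integral_open_interval_real)
qed

text \<open>The bound on the derivative is integrated over \<open>{t1..t2}\<close>.  After exchange of the integrals, \<open>q s\<close> is
  multiplied by the integral of \<open>\<beta> (s - t)\<close> over \<open>t\<close> in \<open>{t1..t2}\<close>, which is at most \<open>1\<close>.\<close>

lemma mollified_diagonal_growth:
  fixes k :: "real \<Rightarrow> real \<Rightarrow> real" and q \<beta> :: "real \<Rightarrow> real" and T \<epsilon> a c :: real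
  defines "K \<equiv> \<lambda>t. integral {0..T} (\<lambda>s. integral {0..T} (\<lambda>r. k s r * (\<beta> (s - t) * \<beta> (r - t))))"
  assumes cont: "continuous_on ({0..T} \<times> {0..T}) (\<lambda>(r, s). k r s)"
    and sym: "\<And>r s. k r s = k s r"
    and q: "integrable (lebesgue_on {0<..<T}) q" "\<And>s. 0 \<le> q s"
    and ac: "0 \<le> a" "0 \<le> c"
    and \<beta>: "smooth_on \<beta> UNIV" "\<And>x. 0 \<le> \<beta> x" "integrable lborel \<beta>" "(LINT x|lborel. \<beta> x) = 1"
    and bound: "\<And>t. t \<in> {t1..t2} \<Longrightarrow>
        - (LINT s|lebesgue_on {0<..<T}. \<beta> (s - t) * (LINT r|lebesgue_on {0<..<T}. k r s * deriv \<beta> (r - t)))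
        \<le> c + a * (LINT s|lebesgue_on {0<..<T}. \<beta> (s - t) * q s)"
    and t: "t1 \<le> t2"
  shows "K t2 - K t1 \<le> 2 * (c * (t2 - t1) + a * (LINT s|lebesgue_on {0<..<T}. q s))"
proof -
  let ?I = "lebesgue_on {0<..<T}" and ?J = "lebesgue_on {t1..t2}"
  interpret I: finite_measure ?I by (rule finite_measure_lebesgue_on[OF lmeasurable_open_interval])
  interpret J: finite_measure ?J by (rule finite_measure_lebesgue_on) auto
  interpret JI: pair_sigma_finite ?J ?I ..
  have D\<beta>: "(\<beta> has_real_derivative deriv \<beta> x) (at x)" for x
    using smooth_on_differentiable[OF \<beta>(1)] by (simp add: DERIV_deriv_iff_real_differentiable)
  have "deriv \<beta> = (\<lambda>t. frechet_derivative \<beta> (at t) 1)"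
    using frechet_derivative_at[OF has_field_derivative_imp_has_derivative[OF D\<beta>]] by (metis mult.right_neutral)
  then have c\<beta>': "continuous_on UNIV (deriv \<beta>)"
    using smooth_on_continuous[OF smooth_on_partial[OF \<beta>(1), of 1]] by simp
  have c\<beta>: "continuous_on UNIV \<beta>" by (rule smooth_on_continuous[OF \<beta>(1)])
  note [continuous_intros] = continuous_on_compose2[OF c\<beta>] continuous_on_compose2[OF c\<beta>']
  define D where "D t = - 2 * integral {0..T} (\<lambda>s. \<beta> (s - t) * integral {0..T} (\<lambda>r. k r s * deriv \<beta> (r - t)))" for t
  have KD: "(K has_real_derivative D t) (at t)" for t
    unfolding K_def D_def by (rule mollified_diagonal_derivative[OF cont sym D\<beta> c\<beta>'])
  note kc = continuous_on_kernel_compose[OF cont]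
  have kr: "continuous_on {0..T} (\<lambda>r. k r s)" if "s \<in> {0..T}" for s
    by (rule kc) (use that in \<open>auto intro!: continuous_intros\<close>)
  have inner: "(LINT r|?I. k r s * deriv \<beta> (r - t)) = integral {0..T} (\<lambda>r. k r s * deriv \<beta> (r - t))"
    if "s \<in> {0..T}" for s t
    by (rule continuous_LINT_interval) (auto intro!: continuous_intros kr that)
  have ci: "continuous_on {0..T} (\<lambda>s. integral {0..T} (\<lambda>r. k r s * deriv \<beta> (r - t)))" for t
  proof -
    have "continuous_on ({0..T} \<times> cbox 0 T) (\<lambda>(s, r). k r s * deriv \<beta> (r - t))"
      unfolding case_prod_unfold by (intro continuous_intros kc) auto
    from integral_continuous_on_param[OF this] show ?thesis by simp
  qed
  have D_le: "D t \<le> 2 * (c + a * (LINT s|?I. \<beta> (s - t) * q s))" if "t \<in> {t1..t2}" for t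
  proof -
    have "(LINT s|?I. \<beta> (s - t) * (LINT r|?I. k r s * deriv \<beta> (r - t)))
        = (LINT s|?I. \<beta> (s - t) * integral {0..T} (\<lambda>r. k r s * deriv \<beta> (r - t)))"
      by (intro Bochner_Integration.integral_cong refl) (simp add: inner)
    also have "\<dots> = integral {0..T} (\<lambda>s. \<beta> (s - t) * integral {0..T} (\<lambda>r. k r s * deriv \<beta> (r - t)))"
      by (rule continuous_LINT_interval) (auto intro!: continuous_intros ci)
    finally show ?thesis using bound[OF that] by (simp add: D_def)
  qed
  obtain C where C: "\<And>x. \<bar>x\<bar> \<le> T + \<bar>t1\<bar> + \<bar>t2\<bar> \<Longrightarrow> \<bar>\<beta> x\<bar> \<le> C"
  proof -
    have "bounded (\<beta> ` {- (T + \<bar>t1\<bar> + \<bar>t2\<bar>)..T + \<bar>t1\<bar> + \<bar>t2\<bar>})"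
      by (intro compact_imp_bounded compact_continuous_image continuous_on_subset[OF c\<beta>]) auto
    then show ?thesis using that by (force simp: bounded_iff)
  qed
  have int2: "integrable (?J \<Otimes>\<^sub>M ?I) (\<lambda>(t, s). \<beta> (s - t) * q s)"
  proof (rule JI.Fubini_integrable)
    have \<beta>m[measurable]: "\<beta> \<in> borel_measurable borel" by (rule borel_measurable_continuous_onI[OF c\<beta>])
    have [measurable]: "q \<in> borel_measurable ?I" using q(1) by simp
    have [measurable]: "(\<lambda>x. x) \<in> borel_measurable ?I" "(\<lambda>x. x) \<in> borel_measurable ?J"
      by (auto intro: continuous_measurable_lebesgue_on)
    show "(\<lambda>(t, s). \<beta> (s - t) * q s) \<in> borel_measurable (?J \<Otimes>\<^sub>M ?I)"
    proof -
      have "(\<lambda>p. snd p) \<in> borel_measurable (?J \<Otimes>\<^sub>M ?I)" "(\<lambda>p. fst p) \<in> borel_measurable (?J \<Otimes>\<^sub>M ?I)"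
        by (rule measurable_compose[OF measurable_snd, where g="\<lambda>x. x"], simp,
            rule measurable_compose[OF measurable_fst, where g="\<lambda>x. x"], simp)
      then show ?thesis unfolding case_prod_unfold by measurable
    qed
    have b: "\<bar>\<beta> (s - t) * q s\<bar> \<le> C * q s" if "t \<in> {t1..t2}" "s \<in> {0<..<T}" for s t
      using C[of "s - t"] that q(2)[of s] by (auto simp: abs_mult intro!: mult_right_mono)
    have int1: "integrable ?I (\<lambda>s. \<beta> (s - t) * q s)" if "t \<in> {t1..t2}" for t
    proof (rule Bochner_Integration.integrable_bound)
      show "integrable ?I (\<lambda>s. C * q s)" using q(1) by simp
      show "AE s in ?I. norm (\<beta> (s - t) * q s) \<le> norm (C * q s)"
        by (intro AE_I2) (use b[OF that] in force)
    qed measurable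
    show "AE t in ?J. integrable ?I (\<lambda>s. (\<lambda>(t, s). \<beta> (s - t) * q s) (t, s))"
      using int1 by (intro AE_I2) simp
    show "integrable ?J (\<lambda>t. LINT s|?I. norm ((\<lambda>(t, s). \<beta> (s - t) * q s) (t, s)))"
    proof (rule J.integrable_const_bound[where B="C * (LINT s|?I. q s)"])
      show "AE t in ?J. norm (LINT s|?I. norm ((\<lambda>(t, s). \<beta> (s - t) * q s) (t, s))) \<le> C * (LINT s|?I. q s)"
      proof (intro AE_I2)
        fix t assume "t \<in> space ?J"
        then have t: "t \<in> {t1..t2}" by simp
        have "(LINT s|?I. norm (\<beta> (s - t) * q s)) \<le> (LINT s|?I. C * q s)"
          using int1[OF t] q(1) b[OF t] by (intro integral_mono) auto
        then show "norm (LINT s|?I. norm ((\<lambda>(t, s). \<beta> (s - t) * q s) (t, s))) \<le> C * (LINT s|?I. q s)"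
          by simp
      qed
      show "(\<lambda>t. LINT s|?I. norm ((\<lambda>(t, s). \<beta> (s - t) * q s) (t, s))) \<in> borel_measurable ?J"
      proof (rule I.borel_measurable_lebesgue_integral)
        show "(\<lambda>(t, s). norm ((\<lambda>(t, s). \<beta> (s - t) * q s) (t, s))) \<in> borel_measurable (?J \<Otimes>\<^sub>M ?I)"
          using \<open>(\<lambda>(t, s). \<beta> (s - t) * q s) \<in> borel_measurable (?J \<Otimes>\<^sub>M ?I)\<close>
          by (auto simp: case_prod_unfold)
      qed
    qed
  qed
  have Q_int: "integrable ?J (\<lambda>t. LINT s|?I. \<beta> (s - t) * q s)"
    using JI.integrable_fst[OF int2] .
  have "(LINT t|?J. LINT s|?I. \<beta> (s - t) * q s) = (LINT s|?I. LINT t|?J. \<beta> (s - t) * q s)"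
    using JI.Fubini_integral[OF int2] by simp
  also have "\<dots> \<le> (LINT s|?I. q s)"
  proof (rule integral_mono)
    show "integrable ?I (\<lambda>s. LINT t|?J. \<beta> (s - t) * q s)" using JI.integrable_snd[OF int2] .
    fix s
    have *: "integrable lborel (\<lambda>t. \<beta> (s - t))" "(LINT t|lborel. \<beta> (s - t)) = 1"
      using lborel_integrable_real_affine[OF \<beta>(3), of "-1" s] lborel_integral_real_affine[of "-1" \<beta> s] \<beta>(4)
      by auto
    have "(LINT t|?J. \<beta> (s - t)) \<le> 1"
      using lebesgue_on_integral_le_lborel(2)[OF _ *(1), of "{t1..t2}"] \<beta>(2) *(2) by simp
    then show "(LINT t|?J. \<beta> (s - t) * q s) \<le> q s"
      using mult_right_mono[OF _ q(2)[of s]] by force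
  qed (rule q(1))
  finally have Q_le: "(LINT t|?J. LINT s|?I. \<beta> (s - t) * q s) \<le> (LINT s|?I. q s)" .
  have "(D has_integral (K t2 - K t1)) {t1..t2}"
    by (rule fundamental_theorem_of_calculus[OF t])
      (use KD in \<open>auto simp: has_real_derivative_iff_has_vector_derivative[symmetric] intro: has_field_derivative_at_within\<close>)
  moreover have "((\<lambda>t. 2 * (c + a * (LINT s|?I. \<beta> (s - t) * q s))) has_integral
      (LINT t|?J. 2 * (c + a * (LINT s|?I. \<beta> (s - t) * q s)))) {t1..t2}"
  proof -
    have "integrable ?J (\<lambda>t. 2 * (c + a * (LINT s|?I. \<beta> (s - t) * q s)))" using Q_int by simp
    from integrable_integral[OF integrable_on_lebesgue_on[OF this]] lebesgue_integral_eq_integral[OF this]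
    show ?thesis by simp
  qed
  ultimately have "K t2 - K t1 \<le> (LINT t|?J. 2 * (c + a * (LINT s|?I. \<beta> (s - t) * q s)))"
    by (rule has_integral_le) (rule D_le)
  also have "\<dots> = 2 * (c * (t2 - t1) + a * (LINT t|?J. LINT s|?I. \<beta> (s - t) * q s))"
    using Q_int t by (simp add: measure_restrict_space)
  also have "\<dots> \<le> 2 * (c * (t2 - t1) + a * (LINT s|?I. q s))"
    using Q_le ac by (simp add: mult_left_mono)
  finally show ?thesis .
qed

lemma weighted_average_close:
  fixes f w :: "real \<Rightarrow> real"
  assumes f: "continuous_on {a..b} f" and w: "continuous_on {a..b} w" "\<And>x. 0 \<le> w x" "integral {a..b} w = 1"
    and close: "\<And>x. \<lbrakk>x \<in> {a..b}; w x \<noteq> 0\<rbrakk> \<Longrightarrow> \<bar>f x - c\<bar> \<le> \<eta>"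
  shows "\<bar>integral {a..b} (\<lambda>x. f x * w x) - c\<bar> \<le> \<eta>"
proof -
  have int: "w integrable_on {a..b}" "(\<lambda>x. f x * w x) integrable_on {a..b}"
    by (intro integrable_continuous_real continuous_intros f w)+
  then have ints: "(\<lambda>x. c * w x) integrable_on {a..b}" "(\<lambda>x. \<eta> * w x) integrable_on {a..b}"
    by (simp_all add: integrable_on_mult_right)
  have "integral {a..b} (\<lambda>x. f x * w x) - c = integral {a..b} (\<lambda>x. f x * w x - c * w x)"
    using integral_diff[OF int(2) ints(1)] w(3) by simp
  moreover have "norm (integral {a..b} (\<lambda>x. f x * w x - c * w x)) \<le> integral {a..b} (\<lambda>x. \<eta> * w x)"
  proof (rule integral_norm_bound_integral[OF integrable_diff[OF int(2) ints(1)] ints(2)])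
    show "norm (f x * w x - c * w x) \<le> \<eta> * w x" if "x \<in> {a..b}" for x
    proof (cases "w x = 0")
      case False
      have "norm (f x * w x - c * w x) = \<bar>f x - c\<bar> * w x"
        using w(2)[of x] by (simp add: abs_mult flip: left_diff_distrib)
      then show ?thesis using mult_right_mono[OF close[OF that False] w(2)] by simp
    qed simp
  qed
  ultimately show ?thesis using w(3) by simp
qed

lemma mollified_diagonal_approx:
  fixes k :: "real \<Rightarrow> real \<Rightarrow> real" and \<beta> :: "real \<Rightarrow> real"
  assumes cont: "continuous_on ({0..T} \<times> {0..T}) (\<lambda>(r, s). k r s)"
    and \<beta>: "continuous_on UNIV \<beta>" "\<And>x. 0 \<le> \<beta> x" "integral {0..T} (\<lambda>r. \<beta> (r - t)) = 1"
    and close: "\<And>r s. \<lbrakk>r \<in> {0..T}; s \<in> {0..T}; \<beta> (r - t) \<noteq> 0; \<beta> (s - t) \<noteq> 0\<rbrakk> \<Longrightarrow> \<bar>k s r - k t t\<bar> \<le> \<eta>"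
  shows "\<bar>integral {0..T} (\<lambda>s. integral {0..T} (\<lambda>r. k s r * (\<beta> (s - t) * \<beta> (r - t)))) - k t t\<bar> \<le> \<eta>"
proof -
  note kc = continuous_on_kernel_compose[OF cont]
  note [continuous_intros] = continuous_on_compose2[OF \<beta>(1)]
  have w: "continuous_on {0..T} (\<lambda>r. \<beta> (r - t))" by (intro continuous_intros) auto
  define A where "A s = integral {0..T} (\<lambda>r. k s r * \<beta> (r - t))" for s
  have "continuous_on ({0..T} \<times> cbox 0 T) (\<lambda>(s, r). k s r * \<beta> (r - t))"
    unfolding case_prod_unfold by (intro continuous_intros kc) auto
  from integral_continuous_on_param[OF this] have Ac: "continuous_on {0..T} A" by (simp add: A_def)
  have A_close: "\<bar>A s - k t t\<bar> \<le> \<eta>" if "s \<in> {0..T}" "\<beta> (s - t) \<noteq> 0" for s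
    unfolding A_def
  proof (rule weighted_average_close[OF _ w \<beta>(2,3)])
    show "continuous_on {0..T} (k s)" by (rule kc) (use that in \<open>auto intro!: continuous_intros\<close>)
  qed (use close that in blast)
  have "integral {0..T} (\<lambda>s. integral {0..T} (\<lambda>r. k s r * (\<beta> (s - t) * \<beta> (r - t))))
      = integral {0..T} (\<lambda>s. A s * \<beta> (s - t))"
    unfolding A_def by (intro integral_cong) (simp add: mult.left_commute mult.commute flip: integral_mult_right)
  then show ?thesis
    using weighted_average_close[OF Ac w \<beta>(2,3) A_close] by simp
qed

text \<open>The hypothesis is the energy inequality for averages of \<open>z\<close>, in terms of \<open>k r s = (z r, z s)\<close>, and the
  conclusion is the energy inequality for \<open>z\<close>.  By uniform continuity of \<open>k\<close> the mollified values on
  the diagonal are close to \<open>k t t\<close> if the support of the mollifier is small.  It has to lie in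
  \<open>{0<..<T}\<close>, so the bound is obtained first between interior times and then extended by continuity.\<close>

lemma diagonal_growth_bound:
  fixes k :: "real \<Rightarrow> real \<Rightarrow> real" and q :: "real \<Rightarrow> real"
  assumes cont: "continuous_on ({0..T} \<times> {0..T}) (\<lambda>(r, s). k r s)"
    and sym: "\<And>r s. k r s = k s r"
    and q: "integrable (lebesgue_on {0<..<T}) q" "\<And>s. 0 \<le> q s"
    and ac: "0 \<le> a" "0 \<le> c"
    and bound: "\<And>\<psi>. \<lbrakk>\<psi> \<in> test_functions {0<..<T}; \<And>r. 0 \<le> \<psi> r; (LINT r|lebesgue_on {0<..<T}. \<psi> r) = 1\<rbrakk> \<Longrightarrow>
        - (LINT s|lebesgue_on {0<..<T}. \<psi> s * (LINT r|lebesgue_on {0<..<T}. k r s * deriv \<psi> r))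
        \<le> c + a * (LINT s|lebesgue_on {0<..<T}. \<psi> s * q s)"
    and t: "t \<in> {0..T}"
  shows "k t t \<le> k 0 0 + 2 * (c * T + a * (LINT s|lebesgue_on {0<..<T}. q s))"
proof -
  let ?I = "lebesgue_on {0<..<T}"
  define E where "E = 2 * (c * T + a * (LINT s|?I. q s))"
  have E0: "0 \<le> E" unfolding E_def using ac q t by (auto intro!: add_nonneg_nonneg mult_nonneg_nonneg)
  have uc: "uniformly_continuous_on ({0..T} \<times> {0..T}) (\<lambda>(r, s). k r s)"
    by (rule compact_uniformly_continuous[OF cont]) (auto intro: compact_Times)
  have inside: "k t2 t2 \<le> k t1 t1 + E" if t12: "0 < t1" "t1 \<le> t2" "t2 < T" for t1 t2
  proof (rule field_le_epsilon)
    fix e :: real assume "0 < e"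
    then obtain d where d: "0 < d" "\<And>p p'. \<lbrakk>p \<in> {0..T} \<times> {0..T}; p' \<in> {0..T} \<times> {0..T}; dist p' p < d\<rbrakk> \<Longrightarrow>
        dist (case p' of (r, s) \<Rightarrow> k r s) (case p of (r, s) \<Rightarrow> k r s) < e / 2"
      using uc unfolding uniformly_continuous_on_def by (metis half_gt_zero)
    \<comment> \<open>Two times at distance less than \<open>d / 2\<close> from \<open>t\<close> give a pair
      at distance less than \<open>d\<close> from \<open>(t, t)\<close>; the other two bounds keep the support
      inside \<open>{0<..<T}\<close> for all centres between \<open>t1\<close> and \<open>t2\<close>.\<close>
    define \<epsilon> where "\<epsilon> = min (d / 2) (min t1 (T - t2))"
    have \<epsilon>: "0 < \<epsilon>" "\<epsilon> \<le> d / 2" "\<epsilon> \<le> t1" "t2 \<le> T - \<epsilon>" using d(1) t12 unfolding \<epsilon>_def by linarith+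
    obtain \<beta> :: "real \<Rightarrow> real" where \<beta>: "smooth_on \<beta> UNIV" "\<And>x. 0 \<le> \<beta> x" "\<And>x. \<epsilon> \<le> \<bar>x\<bar> \<Longrightarrow> \<beta> x = 0"
      "integrable lborel \<beta>" "(LINT x|lborel. \<beta> x) = 1"
      "\<And>t T. \<lbrakk>\<epsilon> \<le> t; t \<le> T - \<epsilon>\<rbrakk> \<Longrightarrow> (\<lambda>r. \<beta> (r - t)) \<in> test_functions {0<..<T}"
      using mollifier_exists[OF \<epsilon>(1)] by blast
    have c\<beta>: "continuous_on UNIV \<beta>" by (rule smooth_on_continuous[OF \<beta>(1)])
    let ?K = "\<lambda>t. integral {0..T} (\<lambda>s. integral {0..T} (\<lambda>r. k s r * (\<beta> (s - t) * \<beta> (r - t))))"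
    have one: "(LINT r|?I. \<beta> (r - t)) = 1" if "t \<in> {t1..t2}" for t
    proof -
      have *: "integrable lborel (\<lambda>r. \<beta> (r - t))" "(LINT r|lborel. \<beta> (r - t)) = 1"
        using lborel_integrable_real_affine[OF \<beta>(4), of 1 "- t"] lborel_integral_real_affine[of 1 \<beta> "- t"] \<beta>(5)
        by auto
      have "\<beta> (r - t) = 0" if "r \<notin> {0<..<T}" for r
        using that \<open>t \<in> {t1..t2}\<close> \<epsilon> by (intro \<beta>(3)) auto
      then show ?thesis
        using lebesgue_on_integral_le_lborel(3)[OF _ *(1), of "{0<..<T}"] \<beta>(2) *(2) by simp
    qed
    have "?K t2 - ?K t1 \<le> 2 * (c * (t2 - t1) + a * (LINT s|?I. q s))"
    proof (rule mollified_diagonal_growth[OF cont sym q ac \<beta>(1,2,4,5) _ t12(2)])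
      fix t assume t: "t \<in> {t1..t2}"
      have test: "(\<lambda>r. \<beta> (r - t)) \<in> test_functions {0<..<T}" using t \<epsilon> by (intro \<beta>(6)) auto
      have "deriv (\<lambda>r. \<beta> (r - t)) r = deriv \<beta> (r - t)" for r
      proof -
        have "(\<beta> has_real_derivative deriv \<beta> (r - t)) (at (r - t))"
          using smooth_on_differentiable[OF \<beta>(1)] by (simp add: DERIV_deriv_iff_real_differentiable)
        moreover have "((\<lambda>r. r - t) has_real_derivative 1) (at r)" by (auto intro!: derivative_eq_intros)
        ultimately have "((\<lambda>r. \<beta> (r - t)) has_real_derivative deriv \<beta> (r - t) * 1) (at r)"
          by (rule DERIV_chain2)
        then show ?thesis using DERIV_imp_deriv by fastforce
      qed
      then show "- (LINT s|?I. \<beta> (s - t) * (LINT r|?I. k r s * deriv \<beta> (r - t)))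
          \<le> c + a * (LINT s|?I. \<beta> (s - t) * q s)"
        using bound[OF test \<beta>(2) one[OF t]] by simp
    qed
    also have "\<dots> \<le> E" unfolding E_def using ac t12
      by (intro mult_left_mono add_right_mono mult_left_mono) auto
    finally have KE: "?K t2 - ?K t1 \<le> E" .
    have approx: "\<bar>?K t - k t t\<bar> \<le> e / 2" if t: "t \<in> {t1..t2}" for t
    proof (rule mollified_diagonal_approx[OF cont c\<beta> \<beta>(2)])
      have "continuous_on {0..T} (\<lambda>r. \<beta> (r - t))"
        by (intro continuous_on_compose2[OF c\<beta>] continuous_intros) auto
      then show "integral {0..T} (\<lambda>r. \<beta> (r - t)) = 1"
        using continuous_LINT_interval one[OF t] by metis
      fix r s assume rs: "r \<in> {0..T}" "s \<in> {0..T}" "\<beta> (r - t) \<noteq> 0" "\<beta> (s - t) \<noteq> 0"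
      then have "\<bar>r - t\<bar> < \<epsilon>" "\<bar>s - t\<bar> < \<epsilon>" using \<beta>(3) not_less by blast+
      moreover have "dist (s, r) (t, t) \<le> \<bar>s - t\<bar> + \<bar>r - t\<bar>"
        unfolding dist_Pair_Pair dist_real_def by (metis power2_abs sqrt_sum_squares_le_sum_abs abs_abs)
      ultimately have "dist (s, r) (t, t) < d" using \<epsilon>(2) by linarith
      then have "dist (k s r) (k t t) < e / 2"
        using d(2)[of "(t, t)" "(s, r)"] rs t t12 by simp
      then show "\<bar>k s r - k t t\<bar> \<le> e / 2" by (simp add: dist_real_def)
    qed
    show "k t2 t2 \<le> k t1 t1 + E + e"
      using KE approx[of t1] approx[of t2] t12 by simp argo
  qed
  have diag: "continuous_on {0..T} (\<lambda>t. k t t)"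
    by (rule continuous_on_kernel_compose[OF cont]) (auto intro!: continuous_intros)
  have from0: "k t2 t2 \<le> k 0 0 + E" if t2: "0 < t2" "t2 < T" for t2
  proof (rule LIMSEQ_le_const)
    have lim: "(\<lambda>n. t2 * inverse (real (Suc n))) \<longlonglongrightarrow> t2 * 0"
      by (intro tendsto_intros LIMSEQ_inverse_real_of_nat)
    have small: "t2 * inverse (real (Suc n)) \<le> t2" "0 < t2 * inverse (real (Suc n))" for n
      using t2 by (auto simp: field_simps)
    then have "t2 * inverse (real (Suc n)) \<in> {0..T}" for n
      using small(1)[of n] small(2)[of n] t2 unfolding atLeastAtMost_iff by (intro conjI) linarith+
    then have "(\<lambda>n. k (t2 * inverse (real (Suc n))) (t2 * inverse (real (Suc n)))) \<longlonglongrightarrow> k 0 0"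
      using continuous_on_tendsto_compose[OF diag, of _ 0 sequentially] lim t2 by simp
    then show "(\<lambda>n. k (t2 * inverse (real (Suc n))) (t2 * inverse (real (Suc n))) + E) \<longlonglongrightarrow> k 0 0 + E"
      by (intro tendsto_intros)
    show "\<exists>N. \<forall>n\<ge>N. k t2 t2 \<le> k (t2 * inverse (real (Suc n))) (t2 * inverse (real (Suc n))) + E"
      using inside[OF small(2) small(1) t2(2)] by blast
  qed
  consider "t = 0" | "0 < t" "t < T" | "t = T" "0 < T" using t by fastforce
  then have "k t t \<le> k 0 0 + E"
  proof cases
    case 3
    show ?thesis
    proof (rule LIMSEQ_le_const2)
      have lim: "(\<lambda>n. T - T / 2 * inverse (real (Suc n))) \<longlonglongrightarrow> T - T / 2 * 0"
        by (intro tendsto_intros LIMSEQ_inverse_real_of_nat)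
      have in01: "0 < T - T / 2 * inverse (real (Suc n)) \<and> T - T / 2 * inverse (real (Suc n)) < T" for n
        using 3 by (auto simp: field_simps add_pos_nonneg)
      then have "T - T / 2 * inverse (real (Suc n)) \<in> {0..T}" for n by (simp add: less_imp_le)
      then show "(\<lambda>n. k (T - T / 2 * inverse (real (Suc n))) (T - T / 2 * inverse (real (Suc n)))) \<longlonglongrightarrow> k t t"
        using continuous_on_tendsto_compose[OF diag, of _ T sequentially] lim 3 by simp
      show "\<exists>N. \<forall>n\<ge>N. k (T - T / 2 * inverse (real (Suc n))) (T - T / 2 * inverse (real (Suc n))) \<le> k 0 0 + E"
        using from0 in01 by blast
    qed
  qed (use E0 from0 in auto)
  then show ?thesis by (simp add: E_def)
qed

section \<open>Time averages and the energy estimate\<close>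

lemma L2_cylinder_fst:
  fixes w :: "'a::euclidean_space \<Rightarrow> 'b::euclidean_space"
  assumes "A \<in> lmeasurable" "w \<in> L2 (lebesgue_on A)"
  shows "(\<lambda>p. w (fst p)) \<in> L2 (cylinder A T)"
proof -
  let ?M = "lebesgue_on A" and ?I = "lebesgue_on {0<..<T}"
  interpret pair_sigma_finite ?M ?I by (rule pair_sigma_finite_cylinder[OF assms(1)])
  interpret I: finite_measure ?I by (rule finite_measure_lebesgue_on[OF lmeasurable_open_interval])
  have meas: "(\<lambda>p. w (fst p)) \<in> borel_measurable (?M \<Otimes>\<^sub>M ?I)"
    by (rule measurable_compose[OF measurable_fst L2_measurable[OF assms(2)]])
  have "integrable (?M \<Otimes>\<^sub>M ?I) (\<lambda>p. (norm (w (fst p)))\<^sup>2)"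
  proof (rule Fubini_integrable)
    show "(\<lambda>p. (norm (w (fst p)))\<^sup>2) \<in> borel_measurable (?M \<Otimes>\<^sub>M ?I)" using meas by measurable
    show "integrable ?M (\<lambda>x. LINT y|?I. norm ((norm (w (fst (x, y))))\<^sup>2))"
      using L2_integrable[OF assms(2)] by simp
  qed simp
  then show ?thesis using meas by (simp add: L2_def cylinder_def)
qed

definition time_average :: "real \<Rightarrow> (real \<Rightarrow> real) \<Rightarrow> ('a \<times> real \<Rightarrow> 'b::euclidean_space) \<Rightarrow> 'a \<Rightarrow> 'b" where
  "time_average T \<psi> G x = (LINT t|lebesgue_on {0<..<T}. \<psi> t *\<^sub>R G (x, t))"

context
  fixes \<Omega> :: "'a::euclidean_space set" and T C :: real and \<psi> :: "real \<Rightarrow> real"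
    and G :: "'a \<times> real \<Rightarrow> 'b::euclidean_space"
  assumes lm: "\<Omega> \<in> lmeasurable" and G: "G \<in> L2 (cylinder \<Omega> T)"
    and \<psi>: "\<psi> \<in> borel_measurable (lebesgue_on {0<..<T})" "\<And>t. 0 \<le> \<psi> t" "\<And>t. \<psi> t \<le> C"
begin

interpretation I: finite_measure "lebesgue_on {0<..<T}"
  by (rule finite_measure_lebesgue_on[OF lmeasurable_open_interval])

interpretation pair_sigma_finite "lebesgue_on \<Omega>" "lebesgue_on {0<..<T}"
  by (rule pair_sigma_finite_cylinder[OF lm])

lemma weighted_L2: "(\<lambda>p. \<psi> (snd p) *\<^sub>R G p) \<in> L2 (cylinder \<Omega> T)"
proof (rule L2_dominated[OF G, where C=C])
  have "(\<lambda>p. \<psi> (snd p)) \<in> borel_measurable (lebesgue_on \<Omega> \<Otimes>\<^sub>M lebesgue_on {0<..<T})"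
    by (rule measurable_compose[OF measurable_snd \<psi>(1)])
  then show "(\<lambda>p. \<psi> (snd p) *\<^sub>R G p) \<in> borel_measurable (cylinder \<Omega> T)"
    using L2_measurable[OF G] by (auto simp: cylinder_def)
  show "AE p in cylinder \<Omega> T. norm (\<psi> (snd p) *\<^sub>R G p) \<le> C * norm (G p)"
    using \<psi>(2,3) by (intro AE_I2) (auto simp: intro!: mult_right_mono)
qed

lemma time_average_measurable: "time_average T \<psi> G \<in> borel_measurable (lebesgue_on \<Omega>)"
  unfolding time_average_def
  by (rule I.borel_measurable_lebesgue_integral)
    (use L2_measurable[OF weighted_L2] in \<open>simp add: cylinder_def case_prod_unfold\<close>)

text \<open>The Cauchy-Schwarz inequality for the weight \<open>\<psi>\<close>, that is, for the functions \<open>sqrt \<psi>\<close> and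
  \<open>sqrt \<psi> * norm G\<close>, bounds the square of the average by the average of the square, for almost
  every \<open>x\<close>; this is then integrated over \<open>x\<close>.\<close>

lemma time_average_L2: "time_average T \<psi> G \<in> L2 (lebesgue_on \<Omega>)" (is ?L2)
  and time_average_norm_le: "(L2_norm (lebesgue_on \<Omega>) (time_average T \<psi> G))\<^sup>2 \<le>
    (LINT t|lebesgue_on {0<..<T}. \<psi> t) *
    (LINT t|lebesgue_on {0<..<T}. \<psi> t * (LINT x|lebesgue_on \<Omega>. (norm (G (x, t)))\<^sup>2))" (is ?le)
proof -
  let ?M = "lebesgue_on \<Omega>" and ?I = "lebesgue_on {0<..<T}"
  let ?f = "\<lambda>x t. \<psi> t * (norm (G (x, t)))\<^sup>2"
  have \<psi>_int: "integrable ?I \<psi>"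
    by (rule I.integrable_const_bound[where B=C]) (use \<psi> in \<open>auto simp: abs_le_iff intro: order_trans\<close>)
  have int: "integrable (?M \<Otimes>\<^sub>M ?I) (\<lambda>(x, t). ?f x t)"
  proof (rule Bochner_Integration.integrable_bound)
    show "integrable (?M \<Otimes>\<^sub>M ?I) (\<lambda>p. C * (norm (G p))\<^sup>2)"
      using L2_integrable[OF G] by (simp add: cylinder_def)
    have "(\<lambda>p. \<psi> (snd p)) \<in> borel_measurable (?M \<Otimes>\<^sub>M ?I)"
      by (rule measurable_compose[OF measurable_snd \<psi>(1)])
    then show "(\<lambda>(x, t). ?f x t) \<in> borel_measurable (?M \<Otimes>\<^sub>M ?I)"
      using L2_measurable[OF G] by (auto simp: cylinder_def case_prod_unfold)
    show "AE p in ?M \<Otimes>\<^sub>M ?I. norm (case p of (x, t) \<Rightarrow> ?f x t) \<le> norm (C * (norm (G p))\<^sup>2)"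
    proof (intro AE_I2)
      fix p
      have "\<psi> (snd p) * (norm (G p))\<^sup>2 \<le> C * (norm (G p))\<^sup>2" using \<psi>(3) by (intro mult_right_mono) auto
      then show "norm (case p of (x, t) \<Rightarrow> ?f x t) \<le> norm (C * (norm (G p))\<^sup>2)"
        using \<psi>(2)[of "snd p"] by (simp add: case_prod_unfold)
    qed
  qed
  have pointwise: "AE x in ?M. (norm (time_average T \<psi> G x))\<^sup>2 \<le> (LINT t|?I. \<psi> t) * (LINT t|?I. ?f x t)"
    using AE_integrable_fst[OF int] AE_space
  proof eventually_elim
    case (elim x)
    have [measurable]: "(\<lambda>t. G (x, t)) \<in> borel_measurable ?I"
      using measurable_Pair2[OF L2_measurable[OF G, unfolded cylinder_def] elim(2)] .
    note \<psi>(1)[measurable]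
    have L: "(\<lambda>t. sqrt (\<psi> t)) \<in> L2 ?I" "(\<lambda>t. sqrt (\<psi> t) * norm (G (x, t))) \<in> L2 ?I"
      using \<psi>_int elim(1) \<psi>(2) by (auto simp: L2_def power_mult_distrib)
    have "norm (time_average T \<psi> G x) \<le> (LINT t|?I. norm (\<psi> t *\<^sub>R G (x, t)))"
      unfolding time_average_def by (rule integral_norm_bound)
    also have "\<dots> = (LINT t|?I. norm (sqrt (\<psi> t)) * norm (sqrt (\<psi> t) * norm (G (x, t))))"
      using \<psi>(2) by (intro Bochner_Integration.integral_cong) (auto simp: abs_mult)
    also have "\<dots> \<le> L2_norm ?I (\<lambda>t. sqrt (\<psi> t)) * L2_norm ?I (\<lambda>t. sqrt (\<psi> t) * norm (G (x, t)))"
      by (rule L2_norm_mult_le[OF L])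
    finally have "(norm (time_average T \<psi> G x))\<^sup>2
        \<le> (L2_norm ?I (\<lambda>t. sqrt (\<psi> t)) * L2_norm ?I (\<lambda>t. sqrt (\<psi> t) * norm (G (x, t))))\<^sup>2"
      by (rule power_mono) simp
    then show ?case using \<psi>(2) by (simp add: power_mult_distrib L2_norm_sq)
  qed
  note ta = time_average_measurable
  have int': "integrable ?M (\<lambda>x. (LINT t|?I. \<psi> t) * (LINT t|?I. ?f x t))"
    using integrable_fst[OF int] by simp
  have int_ta: "integrable ?M (\<lambda>x. (norm (time_average T \<psi> G x))\<^sup>2)"
  proof (rule Bochner_Integration.integrable_bound[OF int'])
    show "AE x in ?M. norm ((norm (time_average T \<psi> G x))\<^sup>2) \<le> norm ((LINT t|?I. \<psi> t) * (LINT t|?I. ?f x t))"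
      using pointwise by eventually_elim auto
  qed (use ta in measurable)
  then show ?L2 using ta by (simp add: L2_def)
  have "(L2_norm ?M (time_average T \<psi> G))\<^sup>2 \<le> (LINT x|?M. (LINT t|?I. \<psi> t) * (LINT t|?I. ?f x t))"
    unfolding L2_norm_sq by (rule integral_mono_AE[OF int_ta int' pointwise])
  also have "\<dots> = (LINT t|?I. \<psi> t) * (LINT t|?I. LINT x|?M. ?f x t)"
    using Fubini_integral[OF int] by simp
  finally show ?le by simp
qed

lemma time_average_inner_integrable:
  assumes w: "w \<in> L2 (lebesgue_on \<Omega>)"
  shows "integrable (lebesgue_on {0<..<T}) (\<lambda>t. \<psi> t * (LINT x|lebesgue_on \<Omega>. G (x, t) \<bullet> w x))" (is ?int)
  and time_average_inner: "(LINT t|lebesgue_on {0<..<T}. \<psi> t * (LINT x|lebesgue_on \<Omega>. G (x, t) \<bullet> w x))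
    = (LINT x|lebesgue_on \<Omega>. time_average T \<psi> G x \<bullet> w x)" (is ?eq)
proof -
  let ?M = "lebesgue_on \<Omega>" and ?I = "lebesgue_on {0<..<T}"
  have "integrable (cylinder \<Omega> T) (\<lambda>p. (\<psi> (snd p) *\<^sub>R G p) \<bullet> w (fst p))"
    by (rule L2_inner_integrable[OF weighted_L2 L2_cylinder_fst[OF lm w]])
  then have int: "integrable (?M \<Otimes>\<^sub>M ?I) (\<lambda>(x, t). \<psi> t * (G (x, t) \<bullet> w x))"
    by (simp add: cylinder_def case_prod_unfold)
  from integrable_snd[OF int] show ?int by simp
  have "(LINT t|?I. \<psi> t * (LINT x|?M. G (x, t) \<bullet> w x)) = (LINT x|?M. LINT t|?I. \<psi> t * (G (x, t) \<bullet> w x))"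
    using Fubini_integral[OF int] by simp
  also have "\<dots> = (LINT x|?M. time_average T \<psi> G x \<bullet> w x)"
  proof (rule integral_cong_AE)
    show "(\<lambda>x. LINT t|?I. \<psi> t * (G (x, t) \<bullet> w x)) \<in> borel_measurable ?M"
      using integrable_fst[OF int] by simp
    show "(\<lambda>x. time_average T \<psi> G x \<bullet> w x) \<in> borel_measurable ?M"
      using time_average_measurable L2_measurable[OF w] by measurable
    have "integrable (?M \<Otimes>\<^sub>M ?I) (\<lambda>(x, t). (norm (\<psi> t *\<^sub>R G (x, t)))\<^sup>2)"
      using L2_integrable[OF weighted_L2] by (simp add: cylinder_def case_prod_unfold)
    from AE_integrable_fst[OF this]
    show "AE x in ?M. (LINT t|?I. \<psi> t * (G (x, t) \<bullet> w x)) = time_average T \<psi> G x \<bullet> w x"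
      using AE_space
    proof eventually_elim
      case (elim x)
      have "(\<lambda>t. \<psi> t *\<^sub>R G (x, t)) \<in> borel_measurable ?I"
        using measurable_Pair2[OF L2_measurable[OF weighted_L2, unfolded cylinder_def] elim(2)] by simp
      then have "(\<lambda>t. \<psi> t *\<^sub>R G (x, t)) \<in> L2 ?I" using elim(1) by (simp add: L2_def)
      then have "integrable ?I (\<lambda>t. \<psi> t *\<^sub>R G (x, t))" by (rule L2_imp_integrable[OF lmeasurable_open_interval])
      then have "(LINT t|?I. (\<psi> t *\<^sub>R G (x, t)) \<bullet> w x) = time_average T \<psi> G x \<bullet> w x"
        unfolding time_average_def by (rule integral_inner_left)
      then show ?case by simp
    qed
  qed
  finally show ?eq .
qed

end

text \<open>By bilinearity the increment of the kernel is a sum of two products, each with a factor that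
  measures the increment of \<open>y\<close> in one of the two times.\<close>

lemma C_L2_kernel_continuous:
  assumes y: "y \<in> C_L2 \<Omega> T"
  shows "continuous_on ({0..T} \<times> {0..T}) (\<lambda>(r, s). LINT x|lebesgue_on \<Omega>. y r x * y s x)"
  unfolding continuous_on_eq_continuous_within
proof
  let ?M = "lebesgue_on \<Omega>"
  fix p assume p: "p \<in> {0..T} \<times> {0..T}"
  obtain r0 s0 where p_eq: "p = (r0, s0)" and r0: "r0 \<in> {0..T}" and s0: "s0 \<in> {0..T}" using p by auto
  note L2 = C_L2_L2[OF y]
  let ?d = "\<lambda>t0 t. L2_norm ?M (\<lambda>x. y t x - y t0 x)"
  have d: "continuous (at t0 within {0..T}) (?d t0)" if "t0 \<in> {0..T}" for t0
    using C_L2_tendsto[OF y that] by (simp add: continuous_within)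
  have T: "fst ` ({0..T} \<times> {0..T}) = {0..T}" "snd ` ({0..T} \<times> {0..T}) = {0..T}" using r0 by auto
  have "continuous (at p within {0..T} \<times> {0..T}) (\<lambda>p. ?d r0 (fst p))"
    by (rule continuous_within_compose2[where f=fst and g="?d r0"])
      (use d[OF r0] in \<open>simp_all only: T p_eq fst_conv continuous_fst[OF continuous_ident]\<close>)
  then have dr: "((\<lambda>p. ?d r0 (fst p)) \<longlongrightarrow> 0) (at p within {0..T} \<times> {0..T})"
    by (simp add: p_eq continuous_within)
  have "continuous (at p within {0..T} \<times> {0..T}) (\<lambda>p. ?d s0 (snd p))"
    by (rule continuous_within_compose2[where f=snd and g="?d s0"])
      (use d[OF s0] in \<open>simp_all only: T p_eq snd_conv continuous_snd[OF continuous_ident]\<close>)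
  then have ds: "((\<lambda>p. ?d s0 (snd p)) \<longlongrightarrow> 0) (at p within {0..T} \<times> {0..T})"
    by (simp add: p_eq continuous_within)
  let ?n = "L2_norm ?M"
  have "((\<lambda>p. (case p of (r, s) \<Rightarrow> LINT x|?M. y r x * y s x) - (LINT x|?M. y r0 x * y s0 x)) \<longlongrightarrow> 0)
      (at p within {0..T} \<times> {0..T})"
  proof (rule Lim_null_comparison)
    have "((\<lambda>p. ?d r0 (fst p) * (?d s0 (snd p) + ?n (y s0)) + ?n (y r0) * ?d s0 (snd p))
        \<longlongrightarrow> 0 * (0 + ?n (y s0)) + ?n (y r0) * 0) (at p within {0..T} \<times> {0..T})"
      by (intro tendsto_intros dr ds)
    then show "((\<lambda>p. ?d r0 (fst p) * (?d s0 (snd p) + ?n (y s0)) + ?n (y r0) * ?d s0 (snd p)) \<longlongrightarrow> 0)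
        (at p within {0..T} \<times> {0..T})" by simp
    have "\<bar>(LINT x|?M. y r x * y s x) - (LINT x|?M. y r0 x * y s0 x)\<bar>
        \<le> ?d r0 r * (?d s0 s + ?n (y s0)) + ?n (y r0) * ?d s0 s" if r: "r \<in> {0..T}" and s: "s \<in> {0..T}" for r s
    proof -
      have "(LINT x|?M. y r x * y s x) - (LINT x|?M. y r0 x * y s0 x)
          = (LINT x|?M. (y r x - y r0 x) * y s x) + (LINT x|?M. y r0 x * (y s x - y s0 x))"
        using L2_mult_integrable[OF L2[OF r] L2[OF s]] L2_mult_integrable[OF L2[OF r0] L2[OF s]]
          L2_mult_integrable[OF L2[OF r0] L2[OF s0]]
        by (simp add: left_diff_distrib right_diff_distrib)
      moreover have "\<bar>LINT x|?M. (y r x - y r0 x) * y s x\<bar> \<le> ?d r0 r * ?n (y s)"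
        using L2_Cauchy_Schwarz[OF L2_diff[OF L2[OF r] L2[OF r0]] L2[OF s]] by simp
      moreover have "\<bar>LINT x|?M. y r0 x * (y s x - y s0 x)\<bar> \<le> ?n (y r0) * ?d s0 s"
        using L2_Cauchy_Schwarz[OF L2[OF r0] L2_diff[OF L2[OF s] L2[OF s0]]] by simp
      moreover have "?d r0 r * ?n (y s) \<le> ?d r0 r * (?d s0 s + ?n (y s0))"
        using L2_norm_triangle[OF L2_diff[OF L2[OF s] L2[OF s0]] L2[OF s0]] by (intro mult_left_mono) auto
      ultimately show ?thesis by linarith
    qed
    then show "\<forall>\<^sub>F p in at p within {0..T} \<times> {0..T}.
        norm ((case p of (r, s) \<Rightarrow> LINT x|?M. y r x * y s x) - (LINT x|?M. y r0 x * y s0 x))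
        \<le> ?d r0 (fst p) * (?d s0 (snd p) + ?n (y s0)) + ?n (y r0) * ?d s0 (snd p)"
      unfolding eventually_at_filter by (auto intro!: always_eventually)
  qed
  then show "continuous (at p within {0..T} \<times> {0..T}) (\<lambda>(r, s). LINT x|?M. y r x * y s x)"
    unfolding continuous_within by (simp add: p_eq LIM_zero_iff)
qed

text \<open>The equation at time \<open>r\<close> is tested with \<open>z s\<close> and averaged with weight \<open>\<psi> r\<close>, for almost every fixed \<open>s\<close>,
  and the result is averaged with weight \<open>\<psi> s\<close>.  The second average is taken of integrals over \<open>\<Omega>\<close>,
  so that only the functions \<open>z s\<close> have to lie in \<open>V_space\<close>, and not their averages in time.  As both
  weights agree, the Dirichlet term becomes a square.\<close>

lemma mollified_energy_identity:
  fixes \<Omega> :: "'a::euclidean_space set"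
  assumes \<Omega>: "open \<Omega>" "bounded \<Omega>" and F: "F \<in> L2 (cylinder \<Omega> T)"
    and z: "variational_solution \<Omega> \<Gamma>1 T F (\<lambda>t \<phi>. 0) y0 (\<lambda>p. 0) z"
    and G: "G \<in> L2 (cylinder \<Omega> T)"
      "AE t in lebesgue_on {0<..<T}. z t \<in> H1 \<Omega> \<and> is_weak_grad \<Omega> (z t) (\<lambda>x. G (x, t))"
    and \<psi>: "\<psi> \<in> test_functions {0<..<T}" "\<And>r. 0 \<le> \<psi> r"
  shows "(LINT s|lebesgue_on {0<..<T}. \<psi> s *
      (LINT r|lebesgue_on {0<..<T}. (LINT x|lebesgue_on \<Omega>. z r x * z s x) * deriv \<psi> r))
    = (L2_norm (lebesgue_on \<Omega>) (time_average T \<psi> G))\<^sup>2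
      - (LINT x|lebesgue_on \<Omega>. time_average T \<psi> F x * time_average T \<psi> (\<lambda>(x, t). z t x) x)"
proof -
  let ?M = "lebesgue_on \<Omega>" and ?I = "lebesgue_on {0<..<T}" and ?V = "V_space \<Omega> \<Gamma>1"
  have lm: "\<Omega> \<in> lmeasurable" using \<Omega> by (simp add: lmeasurable_open)
  obtain C where C: "\<And>t. \<psi> t \<le> C" using test_functions_bounded[OF \<psi>(1)] by (metis abs_le_D1)
  have \<psi>m: "\<psi> \<in> borel_measurable ?I" by (rule L2_measurable[OF test_function_L2_interval[OF \<psi>(1)]])
  have zC: "z \<in> C_L2 \<Omega> T" using z by (simp add: variational_solution_def)
  have zL2: "(\<lambda>(x, t). z t x) \<in> L2 (cylinder \<Omega> T)" using z by (auto simp: variational_solution_def L2_H1_def)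
  obtain h where h: "h \<in> L2_Vdual \<Omega> \<Gamma>1 T" "is_time_derivative \<Omega> \<Gamma>1 T z h"
    and heq: "AE t in ?I. \<forall>\<phi>\<in>?V. h t \<phi> + (LINT x|?M. weak_grad \<Omega> (z t) x \<bullet> weak_grad \<Omega> \<phi> x)
        = (LINT x|?M. F (x, t) * \<phi> x) + 0"
    using z unfolding variational_solution_def by blast
  have "AE t in ?I. trace_eq_on \<Omega> \<Gamma>1 (z t) (\<lambda>x. 0)"
    using z unfolding variational_solution_def by blast
  with G(2) have zV: "AE t in ?I. z t \<in> ?V" by eventually_elim (auto simp: V_space_def)
  note avG = time_average_L2[OF lm G(1) \<psi>m \<psi>(2) C] time_average_inner_integrable[OF lm G(1) \<psi>m \<psi>(2) C]
    time_average_inner[OF lm G(1) \<psi>m \<psi>(2) C]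
  note avF = time_average_L2[OF lm F \<psi>m \<psi>(2) C] time_average_inner_integrable[OF lm F \<psi>m \<psi>(2) C]
    time_average_inner[OF lm F \<psi>m \<psi>(2) C]
  note avz = time_average_L2[OF lm zL2 \<psi>m \<psi>(2) C] time_average_inner_integrable[OF lm zL2 \<psi>m \<psi>(2) C]
    time_average_inner[OF lm zL2 \<psi>m \<psi>(2) C]
  let ?Gs = "\<lambda>s. LINT x|?M. G (x, s) \<bullet> time_average T \<psi> G x"
  let ?zs = "\<lambda>s. LINT x|?M. z s x * time_average T \<psi> F x"
  \<comment> \<open>The time derivative in the dual space, applied to the test function \<open>z s\<close>,
    and the equation at almost every time \<open>r\<close>.\<close>
  have inner: "AE s in ?I. (LINT r|?I. (LINT x|?M. z r x * z s x) * deriv \<psi> r) = ?Gs s - ?zs s"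
    using zV G(2) L2_cylinder_AE_section[OF lm G(1)]
  proof eventually_elim
    case (elim s)
    have zs: "z s \<in> L2 ?M" using elim(1) by (simp add: V_space_H1 H1_L2)
    have wgs: "AE x in ?M. weak_grad \<Omega> (z s) x = G (x, s)" using weak_grad_eq[OF \<Omega>] elim(2) by blast
    have "(LINT r|?I. (LINT x|?M. z r x * z s x) * deriv \<psi> r) = - (LINT r|?I. h r (z s) * \<psi> r)"
      using h(2) elim(1) \<psi>(1) unfolding is_time_derivative_def by blast
    also have "(LINT r|?I. h r (z s) * \<psi> r)
        = (LINT r|?I. \<psi> r * (LINT x|?M. F (x, r) \<bullet> z s x) - \<psi> r * (LINT x|?M. G (x, r) \<bullet> G (x, s)))"
    proof (rule integral_cong_AE)
      show "(\<lambda>r. h r (z s) * \<psi> r) \<in> borel_measurable ?I"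
        using L2_measurable[OF L2_Vdual_L2[OF h(1) elim(1)]] \<psi>m by measurable
      show "(\<lambda>r. \<psi> r * (LINT x|?M. F (x, r) \<bullet> z s x) - \<psi> r * (LINT x|?M. G (x, r) \<bullet> G (x, s))) \<in> borel_measurable ?I"
        using avF(2)[OF zs] avG(2)[OF elim(3)] by (intro borel_measurable_diff borel_measurable_integrable)
      show "AE r in ?I. h r (z s) * \<psi> r
          = \<psi> r * (LINT x|?M. F (x, r) \<bullet> z s x) - \<psi> r * (LINT x|?M. G (x, r) \<bullet> G (x, s))"
        using heq G(2) L2_cylinder_AE_section[OF lm G(1)]
      proof (eventually_elim)
        fix r
        assume r: "\<forall>\<phi>\<in>?V. h r \<phi> + (LINT x|?M. weak_grad \<Omega> (z r) x \<bullet> weak_grad \<Omega> \<phi> x) = (LINT x|?M. F (x, r) * \<phi> x) + 0"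
          "z r \<in> H1 \<Omega> \<and> is_weak_grad \<Omega> (z r) (\<lambda>x. G (x, r))" "(\<lambda>x. G (x, r)) \<in> L2 ?M"
        have wgr: "AE x in ?M. weak_grad \<Omega> (z r) x = G (x, r)" using weak_grad_eq[OF \<Omega>] r(2) by blast
        have "(LINT x|?M. weak_grad \<Omega> (z r) x \<bullet> weak_grad \<Omega> (z s) x) = (LINT x|?M. G (x, r) \<bullet> G (x, s))"
        proof (rule integral_cong_AE)
          show "AE x in ?M. weak_grad \<Omega> (z r) x \<bullet> weak_grad \<Omega> (z s) x = G (x, r) \<bullet> G (x, s)"
            using wgr wgs by eventually_elim simp
        qed (intro borel_measurable_inner L2_measurable weak_grad_L2; use r elim in blast)+
        moreover have "h r (z s) + (LINT x|?M. weak_grad \<Omega> (z r) x \<bullet> weak_grad \<Omega> (z s) x) = (LINT x|?M. F (x, r) * z s x)"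
          using r(1) elim(1) by simp
        ultimately have hr: "h r (z s) = (LINT x|?M. F (x, r) \<bullet> z s x) - (LINT x|?M. G (x, r) \<bullet> G (x, s))" by simp
        show "h r (z s) * \<psi> r
            = \<psi> r * (LINT x|?M. F (x, r) \<bullet> z s x) - \<psi> r * (LINT x|?M. G (x, r) \<bullet> G (x, s))"
          unfolding hr by (simp only: right_diff_distrib mult.commute[of _ "\<psi> r"])
      qed
    qed
    also have "\<dots> = (LINT x|?M. time_average T \<psi> F x \<bullet> z s x) - (LINT x|?M. time_average T \<psi> G x \<bullet> G (x, s))"
      using Bochner_Integration.integral_diff[OF avF(2)[OF zs] avG(2)[OF elim(3)]] avF(3)[OF zs] avG(3)[OF elim(3)] by simp
    also have "\<dots> = ?zs s - ?Gs s" by (simp add: inner_commute mult.commute)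
    finally show ?case by simp
  qed
  have cont: "continuous_on {0..T} (\<lambda>s. LINT r|?I. (LINT x|?M. z r x * z s x) * deriv \<psi> r)"
  proof -
    note kc = continuous_on_kernel_compose[OF C_L2_kernel_continuous[OF zC]]
    have d\<psi>: "continuous_on UNIV (deriv \<psi>)"
      using test_function_deriv(1)[OF \<psi>(1)] by (auto simp: test_functions_def smooth_on_continuous)
    note [continuous_intros] = continuous_on_compose2[OF d\<psi>]
    have "continuous_on ({0..T} \<times> cbox 0 T) (\<lambda>(s, r). (LINT x|?M. z r x * z s x) * deriv \<psi> r)"
      unfolding case_prod_unfold by (intro continuous_intros kc) auto
    from integral_continuous_on_param[OF this]
    have "continuous_on {0..T} (\<lambda>s. integral {0..T} (\<lambda>r. (LINT x|?M. z r x * z s x) * deriv \<psi> r))" by simp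
    moreover have "integral {0..T} (\<lambda>r. (LINT x|?M. z r x * z s x) * deriv \<psi> r)
        = (LINT r|?I. (LINT x|?M. z r x * z s x) * deriv \<psi> r)" if "s \<in> {0..T}" for s
      by (rule continuous_LINT_interval[symmetric], intro continuous_intros kc) (use that in auto)
    ultimately show ?thesis by (rule continuous_on_eq)
  qed
  have "(LINT s|?I. \<psi> s * (LINT r|?I. (LINT x|?M. z r x * z s x) * deriv \<psi> r))
      = (LINT s|?I. \<psi> s * ?Gs s - \<psi> s * ?zs s)"
  proof (rule integral_cong_AE)
    show "(\<lambda>s. \<psi> s * (LINT r|?I. (LINT x|?M. z r x * z s x) * deriv \<psi> r)) \<in> borel_measurable ?I"
      by (intro borel_measurable_times \<psi>m L2_measurable continuous_on_interval_L2 cont)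
    show "(\<lambda>s. \<psi> s * ?Gs s - \<psi> s * ?zs s) \<in> borel_measurable ?I"
      using avG(2)[OF avG(1)] avz(2)[OF avF(1)] by (intro borel_measurable_diff borel_measurable_integrable) auto
    show "AE s in ?I. \<psi> s * (LINT r|?I. (LINT x|?M. z r x * z s x) * deriv \<psi> r) = \<psi> s * ?Gs s - \<psi> s * ?zs s"
      using inner by eventually_elim (simp add: right_diff_distrib)
  qed
  also have "\<dots> = (LINT s|?I. \<psi> s * ?Gs s) - (LINT s|?I. \<psi> s * ?zs s)"
    using avG(2)[OF avG(1)] avz(2)[OF avF(1)] by (intro Bochner_Integration.integral_diff) auto
  also have "(LINT s|?I. \<psi> s * ?Gs s) = (L2_norm ?M (time_average T \<psi> G))\<^sup>2"
    using avG(3)[OF avG(1)] by (simp add: L2_norm_sq power2_norm_eq_inner)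
  also have "(LINT s|?I. \<psi> s * ?zs s) = (LINT x|?M. time_average T \<psi> F x * time_average T \<psi> (\<lambda>(x, t). z t x) x)"
    using avz(3)[OF avF(1)] by (simp add: mult.commute)
  finally show ?thesis .
qed

text \<open>The square on the right of \<open>mollified_energy_identity\<close> is dropped, and the remaining product of the
  averages of \<open>F\<close> and \<open>z\<close> is split by Young's inequality such that, over the time interval of length
  \<open>T\<close>, the average of \<open>z\<close> contributes at most half of the largest value \<open>m\<close> of the squared norm of
  \<open>z t\<close>.  At a time where \<open>m\<close> is attained, this half is absorbed by the left-hand side.\<close>

lemma energy_estimate:
  fixes \<Omega> :: "'a::euclidean_space set"
  assumes \<Omega>: "open \<Omega>" "bounded \<Omega>" and T: "0 < T" and F: "F \<in> L2 (cylinder \<Omega> T)"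
    and z: "variational_solution \<Omega> \<Gamma>1 T F (\<lambda>t \<phi>. 0) (\<lambda>x. 0) (\<lambda>p. 0) z" and t: "t \<in> {0..T}"
  shows "(L2_norm (lebesgue_on \<Omega>) (z t))\<^sup>2 \<le> 4 * T * (L2_norm (cylinder \<Omega> T) F)\<^sup>2"
proof -
  let ?M = "lebesgue_on \<Omega>" and ?I = "lebesgue_on {0<..<T}"
  have lm: "\<Omega> \<in> lmeasurable" using \<Omega> by (simp add: lmeasurable_open)
  interpret pair_sigma_finite ?M ?I by (rule pair_sigma_finite_cylinder[OF lm])
  have zC: "z \<in> C_L2 \<Omega> T" using z by (simp add: variational_solution_def)
  have zL2: "(\<lambda>(x, t). z t x) \<in> L2 (cylinder \<Omega> T)" using z by (auto simp: variational_solution_def L2_H1_def)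
  obtain G where G: "G \<in> L2 (cylinder \<Omega> T)"
      "AE t in ?I. z t \<in> H1 \<Omega> \<and> is_weak_grad \<Omega> (z t) (\<lambda>x. G (x, t))"
    using z by (auto simp: variational_solution_def L2_H1_def)
  define k where "k r s = (LINT x|?M. z r x * z s x)" for r s
  have kc: "continuous_on ({0..T} \<times> {0..T}) (\<lambda>(r, s). k r s)"
    unfolding k_def by (rule C_L2_kernel_continuous[OF zC])
  have k_norm: "k s s = (L2_norm ?M (z s))\<^sup>2" for s unfolding k_def L2_norm_sq by (simp add: power2_eq_square)
  have "continuous_on {0..T} (\<lambda>t. k t t)"
    by (rule continuous_on_kernel_compose[OF kc]) (auto intro!: continuous_intros)
  then obtain tm where tm: "tm \<in> {0..T}" "\<And>t. t \<in> {0..T} \<Longrightarrow> k t t \<le> k tm tm"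
    using continuous_attains_sup[of "{0..T}" "\<lambda>t. k t t"] T by auto
  define m where "m = k tm tm"
  have m: "0 \<le> m" by (simp add: m_def k_norm)
  define q where "q s = (LINT x|?M. (norm (F (x, s)))\<^sup>2)" for s
  have "integrable (?M \<Otimes>\<^sub>M ?I) (\<lambda>(x, t). (norm (F (x, t)))\<^sup>2)"
    using L2_integrable[OF F] by (simp add: cylinder_def case_prod_unfold)
  from integrable_snd[OF this] integral_snd[OF this]
  have q: "integrable ?I q" "(LINT s|?I. q s) = (L2_norm (cylinder \<Omega> T) F)\<^sup>2"
    by (simp_all add: q_def[abs_def] L2_norm_sq cylinder_def case_prod_unfold)
  have "AE x in ?M. z 0 x = 0" using z by (simp add: variational_solution_def)
  then have k0: "k 0 0 = 0" unfolding k_def by (intro integral_eq_zero_AE) (auto elim: AE_mp)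
  have "k tm tm \<le> k 0 0 + 2 * (m / (4 * T) * T + T * (LINT s|?I. q s))"
  proof (rule diagonal_growth_bound[OF kc _ q(1) _ _ _ _ tm(1)])
    fix \<psi> assume \<psi>: "\<psi> \<in> test_functions {0<..<T}" "\<And>r. 0 \<le> \<psi> r" "(LINT r|?I. \<psi> r) = 1"
    obtain C where C: "\<And>t. \<psi> t \<le> C" using test_functions_bounded[OF \<psi>(1)] by (metis abs_le_D1)
    have \<psi>L2: "\<psi> \<in> L2 ?I" by (rule test_function_L2_interval[OF \<psi>(1)])
    have \<psi>i: "integrable ?I \<psi>" by (rule L2_imp_integrable[OF lmeasurable_open_interval \<psi>L2])
    have \<psi>m: "\<psi> \<in> borel_measurable ?I" by (rule L2_measurable[OF \<psi>L2])
    let ?F = "time_average T \<psi> F" and ?z = "time_average T \<psi> (\<lambda>(x, t). z t x)"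
    have F_le: "(L2_norm ?M ?F)\<^sup>2 \<le> (LINT s|?I. \<psi> s * q s)"
      using time_average_norm_le[OF lm F \<psi>m \<psi>(2) C] \<psi>(3) by (simp add: q_def)
    have "(L2_norm ?M ?z)\<^sup>2 \<le> (LINT s|?I. \<psi> s * k s s)"
      using time_average_norm_le[OF lm zL2 \<psi>m \<psi>(2) C] \<psi>(3) by (simp add: k_norm L2_norm_sq)
    also have "\<dots> \<le> (LINT s|?I. \<psi> s * m)"
    proof (rule integral_mono')
      show "\<psi> s * k s s \<le> \<psi> s * m" if "s \<in> space ?I" for s
        using that tm(2)[of s] \<psi>(2) by (intro mult_left_mono) (auto simp: m_def)
    qed (use \<psi>i m \<psi>(2) in auto)
    also have "\<dots> = m" using \<psi>(3) by simp
    finally have z_le: "(L2_norm ?M ?z)\<^sup>2 \<le> m" .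
    \<comment> \<open>The factor \<open>1 / (4 * T)\<close> becomes \<open>1 / 2\<close> after integration
      over \<open>{0..T}\<close> and doubling.\<close>
    have young: "a * b \<le> b\<^sup>2 / (4 * T) + T * a\<^sup>2" for a b :: real
    proof -
      have "0 \<le> (2 * T * a - b)\<^sup>2" by simp
      then show ?thesis using T by (simp add: power2_diff field_simps power2_eq_square)
    qed
    have "- (LINT s|?I. \<psi> s * (LINT r|?I. k r s * deriv \<psi> r)) \<le> (LINT x|?M. ?F x * ?z x)"
      unfolding k_def mollified_energy_identity[OF \<Omega> F z G \<psi>(1,2)] by simp
    also have "\<dots> \<le> L2_norm ?M ?F * L2_norm ?M ?z"
      using L2_Cauchy_Schwarz[OF time_average_L2[OF lm F \<psi>m \<psi>(2) C] time_average_L2[OF lm zL2 \<psi>m \<psi>(2) C]] by simp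
    also have "\<dots> \<le> (L2_norm ?M ?z)\<^sup>2 / (4 * T) + T * (L2_norm ?M ?F)\<^sup>2" by (rule young)
    also have "\<dots> \<le> m / (4 * T) + T * (LINT s|?I. \<psi> s * q s)"
      using z_le F_le T by (intro add_mono divide_right_mono mult_left_mono) auto
    finally show "- (LINT s|?I. \<psi> s * (LINT r|?I. k r s * deriv \<psi> r)) \<le> m / (4 * T) + T * (LINT s|?I. \<psi> s * q s)" .
  qed (use T m in \<open>auto simp: k_def q_def mult.commute\<close>)
  then have "m \<le> m / 2 + 2 * T * (L2_norm (cylinder \<Omega> T) F)\<^sup>2"
    using T by (simp add: k0 q(2) m_def[symmetric])
  then have "m \<le> 4 * T * (L2_norm (cylinder \<Omega> T) F)\<^sup>2" by simp
  then show ?thesis using tm(2)[OF t] unfolding m_def k_norm by linarith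
qed

section \<open>Weighted quadratic functionals\<close>

text \<open>The form of the two observation terms of a cost, which are written with an absolute value.\<close>

definition weighted_sq :: "'a measure \<Rightarrow> ('a \<Rightarrow> real) \<Rightarrow> ('a \<Rightarrow> real) \<Rightarrow> real" where
  "weighted_sq M \<rho> f = (LINT x|M. \<rho> x * \<bar>f x\<bar>\<^sup>2)"

context
  fixes M :: "'a measure" and \<rho> :: "'a \<Rightarrow> real" and C :: real
  assumes \<rho>: "\<rho> \<in> borel_measurable M" "AE x in M. 0 \<le> \<rho> x" "AE x in M. \<bar>\<rho> x\<bar> \<le> C" and C: "0 \<le> C"
begin

lemma weight_L2:
  fixes f :: "'a \<Rightarrow> real"
  assumes f: "f \<in> L2 M"
  shows "(\<lambda>x. \<rho> x * f x) \<in> L2 M"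
proof (rule L2_dominated[OF f, where C=C])
  show "AE x in M. norm (\<rho> x * f x) \<le> C * norm (f x)"
    using \<rho>(3) by eventually_elim (auto simp: abs_mult intro: mult_right_mono)
qed (intro borel_measurable_times \<rho>(1) L2_measurable f)

lemma weighted_integrable: "\<lbrakk>f \<in> L2 M; g \<in> L2 M\<rbrakk> \<Longrightarrow> integrable M (\<lambda>x. \<rho> x * f x * g x)" for f g :: "'a \<Rightarrow> real"
  by (rule L2_mult_integrable[OF weight_L2])

lemma weighted_inner_le:
  fixes f g :: "'a \<Rightarrow> real"
  assumes "f \<in> L2 M" "g \<in> L2 M"
  shows "\<bar>LINT x|M. \<rho> x * f x * g x\<bar> \<le> C * (L2_norm M f * L2_norm M g)"
proof -
  have int: "integrable M (\<lambda>x. C * (norm (f x) * norm (g x)))"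
    using L2_norm_integrable[OF assms] by simp
  have "\<bar>LINT x|M. \<rho> x * f x * g x\<bar> \<le> (LINT x|M. \<bar>\<rho> x * f x * g x\<bar>)" by (rule integral_abs_bound)
  also have "\<dots> \<le> (LINT x|M. C * (norm (f x) * norm (g x)))"
  proof (rule integral_mono_AE[OF _ int])
    show "AE x in M. \<bar>\<rho> x * f x * g x\<bar> \<le> C * (norm (f x) * norm (g x))"
      using \<rho>(3) by eventually_elim (auto simp: abs_mult mult.assoc intro: mult_right_mono)
  qed (use weighted_integrable[OF assms] in auto)
  also have "\<dots> \<le> C * (L2_norm M f * L2_norm M g)"
    using L2_norm_mult_le[OF assms] C by (simp add: mult_left_mono)
  finally show ?thesis .
qed

lemma weighted_sq_nonneg: "0 \<le> weighted_sq M \<rho> f"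
  unfolding weighted_sq_def by (rule integral_nonneg_AE) (use \<rho>(2) in \<open>eventually_elim, simp\<close>)

text \<open>If \<open>f1 - f2 = f3 - f4\<close>, then also \<open>f1 - f3 = f2 - f4\<close>, and the second difference of the quadratic form
  along this parallelogram is twice the bilinear form of its two sides.\<close>

lemma weighted_sq_second_difference:
  assumes L2: "f1 \<in> L2 M" "f2 \<in> L2 M" "f3 \<in> L2 M" "f4 \<in> L2 M"
    and eq: "AE x in M. f1 x - f2 x = f3 x - f4 x"
  shows "weighted_sq M \<rho> f1 - weighted_sq M \<rho> f2 - weighted_sq M \<rho> f3 + weighted_sq M \<rho> f4
    = 2 * (LINT x|M. \<rho> x * (f1 x - f2 x) * (f1 x - f3 x))"
proof -
  have sq: "weighted_sq M \<rho> f = (LINT x|M. \<rho> x * f x * f x)" for f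
    by (simp add: weighted_sq_def power2_eq_square mult.assoc)
  note int = weighted_integrable[OF L2(1,1)] weighted_integrable[OF L2(2,2)] weighted_integrable[OF L2(3,3)]
    weighted_integrable[OF L2(4,4)]
  have "weighted_sq M \<rho> f1 - weighted_sq M \<rho> f2 - weighted_sq M \<rho> f3 + weighted_sq M \<rho> f4
      = (LINT x|M. \<rho> x * f1 x * f1 x - \<rho> x * f2 x * f2 x - \<rho> x * f3 x * f3 x + \<rho> x * f4 x * f4 x)"
    unfolding sq using int by simp
  also have "\<dots> = (LINT x|M. 2 * (\<rho> x * (f1 x - f2 x) * (f1 x - f3 x)))"
  proof (rule integral_cong_AE)
    show "AE x in M. \<rho> x * f1 x * f1 x - \<rho> x * f2 x * f2 x - \<rho> x * f3 x * f3 x + \<rho> x * f4 x * f4 x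
        = 2 * (\<rho> x * (f1 x - f2 x) * (f1 x - f3 x))"
      using eq
    proof eventually_elim
      case (elim x)
      then have f4: "f4 x = f3 x + f2 x - f1 x" by simp
      show ?case unfolding f4 by (simp add: algebra_simps)
    qed
  qed (use int weighted_integrable[OF L2_diff[OF L2(1,2)] L2_diff[OF L2(1,3)]] in auto)
  also have "\<dots> = 2 * (LINT x|M. \<rho> x * (f1 x - f2 x) * (f1 x - f3 x))" by simp
  finally show ?thesis .
qed

lemma weighted_sq_second_difference_le:
  assumes L2: "f1 \<in> L2 M" "f2 \<in> L2 M" "f3 \<in> L2 M" "f4 \<in> L2 M"
    and eq: "AE x in M. f1 x - f2 x = f3 x - f4 x"
  shows "weighted_sq M \<rho> f1 - weighted_sq M \<rho> f2 - weighted_sq M \<rho> f3 + weighted_sq M \<rho> f4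
    \<le> 2 * C * (L2_norm M (\<lambda>x. f1 x - f2 x) * L2_norm M (\<lambda>x. f1 x - f3 x))"
  using weighted_inner_le[OF L2_diff[OF L2(1,2)] L2_diff[OF L2(1,3)]]
  unfolding weighted_sq_second_difference[OF assms] by simp

lemma weighted_sq_midpoint:
  assumes L2: "f \<in> L2 M" "f1 \<in> L2 M" "f2 \<in> L2 M" and eq: "AE x in M. f x - f1 x = f2 x - f x"
  shows "weighted_sq M \<rho> f \<le> (weighted_sq M \<rho> f1 + weighted_sq M \<rho> f2) / 2"
proof -
  \<comment> \<open>The points \<open>f\<close>, \<open>f1\<close>, \<open>f2\<close>, \<open>f\<close> form a
    degenerate parallelogram, whose sides are opposite to each other.\<close>
  have "(LINT x|M. \<rho> x * (f x - f1 x) * (f x - f2 x)) = (LINT x|M. - (\<rho> x * (f x - f1 x)\<^sup>2))"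
  proof (rule integral_cong_AE)
    show "AE x in M. \<rho> x * (f x - f1 x) * (f x - f2 x) = - (\<rho> x * (f x - f1 x)\<^sup>2)"
      using eq
    proof eventually_elim
      case (elim x)
      then have "f x - f2 x = - (f x - f1 x)" by simp
      then show ?case by (simp only: power2_eq_square mult_minus_right mult.assoc)
    qed
  qed (use L2[THEN L2_measurable] \<rho>(1) in auto)
  also have "\<dots> = - weighted_sq M \<rho> (\<lambda>x. f x - f1 x)"
    by (simp add: weighted_sq_def)
  finally have "weighted_sq M \<rho> f - weighted_sq M \<rho> f1 - weighted_sq M \<rho> f2 + weighted_sq M \<rho> f \<le> 0"
    unfolding weighted_sq_second_difference[OF L2(1,2,3,1) eq] using weighted_sq_nonneg by simp
  then show ?thesis by simp
qed

lemma weighted_sq_tendsto: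
  fixes f :: "nat \<Rightarrow> 'a \<Rightarrow> real"
  assumes L2: "\<And>n. f n \<in> L2 M" "g \<in> L2 M" and lim: "(\<lambda>n. L2_norm M (\<lambda>x. f n x - g x)) \<longlonglongrightarrow> 0"
  shows "(\<lambda>n. weighted_sq M \<rho> (f n)) \<longlonglongrightarrow> weighted_sq M \<rho> g"
proof (rule LIM_zero_cancel, rule Lim_null_comparison)
  let ?n = "\<lambda>n. L2_norm M (\<lambda>x. f n x - g x)"
  have "(\<lambda>n. C * (?n n * (?n n + 2 * L2_norm M g))) \<longlonglongrightarrow> C * (0 * (0 + 2 * L2_norm M g))"
    by (intro tendsto_intros lim)
  then show "(\<lambda>n. C * (?n n * (?n n + 2 * L2_norm M g))) \<longlonglongrightarrow> 0" by simp
  have "\<bar>weighted_sq M \<rho> (f n) - weighted_sq M \<rho> g\<bar> \<le> C * (?n n * (?n n + 2 * L2_norm M g))" for n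
  proof -
    have "weighted_sq M \<rho> (f n) - weighted_sq M \<rho> g = (LINT x|M. \<rho> x * f n x * f n x - \<rho> x * g x * g x)"
      using weighted_integrable[OF L2(1)[of n] L2(1)[of n]] weighted_integrable[OF L2(2) L2(2)]
      by (simp add: weighted_sq_def power2_eq_square mult.assoc)
    also have "\<dots> = (LINT x|M. \<rho> x * (f n x - g x) * (f n x + g x))"
      by (simp add: algebra_simps)
    finally have "\<bar>weighted_sq M \<rho> (f n) - weighted_sq M \<rho> g\<bar> \<le> C * (?n n * L2_norm M (\<lambda>x. f n x + g x))"
      using weighted_inner_le[OF L2_diff[OF L2(1)[of n] L2(2)] L2_add[OF L2(1)[of n] L2(2)]] by simp
    moreover have "L2_norm M (\<lambda>x. f n x + g x) \<le> ?n n + 2 * L2_norm M g"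
    proof -
      have "(\<lambda>x. f n x + g x) = (\<lambda>x. (f n x - g x) + 2 *\<^sub>R g x)" by (simp add: fun_eq_iff)
      then show ?thesis
        using L2_norm_triangle[OF L2_diff[OF L2(1)[of n] L2(2)] L2_scaleR[OF L2(2), of 2]]
        by (simp add: L2_norm_scaleR[of M 2 g, simplified])
    qed
    ultimately show ?thesis using C by (smt (verit) L2_norm_nonneg mult_left_mono)
  qed
  then show "\<forall>\<^sub>F n in sequentially. norm (weighted_sq M \<rho> (f n) - weighted_sq M \<rho> g)
      \<le> C * (?n n * (?n n + 2 * L2_norm M g))" by simp
qed

end

section \<open>Dependence of the state on the source\<close>

lemma Linfty_bound:
  assumes "\<rho> \<in> Linfty M"
  obtains C where "0 \<le> C" "AE x in M. \<bar>\<rho> x\<bar> \<le> C"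
proof -
  obtain C where "AE x in M. \<bar>\<rho> x\<bar> \<le> C" using assms by (auto simp: Linfty_def)
  then have "AE x in M. \<bar>\<rho> x\<bar> \<le> max C 0" by eventually_elim auto
  then show ?thesis using that[of "max C 0"] by simp
qed

lemma AE_cylinder_fst:
  fixes \<Omega> :: "'a::euclidean_space set"
  assumes lm: "\<Omega> \<in> lmeasurable" and P: "Measurable.pred (lebesgue_on \<Omega>) P" "AE x in lebesgue_on \<Omega>. P x"
  shows "AE p in cylinder \<Omega> T. P (fst p)"
proof -
  interpret pair_sigma_finite "lebesgue_on \<Omega>" "lebesgue_on {0<..<T}"
    by (rule pair_sigma_finite_cylinder[OF lm])
  show ?thesis
    unfolding cylinder_def
  proof (rule AE_pair_measure)
    have "(\<lambda>p. P (fst p)) \<in> measurable (lebesgue_on \<Omega> \<Otimes>\<^sub>M lebesgue_on {0<..<T}) (count_space UNIV)"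
      by (rule measurable_compose[OF measurable_fst P(1)])
    then show "{p \<in> space (lebesgue_on \<Omega> \<Otimes>\<^sub>M lebesgue_on {0<..<T}). P (fst p)}
        \<in> sets (lebesgue_on \<Omega> \<Otimes>\<^sub>M lebesgue_on {0<..<T})" by (rule predE)
    show "AE x in lebesgue_on \<Omega>. AE y in lebesgue_on {0<..<T}. P (fst (x, y))"
      using P(2) by eventually_elim simp
  qed
qed

lemma
  fixes \<Omega> :: "'a::euclidean_space set" and w :: "'a \<times> real \<Rightarrow> real"
  assumes lm: "\<Omega> \<in> lmeasurable" and \<omega>: "\<omega> \<in> sets lebesgue" "\<omega> \<subseteq> \<Omega>" and w: "w \<in> L2 (cylinder \<omega> T)"
  shows zero_extension_L2: "(\<lambda>(x, t). indicator \<omega> x * w (x, t)) \<in> L2 (cylinder \<Omega> T)" (is "?e \<in> _")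
    and zero_extension_norm: "L2_norm (cylinder \<Omega> T) (\<lambda>(x, t). indicator \<omega> x * w (x, t)) = L2_norm (cylinder \<omega> T) w"
proof -
  let ?M = "lebesgue_on \<Omega>" and ?I = "lebesgue_on {0<..<T}" and ?m = "lebesgue_on \<omega>"
  have lm\<omega>: "\<omega> \<in> lmeasurable" using fmeasurableI2[OF lm] \<omega> by blast
  have \<Omega>: "\<Omega> \<in> sets lebesgue" using lm by (rule fmeasurableD)
  interpret Q: pair_sigma_finite ?M ?I by (rule pair_sigma_finite_cylinder[OF lm])
  interpret q: pair_sigma_finite ?m ?I by (rule pair_sigma_finite_cylinder[OF lm\<omega>])
  have wm: "w \<in> borel_measurable (?m \<Otimes>\<^sub>M ?I)" using L2_measurable[OF w] by (simp add: cylinder_def)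
  have \<omega>M: "\<omega> \<in> sets ?M" using \<omega> \<Omega> by (simp add: sets_restrict_space_iff)
  let ?S = "\<omega> \<times> space ?I"
  have S: "?S \<in> sets (?M \<Otimes>\<^sub>M ?I)" using \<omega>M by (intro pair_measureI) auto
  have em: "?e \<in> borel_measurable (?M \<Otimes>\<^sub>M ?I)"
  proof -
    have "(\<lambda>p. (fst p, snd p)) \<in> restrict_space (?M \<Otimes>\<^sub>M ?I) ?S \<rightarrow>\<^sub>M ?m \<Otimes>\<^sub>M ?I"
    proof (rule measurable_Pair)
      have "(\<lambda>x. x) \<in> ?M \<rightarrow>\<^sub>M lebesgue" by (rule measurable_restrict_space1) simp
      then have "fst \<in> (?M \<Otimes>\<^sub>M ?I) \<rightarrow>\<^sub>M lebesgue" using measurable_compose[OF measurable_fst] by fastforce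
      then show "fst \<in> restrict_space (?M \<Otimes>\<^sub>M ?I) ?S \<rightarrow>\<^sub>M ?m"
        by (intro measurable_restrict_space2 measurable_restrict_space1) (auto simp: space_restrict_space)
      show "snd \<in> restrict_space (?M \<Otimes>\<^sub>M ?I) ?S \<rightarrow>\<^sub>M ?I"
        by (intro measurable_restrict_space1) simp
    qed
    then have "w \<in> borel_measurable (restrict_space (?M \<Otimes>\<^sub>M ?I) ?S)"
      using measurable_compose[OF _ wm, of "\<lambda>p. (fst p, snd p)"] by simp
    then have "(\<lambda>p. indicator ?S p *\<^sub>R w p) \<in> borel_measurable (?M \<Otimes>\<^sub>M ?I)"
      using S by (subst (asm) borel_measurable_restrict_space_iff) (auto simp: sets.Int_space_eq2)
    moreover have "indicator ?S p *\<^sub>R w p = ?e p" if "p \<in> space (?M \<Otimes>\<^sub>M ?I)" for p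
      using that by (auto simp: space_pair_measure indicator_def split: prod.split)
    ultimately show ?thesis by (subst (asm) measurable_cong) auto
  qed
  have nn: "(\<integral>\<^sup>+p. ennreal ((norm (?e p))\<^sup>2) \<partial>(?M \<Otimes>\<^sub>M ?I)) = (\<integral>\<^sup>+p. ennreal ((norm (w p))\<^sup>2) \<partial>(?m \<Otimes>\<^sub>M ?I))"
  proof -
    have "(\<lambda>p. ennreal ((norm (?e p))\<^sup>2)) \<in> borel_measurable (?M \<Otimes>\<^sub>M ?I)" using em by measurable
    then have 1: "(\<integral>\<^sup>+p. ennreal ((norm (?e p))\<^sup>2) \<partial>(?M \<Otimes>\<^sub>M ?I))
        = (\<integral>\<^sup>+t. (\<integral>\<^sup>+x. ennreal ((norm (?e (x, t)))\<^sup>2) \<partial>?M) \<partial>?I)"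
      by (rule Q.nn_integral_snd[symmetric])
    have "(\<lambda>p. ennreal ((norm (w p))\<^sup>2)) \<in> borel_measurable (?m \<Otimes>\<^sub>M ?I)" using wm by measurable
    then have 2: "(\<integral>\<^sup>+p. ennreal ((norm (w p))\<^sup>2) \<partial>(?m \<Otimes>\<^sub>M ?I))
        = (\<integral>\<^sup>+t. (\<integral>\<^sup>+x. ennreal ((norm (w (x, t)))\<^sup>2) \<partial>?m) \<partial>?I)"
      by (rule q.nn_integral_snd[symmetric])
    have "(\<integral>\<^sup>+x. ennreal ((norm (?e (x, t)))\<^sup>2) \<partial>?M) = (\<integral>\<^sup>+x. ennreal ((norm (w (x, t)))\<^sup>2) \<partial>?m)" for t
      using \<omega> \<Omega> by (subst (1 2) nn_integral_restrict_space)
        (auto intro!: nn_integral_cong simp: indicator_def)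
    then show ?thesis unfolding 1 2 by simp
  qed
  have fin: "(\<integral>\<^sup>+p. ennreal ((norm (w p))\<^sup>2) \<partial>(?m \<Otimes>\<^sub>M ?I)) < \<infinity>"
    using L2_integrable[OF w] by (simp add: cylinder_def integrable_iff_bounded)
  show "?e \<in> L2 (cylinder \<Omega> T)"
    unfolding cylinder_def by (rule L2I_nn_integral[OF em]) (use nn fin in simp)
  show "L2_norm (cylinder \<Omega> T) ?e = L2_norm (cylinder \<omega> T) w"
    unfolding L2_norm_def cylinder_def
    by (subst (1 2) integral_eq_nn_integral) (use em wm nn in auto)
qed

lemma L2_norm_cylinder_le:
  fixes \<Omega> :: "'a::euclidean_space set" and z :: "real \<Rightarrow> 'a \<Rightarrow> real"
  assumes lm: "\<Omega> \<in> lmeasurable" and T: "0 \<le> T" and z: "(\<lambda>(x, t). z t x) \<in> L2 (cylinder \<Omega> T)"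
    and B: "\<And>t. t \<in> {0<..<T} \<Longrightarrow> L2_norm (lebesgue_on \<Omega>) (z t) \<le> B" and B0: "0 \<le> B"
  shows "L2_norm (cylinder \<Omega> T) (\<lambda>(x, t). z t x) \<le> sqrt T * B"
proof (rule power2_le_imp_le)
  let ?M = "lebesgue_on \<Omega>" and ?I = "lebesgue_on {0<..<T}"
  interpret pair_sigma_finite ?M ?I by (rule pair_sigma_finite_cylinder[OF lm])
  interpret I: finite_measure ?I by (rule finite_measure_lebesgue_on[OF lmeasurable_open_interval])
  have int: "integrable (?M \<Otimes>\<^sub>M ?I) (\<lambda>(x, t). (norm (z t x))\<^sup>2)"
    using L2_integrable[OF z] by (simp add: cylinder_def case_prod_unfold)
  have "(L2_norm (cylinder \<Omega> T) (\<lambda>(x, t). z t x))\<^sup>2 = (LINT t|?I. (L2_norm ?M (z t))\<^sup>2)"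
    using integral_snd[OF int] by (simp add: L2_norm_sq cylinder_def case_prod_unfold)
  also have "\<dots> \<le> (LINT t|?I. B\<^sup>2)"
    using integrable_snd[OF int] B by (intro integral_mono power_mono) (auto simp: L2_norm_sq)
  also have "\<dots> = (sqrt T * B)\<^sup>2"
    using T by (simp add: measure_restrict_space power_mult_distrib)
  finally show "(L2_norm (cylinder \<Omega> T) (\<lambda>(x, t). z t x))\<^sup>2 \<le> (sqrt T * B)\<^sup>2" .
qed (use T B0 in simp)

context
  fixes \<Omega> :: "'a::euclidean_space set" and \<Gamma>1 \<Gamma>2 :: "'a set" and T :: real
  assumes \<Omega>: "open \<Omega>" "bounded \<Omega>" and T: "0 < T"
begin

lemma weak_solution_diff:
  assumes "F \<in> L2 (cylinder \<Omega> T)" "F' \<in> L2 (cylinder \<Omega> T)"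
    and "weak_solution \<Omega> \<Gamma>1 \<Gamma>2 T F y0 g1 g2 y" "weak_solution \<Omega> \<Gamma>1 \<Gamma>2 T F' y0 g1 g2 y'"
  shows "variational_solution \<Omega> \<Gamma>1 T (\<lambda>p. F p - F' p) (\<lambda>t \<phi>. 0) (\<lambda>x. 0) (\<lambda>p. 0) (\<lambda>t x. y t x - y' t x)"
  using variational_solution_superposition[OF \<Omega> assms(1,2) weak_solution_imp_variational[OF assms(3)]
      weak_solution_imp_variational[OF assms(4)], of 1 "-1"] by simp

lemma weak_solution_L2:
  assumes "weak_solution \<Omega> \<Gamma>1 \<Gamma>2 T F y0 g1 g2 y"
  shows "(\<lambda>(x, t). y t x) \<in> L2 (cylinder \<Omega> T)" "t \<in> {0..T} \<Longrightarrow> y t \<in> L2 (lebesgue_on \<Omega>)"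
  using assms by (auto simp: weak_solution_def L2_H1_def intro: C_L2_L2)

lemma variational_solution_L2:
  assumes "variational_solution \<Omega> \<Gamma>1 T F l y0 g1 y"
  shows "(\<lambda>(x, t). y t x) \<in> L2 (cylinder \<Omega> T)" "t \<in> {0..T} \<Longrightarrow> y t \<in> L2 (lebesgue_on \<Omega>)"
  using assms by (auto simp: variational_solution_def L2_H1_def intro: C_L2_L2)

text \<open>The second bound follows from the first by integration of its square over the time interval.\<close>

lemma homogeneous_solution_bounds:
  assumes F: "F \<in> L2 (cylinder \<Omega> T)"
    and z: "variational_solution \<Omega> \<Gamma>1 T F (\<lambda>t \<phi>. 0) (\<lambda>x. 0) (\<lambda>p. 0) z"
  shows "t \<in> {0..T} \<Longrightarrow> L2_norm (lebesgue_on \<Omega>) (z t) \<le> 2 * sqrt T * L2_norm (cylinder \<Omega> T) F"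
    and "L2_norm (cylinder \<Omega> T) (\<lambda>(x, t). z t x) \<le> 2 * T * L2_norm (cylinder \<Omega> T) F"
proof -
  have lm: "\<Omega> \<in> lmeasurable" using \<Omega> by (simp add: lmeasurable_open)
  show *: "L2_norm (lebesgue_on \<Omega>) (z t) \<le> 2 * sqrt T * L2_norm (cylinder \<Omega> T) F" if "t \<in> {0..T}" for t
  proof (rule power2_le_imp_le)
    show "(L2_norm (lebesgue_on \<Omega>) (z t))\<^sup>2 \<le> (2 * sqrt T * L2_norm (cylinder \<Omega> T) F)\<^sup>2"
      using energy_estimate[OF \<Omega> T F z that] T by (simp add: power_mult_distrib)
  qed (use T in simp)
  have "L2_norm (cylinder \<Omega> T) (\<lambda>(x, t). z t x) \<le> sqrt T * (2 * sqrt T * L2_norm (cylinder \<Omega> T) F)"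
    by (rule L2_norm_cylinder_le[OF lm _ variational_solution_L2(1)[OF z] *]) (use T in auto)
  also have "\<dots> = 2 * (sqrt T * sqrt T) * L2_norm (cylinder \<Omega> T) F" by (simp only: mult_ac)
  also have "\<dots> = 2 * T * L2_norm (cylinder \<Omega> T) F" using T by simp
  finally show "L2_norm (cylinder \<Omega> T) (\<lambda>(x, t). z t x) \<le> 2 * T * L2_norm (cylinder \<Omega> T) F" .
qed

text \<open>This is affinity of the map from the source to the state.  The combination \<open>y1 - y2 - (y3 - y4)\<close> is a
  solution with vanishing data and source, so the energy estimate makes it vanish.\<close>

lemma weak_solution_second_difference:
  assumes F: "F1 \<in> L2 (cylinder \<Omega> T)" "F2 \<in> L2 (cylinder \<Omega> T)" "F3 \<in> L2 (cylinder \<Omega> T)" "F4 \<in> L2 (cylinder \<Omega> T)"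
    and y: "weak_solution \<Omega> \<Gamma>1 \<Gamma>2 T F1 y0 g1 g2 y1" "weak_solution \<Omega> \<Gamma>1 \<Gamma>2 T F2 y0 g1 g2 y2"
      "weak_solution \<Omega> \<Gamma>1 \<Gamma>2 T F3 y0 g1 g2 y3" "weak_solution \<Omega> \<Gamma>1 \<Gamma>2 T F4 y0 g1 g2 y4"
    and eq: "\<And>p. F1 p - F2 p = F3 p - F4 p"
  shows "AE x in lebesgue_on \<Omega>. y1 T x - y2 T x = y3 T x - y4 T x"
    and "AE p in cylinder \<Omega> T. y1 (snd p) (fst p) - y2 (snd p) (fst p) = y3 (snd p) (fst p) - y4 (snd p) (fst p)"
proof -
  let ?z = "\<lambda>t x. (y1 t x - y2 t x) - (y3 t x - y4 t x)"
  have "variational_solution \<Omega> \<Gamma>1 T (\<lambda>p. 0) (\<lambda>t \<phi>. 0) (\<lambda>x. 0) (\<lambda>p. 0)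
      (\<lambda>t x. 1 * (y1 t x - y2 t x) + - 1 * (y3 t x - y4 t x))"
    using variational_solution_superposition[OF \<Omega> L2_diff[OF F(1,2)] L2_diff[OF F(3,4)]
        weak_solution_diff[OF F(1,2) y(1,2)] weak_solution_diff[OF F(3,4) y(3,4)], of 1 "-1"] eq by simp
  moreover have "(\<lambda>t x. 1 * (y1 t x - y2 t x) + - 1 * (y3 t x - y4 t x)) = ?z" by (simp add: fun_eq_iff)
  ultimately have z: "variational_solution \<Omega> \<Gamma>1 T (\<lambda>p. 0) (\<lambda>t \<phi>. 0) (\<lambda>x. 0) (\<lambda>p. 0) ?z" by (simp only:)
  note L2 = variational_solution_L2[OF z] and b = homogeneous_solution_bounds[OF L2_zero z]
  have "L2_norm (lebesgue_on \<Omega>) (?z T) = 0" using b(1)[of T] T L2_norm_nonneg[of "lebesgue_on \<Omega>" "?z T"] by simp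
  from L2_norm_eq_0D[OF L2(2) this] show "AE x in lebesgue_on \<Omega>. y1 T x - y2 T x = y3 T x - y4 T x"
    using T by simp
  have "L2_norm (cylinder \<Omega> T) (\<lambda>(x, t). ?z t x) = 0"
    using b(2) L2_norm_nonneg[of "cylinder \<Omega> T" "\<lambda>(x, t). ?z t x"] by simp
  from L2_norm_eq_0D[OF L2(1) this]
  show "AE p in cylinder \<Omega> T. y1 (snd p) (fst p) - y2 (snd p) (fst p) = y3 (snd p) (fst p) - y4 (snd p) (fst p)"
    by (simp add: case_prod_unfold)
qed

end

section \<open>Nash equilibria of games with weak interaction\<close>

text \<open>The strategy spaces carry complete pseudometrics, as spaces of functions up to equality almost
  everywhere do, and no linear structure: convexity is expressed by the existence of midpoints.  It
  yields best responses, as minimizing sequences are Cauchy sequences, and quadratic growth of the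
  cost away from a best response.  Let \<open>w\<close>, \<open>w'\<close> be best responses of player \<open>i\<close> to \<open>u\<close>, \<open>u'\<close>.  Adding the two
  growth inequalities, at \<open>w\<close> in direction \<open>w'\<close> and conversely, leaves the mixed second difference, so
  that \<open>\<alpha> i / 2 * (d i w w')\<^sup>2 \<le> C * D u u' * d i w w'\<close>.  With \<open>4 * C * N \<le> \<alpha> i\<close> the sum of these
  distances over the \<open>N\<close> players is at most \<open>D u u' / 2\<close>, and the iterates of a selection \<open>\<Phi>\<close> of best
  responses converge as in Banach's fixed point theorem.  A fixed point is at distance \<open>0\<close> from its
  image, which suffices because the costs are continuous.\<close>

lemma unique_Nash_equilibrium_of_contraction:
  fixes X :: "nat \<Rightarrow> 'b set" and d :: "nat \<Rightarrow> 'b \<Rightarrow> 'b \<Rightarrow> real"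
    and J :: "nat \<Rightarrow> (nat \<Rightarrow> 'b) \<Rightarrow> real" and \<alpha> :: "nat \<Rightarrow> real" and C :: real and N :: nat
  defines "D \<equiv> \<lambda>u v. \<Sum>i=1..N. d i (u i) (v i)"
  assumes nonempty: "\<And>i. i \<in> {1..N} \<Longrightarrow> X i \<noteq> {}"
    and nonneg: "\<And>i x y. 0 \<le> d i x y"
    and commute: "\<And>i x y. d i x y = d i y x"
    and triangle: "\<And>i x y z. \<lbrakk>i \<in> {1..N}; x \<in> X i; y \<in> X i; z \<in> X i\<rbrakk> \<Longrightarrow> d i x z \<le> d i x y + d i y z"
    and complete: "\<And>i s. \<lbrakk>i \<in> {1..N}; \<And>n. s n \<in> X i;
        \<And>e. 0 < e \<Longrightarrow> \<exists>n0. \<forall>m\<ge>n0. \<forall>n\<ge>n0. d i (s m) (s n) < e\<rbrakk> \<Longrightarrow> \<exists>x\<in>X i. (\<lambda>n. d i (s n) x) \<longlonglongrightarrow> 0"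
    and J_nonneg: "\<And>i u. \<lbrakk>i \<in> {1..N}; u \<in> (\<Pi>\<^sub>E i\<in>{1..N}. X i)\<rbrakk> \<Longrightarrow> 0 \<le> J i u"
    and J_cont: "\<And>i u s w. \<lbrakk>i \<in> {1..N}; u \<in> (\<Pi>\<^sub>E i\<in>{1..N}. X i); \<And>n. s n \<in> X i; w \<in> X i;
        (\<lambda>n. d i (s n) w) \<longlonglongrightarrow> 0\<rbrakk> \<Longrightarrow> (\<lambda>n. J i (u(i := s n))) \<longlonglongrightarrow> J i (u(i := w))"
    and convex: "\<And>i u w w'. \<lbrakk>i \<in> {1..N}; u \<in> (\<Pi>\<^sub>E i\<in>{1..N}. X i); w \<in> X i; w' \<in> X i\<rbrakk> \<Longrightarrow>
        \<exists>m\<in>X i. J i (u(i := m)) + \<alpha> i / 8 * (d i w w')\<^sup>2 \<le> (J i (u(i := w)) + J i (u(i := w'))) / 2"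
    and mixed: "\<And>i u u' w w'. \<lbrakk>i \<in> {1..N}; u \<in> (\<Pi>\<^sub>E i\<in>{1..N}. X i); u' \<in> (\<Pi>\<^sub>E i\<in>{1..N}. X i);
        w \<in> X i; w' \<in> X i\<rbrakk> \<Longrightarrow>
        J i (u(i := w')) - J i (u(i := w)) - J i (u'(i := w')) + J i (u'(i := w)) \<le> C * D u u' * d i w w'"
    and large: "\<And>i. i \<in> {1..N} \<Longrightarrow> 0 < \<alpha> i \<and> 4 * C * real N \<le> \<alpha> i"
  shows "\<exists>u. is_Nash_equilibrium N X J u \<and>
    (\<forall>u'. is_Nash_equilibrium N X J u' \<longrightarrow> (\<forall>i\<in>{1..N}. d i (u' i) (u i) = 0))"
proof -
  let ?U = "\<Pi>\<^sub>E i\<in>{1..N}. X i"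
  define best where "best i u w \<longleftrightarrow> w \<in> X i \<and> (\<forall>w'\<in>X i. J i (u(i := w)) \<le> J i (u(i := w')))" for i u w
  have upd: "u(i := w) \<in> ?U" if "u \<in> ?U" "i \<in> {1..N}" "w \<in> X i" for u i w
    using that by (intro PiE_I) (auto simp: PiE_iff extensional_def)
  have D_nonneg: "0 \<le> D u v" for u v
    by (simp add: D_def sum_nonneg nonneg)
  have D_ge: "d i (u i) (v i) \<le> D u v" if "i \<in> {1..N}" for i u v
    unfolding D_def by (rule member_le_sum) (use that nonneg in auto)
  have Nash_iff: "is_Nash_equilibrium N X J u \<longleftrightarrow> u \<in> ?U \<and> (\<forall>i\<in>{1..N}. best i u (u i))" for u
    by (auto simp: is_Nash_equilibrium_def best_def PiE_iff)
  have growth: "J i (u(i := w)) + \<alpha> i / 4 * (d i w w')\<^sup>2 \<le> J i (u(i := w'))"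
    if *: "i \<in> {1..N}" "u \<in> ?U" "best i u w" "w' \<in> X i" for i u w w'
  proof -
    obtain m where m: "m \<in> X i" "J i (u(i := m)) + \<alpha> i / 8 * (d i w w')\<^sup>2 \<le> (J i (u(i := w)) + J i (u(i := w'))) / 2"
      using convex[of i u w w'] * unfolding best_def by blast
    have "J i (u(i := w)) \<le> J i (u(i := m))" using *(3) m(1) by (simp add: best_def)
    then show ?thesis using m(2) by argo
  qed
  have best_ex: "\<exists>w. best i u w" if i: "i \<in> {1..N}" and u: "u \<in> ?U" for i u
  proof -
    define S where "S = (\<lambda>w. J i (u(i := w))) ` X i"
    have S: "S \<noteq> {}" "bdd_below S"
      using nonempty[OF i] J_nonneg[OF i upd[OF u i]] by (auto simp: S_def bdd_below_def)
    have lower: "Inf S \<le> J i (u(i := w))" if "w \<in> X i" for w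
      using that S by (auto simp: S_def intro: cInf_lower)
    have "\<exists>w\<in>X i. J i (u(i := w)) < Inf S + inverse (real (Suc n))" for n
      using cInf_lessD[OF S(1), of "Inf S + inverse (real (Suc n))"] by (auto simp: S_def)
    then obtain s where s: "\<And>n. s n \<in> X i" "\<And>n. J i (u(i := s n)) < Inf S + inverse (real (Suc n))"
      by (metis (no_types))
    have close: "(d i (s m) (s n))\<^sup>2 \<le> (8 * inverse (real (Suc k))) / \<alpha> i" if "k \<le> m" "k \<le> n" for k m n
    proof -
      obtain c where c: "c \<in> X i" "J i (u(i := c)) + \<alpha> i / 8 * (d i (s m) (s n))\<^sup>2
          \<le> (J i (u(i := s m)) + J i (u(i := s n))) / 2"
        using convex[OF i u s(1) s(1)] by blast
      have "inverse (real (Suc m)) \<le> inverse (real (Suc k))" "inverse (real (Suc n)) \<le> inverse (real (Suc k))"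
        using that by (auto simp: field_simps)
      then have "\<alpha> i / 8 * (d i (s m) (s n))\<^sup>2 \<le> inverse (real (Suc k))"
        using c(2) lower[OF c(1)] s(2)[of m] s(2)[of n] by argo
      then show ?thesis using large[OF i] by (simp add: pos_le_divide_eq mult.commute)
    qed
    have "\<exists>n0. \<forall>m\<ge>n0. \<forall>n\<ge>n0. d i (s m) (s n) < e" if "0 < e" for e
    proof -
      have "(\<lambda>k. (8 * inverse (real (Suc k))) / \<alpha> i) \<longlonglongrightarrow> 8 * 0 / \<alpha> i"
        by (intro tendsto_intros LIMSEQ_inverse_real_of_nat) (use large[OF i] in auto)
      then have "eventually (\<lambda>k. (8 * inverse (real (Suc k))) / \<alpha> i < e\<^sup>2) sequentially"
        by (rule order_tendstoD(2)) (use \<open>0 < e\<close> in simp)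
      then obtain k where k: "(8 * inverse (real (Suc k))) / \<alpha> i < e\<^sup>2"
        by (auto simp: eventually_sequentially)
      have "d i (s m) (s n) < e" if "k \<le> m" "k \<le> n" for m n
      proof (rule power2_less_imp_less)
        show "(d i (s m) (s n))\<^sup>2 < e\<^sup>2" using close[OF that] k by (rule le_less_trans)
      qed (use \<open>0 < e\<close> in simp)
      then show ?thesis by blast
    qed
    from complete[OF i s(1) this] obtain w where w: "w \<in> X i" "(\<lambda>n. d i (s n) w) \<longlonglongrightarrow> 0" by blast
    have "(\<lambda>n. J i (u(i := s n))) \<longlonglongrightarrow> J i (u(i := w))" using J_cont[OF i u s(1) w] .
    moreover have "(\<lambda>n. Inf S + inverse (real (Suc n))) \<longlonglongrightarrow> Inf S + 0"
      by (intro tendsto_intros LIMSEQ_inverse_real_of_nat)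
    ultimately have "J i (u(i := w)) \<le> Inf S + 0"
      by (rule LIMSEQ_le) (meson s(2) less_imp_le)
    then have "J i (u(i := w)) \<le> J i (u(i := w'))" if "w' \<in> X i" for w'
      using lower[OF that] by linarith
    then show ?thesis using w(1) unfolding best_def by blast
  qed
  \<comment> \<open>Either the distance of the best responses is \<open>0\<close>, or one factor of it can be
    cancelled.\<close>
  have best_lipschitz: "real N * d i w w' \<le> D u u' / 2"
    if i: "i \<in> {1..N}" and u: "u \<in> ?U" "u' \<in> ?U" and w: "best i u w" "best i u' w'" for i u u' w w'
  proof -
    have X: "w \<in> X i" "w' \<in> X i" using w by (auto simp: best_def)
    have "\<alpha> i / 2 * (d i w w')\<^sup>2 \<le> C * D u u' * d i w w'"
      using growth[OF i u(1) w(1) X(2)] growth[OF i u(2) w(2) X(1)] mixed[OF i u X]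
      by (simp add: commute[of i w' w])
    then have "(\<alpha> i / 2 * d i w w') * d i w w' \<le> (C * D u u') * d i w w'"
      by (simp add: power2_eq_square)
    then have "\<alpha> i / 2 * d i w w' \<le> C * D u u' \<or> d i w w' = 0"
      using nonneg[of i w w'] mult_right_le_imp_le by (metis order_less_le)
    then show ?thesis
    proof
      assume "\<alpha> i / 2 * d i w w' \<le> C * D u u'"
      then have "\<alpha> i * (real N * d i w w') \<le> 2 * C * real N * D u u'"
        using mult_left_mono[of "\<alpha> i / 2 * d i w w'" "C * D u u'" "2 * real N"] by (simp add: algebra_simps)
      also have "\<dots> \<le> \<alpha> i * (D u u' / 2)"
        using mult_right_mono[of "4 * C * real N" "\<alpha> i" "D u u' / 2"] large[OF i] D_nonneg[of u u']
        by (simp add: algebra_simps)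
      finally show ?thesis using large[OF i] by (simp add: mult_le_cancel_left_pos)
    qed (simp add: D_nonneg)
  qed
  have contract: "D b b' \<le> D u u' / 2"
    if u: "u \<in> ?U" "u' \<in> ?U" and b: "\<forall>i\<in>{1..N}. best i u (b i)" "\<forall>i\<in>{1..N}. best i u' (b' i)" for u u' b b'
  proof (cases "N = 0")
    case False
    have "real N * D b b' = (\<Sum>i=1..N. real N * d i (b i) (b' i))" by (simp add: D_def sum_distrib_left)
    also have "\<dots> \<le> (\<Sum>i=1..N. D u u' / 2)"
      by (rule sum_mono, rule best_lipschitz[OF _ u]) (use b in blast)+
    also have "\<dots> = real N * (D u u' / 2)" by simp
    finally show ?thesis using False by (subst (asm) mult_le_cancel_left_pos) auto
  qed (simp add: D_def)
  \<comment> \<open>One best response per player, chosen for every \<open>u\<close>; any selection is a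
    contraction.\<close>
  define \<Phi> where "\<Phi> u = restrict (\<lambda>i. SOME w. best i u w) {1..N}" for u
  have \<Phi>_best: "best i u (\<Phi> u i)" if "i \<in> {1..N}" "u \<in> ?U" for i u
    using someI_ex[OF best_ex[OF that]] that by (simp add: \<Phi>_def)
  have \<Phi>_U: "\<Phi> u \<in> ?U" if "u \<in> ?U" for u
    using \<Phi>_best[OF _ that] by (intro PiE_I) (auto simp: best_def \<Phi>_def)
  obtain u0 where u0: "u0 \<in> ?U"
  proof -
    have "?U \<noteq> {}" using nonempty by (simp add: PiE_eq_empty_iff)
    then show ?thesis using that by blast
  qed
  define s where "s n = (\<Phi> ^^ n) u0" for n
  have s_Suc: "s (Suc n) = \<Phi> (s n)" for n by (simp add: s_def)
  have s_U: "s n \<in> ?U" for n using u0 \<Phi>_U by (induction n) (simp_all add: s_def)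
  have s_X: "s n i \<in> X i" if "i \<in> {1..N}" for n i using s_U[of n] that by (auto simp: PiE_iff)
  have s_step: "D (s n) (s (Suc n)) \<le> D (s 0) (s 1) * (1/2)^n" for n
  proof (induction n)
    case (Suc n)
    have "D (\<Phi> (s n)) (\<Phi> (s (Suc n))) \<le> D (s n) (s (Suc n)) / 2"
      by (rule contract[OF s_U s_U]; intro ballI \<Phi>_best s_U)
    then have "D (s (Suc n)) (s (Suc (Suc n))) \<le> D (s n) (s (Suc n)) / 2" by (simp only: s_Suc)
    then show ?case using Suc by simp
  qed simp
  define E where "E = D (s 0) (s 1)"
  have E: "0 \<le> E" by (simp add: E_def D_nonneg)
  have s_dist: "d i (s n i) (s (n + k) i) \<le> 2 * E * (1/2)^n - 2 * E * (1/2)^(n+k)"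
    if i: "i \<in> {1..N}" and "0 < k" for i n k
    using \<open>0 < k\<close>
  proof (induction k rule: nat_induct_non_zero)
    case 1
    show ?case using order_trans[OF D_ge[OF i, of "s n" "s (Suc n)"] s_step[of n]] by (simp add: E_def)
  next
    case (Suc k)
    have "d i (s n i) (s (n + Suc k) i) \<le> d i (s n i) (s (n + k) i) + d i (s (n + k) i) (s (n + Suc k) i)"
      by (rule triangle[OF i]) (auto intro: s_X i)
    moreover have "d i (s (n + k) i) (s (n + Suc k) i) \<le> E * (1/2)^(n+k)"
      using order_trans[OF D_ge[OF i, of "s (n+k)" "s (Suc (n+k))"] s_step[of "n+k"]] by (simp add: E_def)
    ultimately show ?case using Suc by simp
  qed
  have "\<exists>x\<in>X i. (\<lambda>n. d i (s n i) x) \<longlonglongrightarrow> 0" if i: "i \<in> {1..N}" for i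
  proof (rule complete[OF i s_X[OF i]])
    fix e :: real assume "0 < e"
    have "(\<lambda>n. 4 * E * (1/2)^n) \<longlonglongrightarrow> 4 * E * 0"
      by (intro tendsto_intros LIMSEQ_realpow_zero) auto
    then have "eventually (\<lambda>n. 4 * E * (1/2)^n < e) sequentially"
      by (rule order_tendstoD(2)) (use \<open>0 < e\<close> in simp)
    then obtain n0 where n0: "4 * E * (1/2)^n0 < e"
      by (auto simp: eventually_sequentially)
    have tail: "d i (s n0 i) (s m i) \<le> 2 * E * (1/2)^n0" if "n0 < m" for m
      using s_dist[OF i, of "m - n0" n0] that E
      by simp (smt (verit) mult_nonneg_nonneg zero_le_power divide_nonneg_nonneg)
    have "d i (s m i) (s n i) < e" if "Suc n0 \<le> m" "Suc n0 \<le> n" for m n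
    proof -
      have "d i (s m i) (s n i) \<le> d i (s m i) (s n0 i) + d i (s n0 i) (s n i)"
        by (rule triangle[OF i s_X[OF i] s_X[OF i] s_X[OF i]])
      then show ?thesis
        using tail[of m] tail[of n] that n0 by (simp add: commute[of i "s m i" "s n0 i"])
    qed
    then show "\<exists>n0. \<forall>m\<ge>n0. \<forall>n\<ge>n0. d i (s m i) (s n i) < e" by blast
  qed
  then have "\<forall>i\<in>{1..N}. \<exists>x. x \<in> X i \<and> (\<lambda>n. d i (s n i) x) \<longlonglongrightarrow> 0" by blast
  from bchoice[OF this] obtain l where l: "\<And>i. i \<in> {1..N} \<Longrightarrow> l i \<in> X i \<and> (\<lambda>n. d i (s n i) (l i)) \<longlonglongrightarrow> 0"
    by blast
  define u where "u = restrict l {1..N}"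
  have u: "u \<in> ?U" using l by (auto simp: u_def)
  have conv: "(\<lambda>n. d i (s n i) (u i)) \<longlonglongrightarrow> 0" if "i \<in> {1..N}" for i using l[OF that] that by (simp add: u_def)
  have D_conv: "(\<lambda>n. D (s n) u) \<longlonglongrightarrow> 0"
    unfolding D_def by (rule tendsto_null_sum) (rule conv)
  have fixed: "d i (u i) (\<Phi> u i) = 0" if i: "i \<in> {1..N}" for i
  proof -
    have X: "u i \<in> X i" "\<Phi> u i \<in> X i" using u \<Phi>_U[OF u] i by (auto simp: PiE_iff)
    have le: "d i (u i) (\<Phi> u i) \<le> d i (s (Suc n) i) (u i) + D (s n) u / 2" for n
    proof -
      have "d i (u i) (\<Phi> u i) \<le> d i (u i) (s (Suc n) i) + d i (s (Suc n) i) (\<Phi> u i)"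
        by (rule triangle[OF i X(1) s_X[OF i] X(2)])
      moreover have "d i (s (Suc n) i) (\<Phi> u i) \<le> D (\<Phi> (s n)) (\<Phi> u)"
        using D_ge[OF i, of "s (Suc n)" "\<Phi> u"] by (simp add: s_def)
      moreover have "D (\<Phi> (s n)) (\<Phi> u) \<le> D (s n) u / 2"
        by (rule contract[OF s_U u]; intro ballI \<Phi>_best s_U u)
      ultimately show ?thesis by (simp add: commute)
    qed
    have lim: "(\<lambda>n. d i (s (Suc n) i) (u i) + D (s n) u / 2) \<longlonglongrightarrow> 0 + 0 / 2"
      by (intro tendsto_intros D_conv LIMSEQ_Suc[OF conv[OF i]]) auto
    have "d i (u i) (\<Phi> u i) \<le> 0 + 0 / 2"
      by (rule LIMSEQ_le_const[OF lim]) (use le in blast)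
    then show ?thesis using nonneg[of i "u i" "\<Phi> u i"] by simp
  qed
  \<comment> \<open>The constant sequence \<open>u i\<close> converges to \<open>\<Phi> u i\<close>, because
    their distance is \<open>0\<close>.\<close>
  have "best i u (u i)" if i: "i \<in> {1..N}" for i
  proof -
    have X: "u i \<in> X i" "\<Phi> u i \<in> X i" using u \<Phi>_U[OF u] i by (auto simp: PiE_iff)
    have "(\<lambda>n::nat. J i (u(i := u i))) \<longlonglongrightarrow> J i (u(i := \<Phi> u i))"
      by (rule J_cont[OF i u X]) (simp add: fixed[OF i])
    then have "J i (u(i := u i)) = J i (u(i := \<Phi> u i))" by (simp add: LIMSEQ_const_iff)
    then show ?thesis using \<Phi>_best[OF i u] X by (simp add: best_def)
  qed
  then have Nash: "is_Nash_equilibrium N X J u" using u by (simp add: Nash_iff)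
  have "d i (u' i) (u i) = 0" if u': "is_Nash_equilibrium N X J u'" and i: "i \<in> {1..N}" for u' i
  proof -
    have "D u' u \<le> D u' u / 2"
      using u' Nash unfolding Nash_iff by (intro contract) blast+
    then have "D u' u \<le> 0" by simp
    then show ?thesis using D_ge[OF i, of u' u] nonneg[of i "u' i" "u i"] by simp
  qed
  then show ?thesis using Nash by blast
qed

section \<open>The control problem\<close>

lemma L2_norm_midpoint:
  fixes f g :: "'a \<Rightarrow> real"
  assumes "f \<in> L2 M" "g \<in> L2 M"
  shows "(L2_norm M (\<lambda>x. (f x + g x) / 2))\<^sup>2 + (L2_norm M (\<lambda>x. f x - g x))\<^sup>2 / 4
    = ((L2_norm M f)\<^sup>2 + (L2_norm M g)\<^sup>2) / 2"
proof -
  have int: "integrable M (\<lambda>x. (f x)\<^sup>2)" "integrable M (\<lambda>x. (g x)\<^sup>2)" "integrable M (\<lambda>x. f x * g x)"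
    using L2_integrable[OF assms(1)] L2_integrable[OF assms(2)] L2_mult_integrable[OF assms] by simp_all
  have "(L2_norm M (\<lambda>x. (f x + g x) / 2))\<^sup>2 = (LINT x|M. ((f x)\<^sup>2 + (g x)\<^sup>2 + 2 * (f x * g x)) / 4)"
    by (simp add: L2_norm_sq power_divide power2_sum mult.assoc)
  also have "\<dots> = ((LINT x|M. (f x)\<^sup>2) + (LINT x|M. (g x)\<^sup>2) + 2 * (LINT x|M. f x * g x)) / 4"
    using int by simp
  finally have 1: "(L2_norm M (\<lambda>x. (f x + g x) / 2))\<^sup>2
      = ((LINT x|M. (f x)\<^sup>2) + (LINT x|M. (g x)\<^sup>2) + 2 * (LINT x|M. f x * g x)) / 4" .
  have "(L2_norm M (\<lambda>x. f x - g x))\<^sup>2 = (LINT x|M. (f x)\<^sup>2 + (g x)\<^sup>2 - 2 * (f x * g x))"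
    by (simp add: L2_norm_sq power2_diff mult.assoc)
  also have "\<dots> = (LINT x|M. (f x)\<^sup>2) + (LINT x|M. (g x)\<^sup>2) - 2 * (LINT x|M. f x * g x)"
    using int by simp
  finally show ?thesis unfolding 1 by (simp add: L2_norm_sq field_simps)
qed

lemma source_upd_diff:
  fixes \<omega> :: "nat \<Rightarrow> 'a set"
  assumes "i \<in> {1..N}"
  shows "source N \<omega> f (u(i := w)) p - source N \<omega> f (u(i := w')) p = indicator (\<omega> i) (fst p) * (w p - w' p)"
proof -
  have "source N \<omega> f (u(i := w)) p - source N \<omega> f (u(i := w')) p
      = (\<Sum>j=1..N. indicator (\<omega> j) (fst p) * (u(i := w)) j p - indicator (\<omega> j) (fst p) * (u(i := w')) j p)"
    by (simp add: source_def case_prod_unfold sum_subtractf)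
  also have "\<dots> = (\<Sum>j=1..N. if j = i then indicator (\<omega> i) (fst p) * (w p - w' p) else 0)"
    by (intro sum.cong) (auto simp: right_diff_distrib)
  also have "\<dots> = indicator (\<omega> i) (fst p) * (w p - w' p)" using assms by simp
  finally show ?thesis .
qed

context
  fixes \<Omega> :: "'a::euclidean_space set" and \<omega> :: "nat \<Rightarrow> 'a set" and N :: nat and T :: real
  assumes lm: "\<Omega> \<in> lmeasurable" and \<omega>: "\<And>i. i \<in> {1..N} \<Longrightarrow> \<omega> i \<in> sets lebesgue \<and> \<omega> i \<subseteq> \<Omega>"
begin

lemma source_L2:
  assumes "f \<in> L2 (cylinder \<Omega> T)" "v \<in> controls N \<omega> T"
  shows "source N \<omega> f v \<in> L2 (cylinder \<Omega> T)"
proof -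
  have "(\<lambda>p. f p + (\<Sum>i=1..N. (\<lambda>(x, t). indicator (\<omega> i) x * v i (x, t)) p)) \<in> L2 (cylinder \<Omega> T)"
  proof (intro L2_add L2_sum assms(1))
    fix i assume i: "i \<in> {1..N}"
    then have "v i \<in> L2 (cylinder (\<omega> i) T)" using assms(2) by (auto simp: controls_def)
    then show "(\<lambda>(x, t). indicator (\<omega> i) x * v i (x, t)) \<in> L2 (cylinder \<Omega> T)"
      using zero_extension_L2[OF lm] \<omega>[OF i] by blast
  qed
  then show ?thesis by (simp add: source_def[abs_def] case_prod_unfold)
qed

text \<open>The source is the sum of the zero extensions of the controls, each of which has the norm of its control.\<close>

lemma source_diff_norm_le:
  assumes "u \<in> controls N \<omega> T" "v \<in> controls N \<omega> T"
  shows "L2_norm (cylinder \<Omega> T) (\<lambda>p. source N \<omega> f u p - source N \<omega> f v p)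
    \<le> (\<Sum>i=1..N. L2_norm (cylinder (\<omega> i) T) (\<lambda>p. u i p - v i p))"
proof -
  let ?e = "\<lambda>i (x, t). indicator (\<omega> i) x * (u i (x, t) - v i (x, t)) :: real"
  have L2: "(\<lambda>p. u i p - v i p) \<in> L2 (cylinder (\<omega> i) T)" if "i \<in> {1..N}" for i
    using assms that by (intro L2_diff) (auto simp: controls_def)
  have ext: "?e i \<in> L2 (cylinder \<Omega> T)"
    "L2_norm (cylinder \<Omega> T) (?e i) = L2_norm (cylinder (\<omega> i) T) (\<lambda>p. u i p - v i p)" if i: "i \<in> {1..N}" for i
    using zero_extension_L2[OF lm _ _ L2[OF i]] zero_extension_norm[OF lm _ _ L2[OF i]] \<omega>[OF i] by blast+
  have "(\<lambda>p. source N \<omega> f u p - source N \<omega> f v p) = (\<lambda>p. \<Sum>i=1..N. ?e i p)"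
    by (simp add: source_def case_prod_unfold fun_eq_iff right_diff_distrib sum_subtractf)
  then have "L2_norm (cylinder \<Omega> T) (\<lambda>p. source N \<omega> f u p - source N \<omega> f v p)
      \<le> (\<Sum>i=1..N. L2_norm (cylinder \<Omega> T) (?e i))"
    using L2_norm_sum_le[of "{1..N}" ?e] ext(1) by simp
  then show ?thesis using ext(2) by simp
qed

end

text \<open>The game is played in the spaces \<open>L2\<close> of the control regions with the distances \<open>d i\<close> of the \<open>L2\<close> norms.
  The functions \<open>eQ i v\<close> and \<open>eT i v\<close> are the deviations of the state from the targets of player \<open>i\<close>;
  their differences are differences of states, hence bounded by the energy estimate and
  independent of the targets.\<close>

theorem theorem1:
  fixes \<Omega> \<Gamma>1 \<Gamma>2 :: "'a::euclidean_space set"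
    and \<omega> :: "nat \<Rightarrow> 'a set"
    and \<rho> \<eta> :: "nat \<Rightarrow> 'a \<Rightarrow> real"
    and T :: real and N :: nat
  assumes "DIM('a) \<in> {1, 2, 3}"
    and "0 < T"
    and "open \<Omega>" "bounded \<Omega>" "smooth_boundary \<Omega>"
    and "\<Gamma>1 \<in> sets (surface_measure \<Omega>)" "\<Gamma>2 \<in> sets (surface_measure \<Omega>)"
    and "frontier \<Omega> = \<Gamma>1 \<union> \<Gamma>2"
    and "1 \<le> N"
    and "\<And>i. i \<in> {1..N} \<Longrightarrow> \<omega> i \<in> sets lebesgue \<and> \<omega> i \<subseteq> \<Omega>"
    and "\<And>i j. i \<in> {1..N} \<Longrightarrow> j \<in> {1..N} \<Longrightarrow> i \<noteq> j \<Longrightarrow> \<omega> i \<inter> \<omega> j = {}"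
    and "\<And>i. i \<in> {1..N} \<Longrightarrow> \<rho> i \<in> Linfty (lebesgue_on \<Omega>) \<and> (AE x in lebesgue_on \<Omega>. 0 \<le> \<rho> i x)"
    and "\<And>i. i \<in> {1..N} \<Longrightarrow> \<eta> i \<in> Linfty (lebesgue_on \<Omega>) \<and> (AE x in lebesgue_on \<Omega>. 0 \<le> \<eta> i x)"
  shows "\<exists>A::real. \<forall>(\<alpha> :: nat \<Rightarrow> real) f y0 g1 g2
      (yd :: nat \<Rightarrow> 'a \<times> real \<Rightarrow> real) (yT :: nat \<Rightarrow> 'a \<Rightarrow> real)
      (y :: (nat \<Rightarrow> 'a \<times> real \<Rightarrow> real) \<Rightarrow> real \<Rightarrow> 'a \<Rightarrow> real).
    (\<forall>i\<in>{1..N}. 0 < \<alpha> i) \<and> A < Min (\<alpha> ` {1..N}) \<and>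
    f \<in> L2 (cylinder \<Omega> T) \<and> y0 \<in> L2 (lebesgue_on \<Omega>) \<and>
    g1 \<in> L2 (boundary_cylinder \<Omega> \<Gamma>1 T) \<and> g2 \<in> L2 (boundary_cylinder \<Omega> \<Gamma>2 T) \<and>
    (\<forall>i\<in>{1..N}. yd i \<in> L2 (cylinder \<Omega> T) \<and> yT i \<in> L2 (lebesgue_on \<Omega>)) \<and>
    (\<forall>v\<in>controls N \<omega> T. is_state \<Omega> \<Gamma>1 \<Gamma>2 T N \<omega> f y0 g1 g2 v (y v))
    \<longrightarrow>
    (\<exists>u. is_Nash_equilibrium N (\<lambda>i. L2 (cylinder (\<omega> i) T)) (cost \<Omega> T \<omega> \<rho> \<eta> \<alpha> yd yT y) u \<and>
       (\<forall>u'. is_Nash_equilibrium N (\<lambda>i. L2 (cylinder (\<omega> i) T))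
               (cost \<Omega> T \<omega> \<rho> \<eta> \<alpha> yd yT y) u' \<longrightarrow>
          (\<forall>i\<in>{1..N}. AE p in cylinder (\<omega> i) T. u' i p = u i p)))"
proof -
  note T = assms(2) and \<Omega> = assms(3,4) and \<omega> = assms(10)
  have lm: "\<Omega> \<in> lmeasurable" using \<Omega> by (simp add: lmeasurable_open)
  let ?M = "lebesgue_on \<Omega>" and ?Q = "cylinder \<Omega> T"
  have "\<exists>c. 0 \<le> c \<and> (AE x in ?M. \<bar>\<rho> i x\<bar> \<le> c)" if "i \<in> {1..N}" for i
    using Linfty_bound[of "\<rho> i" ?M] assms(12)[OF that] by blast
  then obtain c\<rho> where c\<rho>: "\<And>i. i \<in> {1..N} \<Longrightarrow> 0 \<le> c\<rho> i \<and> (AE x in ?M. \<bar>\<rho> i x\<bar> \<le> c\<rho> i)" by metis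
  have "\<exists>c. 0 \<le> c \<and> (AE x in ?M. \<bar>\<eta> i x\<bar> \<le> c)" if "i \<in> {1..N}" for i
    using Linfty_bound[of "\<eta> i" ?M] assms(13)[OF that] by blast
  then obtain c\<eta> where c\<eta>: "\<And>i. i \<in> {1..N} \<Longrightarrow> 0 \<le> c\<eta> i \<and> (AE x in ?M. \<bar>\<eta> i x\<bar> \<le> c\<eta> i)" by metis
  \<comment> \<open>Each side of a parallelogram of states is at most \<open>2 * T\<close> times the change of
    the controls in \<open>L2\<close> of the cylinder, and \<open>2 * sqrt T\<close> times this change at the
    final time; the product of two sides gives \<open>4 * T\<^sup>2\<close> and \<open>4 * T\<close>.\<close>
  define K where "K = (\<Sum>i=1..N. 4 * T\<^sup>2 * c\<rho> i + 4 * T * c\<eta> i)"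
  have K_ge: "4 * T\<^sup>2 * c\<rho> i + 4 * T * c\<eta> i \<le> K" if "i \<in> {1..N}" for i
    unfolding K_def by (rule member_le_sum) (use that c\<rho> c\<eta> T in auto)
  have \<rho>m: "\<rho> i \<in> borel_measurable ?M" "\<eta> i \<in> borel_measurable ?M" if "i \<in> {1..N}" for i
    using assms(12,13)[OF that] by (auto simp: Linfty_def)
  have wQ: "(\<lambda>p. \<rho> i (fst p)) \<in> borel_measurable ?Q" "AE p in ?Q. 0 \<le> \<rho> i (fst p)"
    "AE p in ?Q. \<bar>\<rho> i (fst p)\<bar> \<le> c\<rho> i" if i: "i \<in> {1..N}" for i
  proof -
    note [measurable] = \<rho>m(1)[OF i]
    show "(\<lambda>p. \<rho> i (fst p)) \<in> borel_measurable ?Q"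
      unfolding cylinder_def by (rule measurable_compose[OF measurable_fst \<rho>m(1)[OF i]])
    show "AE p in ?Q. 0 \<le> \<rho> i (fst p)"
      by (rule AE_cylinder_fst[OF lm, where P="\<lambda>x. 0 \<le> \<rho> i x"]) (use assms(12)[OF i] in auto)
    show "AE p in ?Q. \<bar>\<rho> i (fst p)\<bar> \<le> c\<rho> i"
      by (rule AE_cylinder_fst[OF lm, where P="\<lambda>x. \<bar>\<rho> i x\<bar> \<le> c\<rho> i"]) (use c\<rho>[OF i] in auto)
  qed
  show ?thesis
  proof (intro exI[of _ "4 * K * real N"] allI impI, elim conjE)
    fix \<alpha> f y0 g1 g2 and yd :: "nat \<Rightarrow> 'a \<times> real \<Rightarrow> real" and yT :: "nat \<Rightarrow> 'a \<Rightarrow> real" and y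
    assume \<alpha>: "\<forall>i\<in>{1..N}. 0 < \<alpha> i" "4 * K * real N < Min (\<alpha> ` {1..N})" and f: "f \<in> L2 ?Q"
      and targets: "\<forall>i\<in>{1..N}. yd i \<in> L2 ?Q \<and> yT i \<in> L2 ?M"
      and state: "\<forall>v\<in>controls N \<omega> T. is_state \<Omega> \<Gamma>1 \<Gamma>2 T N \<omega> f y0 g1 g2 v (y v)"
    let ?X = "\<lambda>i. L2 (cylinder (\<omega> i) T) :: ('a \<times> real \<Rightarrow> real) set"
    let ?J = "cost \<Omega> T \<omega> \<rho> \<eta> \<alpha> yd yT y"
    let ?U = "\<Pi>\<^sub>E i\<in>{1..N}. ?X i"
    define d where "d i v w = L2_norm (cylinder (\<omega> i) T) (\<lambda>p. v p - w p)" for i and v w :: "'a \<times> real \<Rightarrow> real"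
    define D where "D u v = (\<Sum>i=1..N. d i (u i) (v i))" for u v
    have U: "controls N \<omega> T = ?U" by (simp add: controls_def)
    have upd: "u(i := w) \<in> ?U" if "u \<in> ?U" "i \<in> {1..N}" "w \<in> ?X i" for u i w
      using that by (intro PiE_I) (auto simp: PiE_iff extensional_def)
    have d_nonneg: "0 \<le> d i v w" for i v w by (simp add: d_def)
    have d_self: "d i v v = 0" for i v by (simp add: d_def)
    have sol: "weak_solution \<Omega> \<Gamma>1 \<Gamma>2 T (source N \<omega> f v) y0 g1 g2 (y v)" if "v \<in> ?U" for v
      using state that by (simp add: U is_state_def)
    have src: "source N \<omega> f v \<in> L2 ?Q" if "v \<in> ?U" for v
      by (rule source_L2[OF lm \<omega> f]) (use that U in auto)
    have src_le: "L2_norm ?Q (\<lambda>p. source N \<omega> f u p - source N \<omega> f v p) \<le> D u v" if "u \<in> ?U" "v \<in> ?U" for u v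
      unfolding D_def d_def by (rule source_diff_norm_le[OF lm \<omega>]) (use that U in auto)
    define eQ where "eQ i v p = y v (snd p) (fst p) - yd i p" for i v p
    define eT where "eT i v x = y v T x - yT i x" for i v x
    have eQ_L2: "eQ i v \<in> L2 ?Q" if "i \<in> {1..N}" "v \<in> ?U" for i v
      using L2_diff[OF weak_solution_L2(1)[OF \<Omega> T sol[OF that(2)]], of "yd i"] targets that(1)
      by (simp add: eQ_def[abs_def] case_prod_unfold)
    have eT_L2: "eT i v \<in> L2 ?M" if "i \<in> {1..N}" "v \<in> ?U" for i v
      using L2_diff[OF weak_solution_L2(2)[OF \<Omega> T sol[OF that(2)]], of T "yT i"] targets that(1) T
      by (simp add: eT_def[abs_def])
    have J: "?J i v = \<alpha> i / 2 * (L2_norm (cylinder (\<omega> i) T) (v i))\<^sup>2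
        + 1 / 2 * weighted_sq ?Q (\<lambda>p. \<rho> i (fst p)) (eQ i v) + 1 / 2 * weighted_sq ?M (\<eta> i) (eT i v)" for i v
      by (simp add: cost_def weighted_sq_def L2_norm_sq eQ_def eT_def case_prod_unfold)
    have lip: "L2_norm ?Q (\<lambda>p. eQ i u p - eQ i v p) \<le> 2 * T * D u v"
      "L2_norm ?M (\<lambda>x. eT i u x - eT i v x) \<le> 2 * sqrt T * D u v" if "u \<in> ?U" "v \<in> ?U" for i u v
    proof -
      \<comment> \<open>The targets cancel in the difference of two deviations.\<close>
      note z = weak_solution_diff[OF \<Omega> T src[OF that(1)] src[OF that(2)] sol[OF that(1)] sol[OF that(2)]]
      note b = homogeneous_solution_bounds[OF \<Omega> T L2_diff[OF src[OF that(1)] src[OF that(2)]] z]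
      show "L2_norm ?Q (\<lambda>p. eQ i u p - eQ i v p) \<le> 2 * T * D u v"
        using order_trans[OF b(2) mult_left_mono[OF src_le[OF that]]] T by (simp add: eQ_def case_prod_unfold)
      show "L2_norm ?M (\<lambda>x. eT i u x - eT i v x) \<le> 2 * sqrt T * D u v"
        using order_trans[OF b(1)[of T] mult_left_mono[OF src_le[OF that]]] T by (simp add: eT_def)
    qed
    have second: "AE p in ?Q. eQ i u1 p - eQ i u2 p = eQ i u3 p - eQ i u4 p"
      "AE x in ?M. eT i u1 x - eT i u2 x = eT i u3 x - eT i u4 x"
      if u: "u1 \<in> ?U" "u2 \<in> ?U" "u3 \<in> ?U" "u4 \<in> ?U"
        and eq: "\<And>p. source N \<omega> f u1 p - source N \<omega> f u2 p = source N \<omega> f u3 p - source N \<omega> f u4 p" for i u1 u2 u3 u4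
      using weak_solution_second_difference[OF \<Omega> T src[OF u(1)] src[OF u(2)] src[OF u(3)] src[OF u(4)]
          sol[OF u(1)] sol[OF u(2)] sol[OF u(3)] sol[OF u(4)] eq]
      by (simp_all add: eQ_def eT_def)
    have D_upd: "D (u(i := w)) (u(i := w')) = d i w w'" if "i \<in> {1..N}" for u i w w'
    proof -
      have "D (u(i := w)) (u(i := w')) = (\<Sum>j=1..N. if j = i then d i w w' else 0)"
        unfolding D_def by (intro sum.cong) (auto simp: d_self)
      then show ?thesis using that by simp
    qed
    have D_upd_same: "D (u(i := w)) (u'(i := w)) \<le> D u u'" for u u' i w
      unfolding D_def by (intro sum_mono) (auto simp: d_self d_nonneg)
    have "\<exists>u. is_Nash_equilibrium N ?X ?J u \<and>
        (\<forall>u'. is_Nash_equilibrium N ?X ?J u' \<longrightarrow> (\<forall>i\<in>{1..N}. d i (u' i) (u i) = 0))"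
    proof (rule unique_Nash_equilibrium_of_contraction[where \<alpha>=\<alpha> and C=K])
      show "?X i \<noteq> {}" for i using L2_zero by blast
      show "0 \<le> d i v w" for i v w by (rule d_nonneg)
      show "d i v w = d i w v" for i v w unfolding d_def by (rule L2_norm_minus_commute)
      show "d i v w \<le> d i v v' + d i v' w" if "v \<in> ?X i" "v' \<in> ?X i" "w \<in> ?X i" for i v v' w
        unfolding d_def by (rule L2_norm_diff_triangle[OF that])
      show "\<exists>w\<in>?X i. (\<lambda>n. d i (s n) w) \<longlonglongrightarrow> 0"
        if "\<And>n. s n \<in> ?X i" "\<And>e. 0 < e \<Longrightarrow> \<exists>n0. \<forall>m\<ge>n0. \<forall>n\<ge>n0. d i (s m) (s n) < e" for i s
        using L2_complete[of s, OF that(1)] that(2) unfolding d_def by blast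
      show "0 < \<alpha> i \<and> 4 * K * real N \<le> \<alpha> i" if i: "i \<in> {1..N}" for i
      proof -
        have "Min (\<alpha> ` {1..N}) \<le> \<alpha> i" using i by (intro Min_le) auto
        then have "4 * K * real N \<le> \<alpha> i" using \<alpha>(2) by linarith
        then show ?thesis using \<alpha>(1) i by blast
      qed
    next
      fix i u assume i: "i \<in> {1..N}" and u: "u \<in> ?U"
      note wQ' = wQ[OF i] c\<rho>[OF i, THEN conjunct1]
      note wM = \<rho>m(2)[OF i] assms(13)[OF i, THEN conjunct2] c\<eta>[OF i, THEN conjunct2] c\<eta>[OF i, THEN conjunct1]
      show "0 \<le> ?J i u"
        unfolding J using \<alpha>(1) i weighted_sq_nonneg[OF wQ'] weighted_sq_nonneg[OF wM]
        by (intro add_nonneg_nonneg mult_nonneg_nonneg) (auto intro: less_imp_le)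
      show "(\<lambda>n. ?J i (u(i := s n))) \<longlonglongrightarrow> ?J i (u(i := w))"
        if s: "\<And>n. s n \<in> ?X i" and w: "w \<in> ?X i" and lim: "(\<lambda>n. d i (s n) w) \<longlonglongrightarrow> 0" for s w
      proof -
        note us = upd[OF u i s] and uw = upd[OF u i w]
        \<comment> \<open>The control cost is a weighted square with the constant weight
          \<open>1\<close>.\<close>
        have "(\<lambda>n. weighted_sq (cylinder (\<omega> i) T) (\<lambda>_. 1) (s n)) \<longlonglongrightarrow> weighted_sq (cylinder (\<omega> i) T) (\<lambda>_. 1) w"
          by (rule weighted_sq_tendsto[where C=1, OF _ _ _ _ s w]) (use lim in \<open>auto simp: d_def\<close>)
        then have 1: "(\<lambda>n. (L2_norm (cylinder (\<omega> i) T) (s n))\<^sup>2) \<longlonglongrightarrow> (L2_norm (cylinder (\<omega> i) T) w)\<^sup>2"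
          by (simp add: weighted_sq_def L2_norm_sq)
        have 2: "(\<lambda>n. weighted_sq ?Q (\<lambda>p. \<rho> i (fst p)) (eQ i (u(i := s n))))
            \<longlonglongrightarrow> weighted_sq ?Q (\<lambda>p. \<rho> i (fst p)) (eQ i (u(i := w)))"
        proof (rule weighted_sq_tendsto[OF wQ' eQ_L2[OF i us] eQ_L2[OF i uw]])
          show "(\<lambda>n. L2_norm ?Q (\<lambda>p. eQ i (u(i := s n)) p - eQ i (u(i := w)) p)) \<longlonglongrightarrow> 0"
          proof (rule Lim_null_comparison)
            show "(\<lambda>n. 2 * T * d i (s n) w) \<longlonglongrightarrow> 0" using tendsto_mult_right_zero[OF lim] by simp
            show "\<forall>\<^sub>F n in sequentially. norm (L2_norm ?Q (\<lambda>p. eQ i (u(i := s n)) p - eQ i (u(i := w)) p))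
                \<le> 2 * T * d i (s n) w"
              using lip(1)[OF us uw, of i] by (simp add: D_upd[OF i])
          qed
        qed
        have 3: "(\<lambda>n. weighted_sq ?M (\<eta> i) (eT i (u(i := s n)))) \<longlonglongrightarrow> weighted_sq ?M (\<eta> i) (eT i (u(i := w)))"
        proof (rule weighted_sq_tendsto[OF wM eT_L2[OF i us] eT_L2[OF i uw]])
          show "(\<lambda>n. L2_norm ?M (\<lambda>x. eT i (u(i := s n)) x - eT i (u(i := w)) x)) \<longlonglongrightarrow> 0"
          proof (rule Lim_null_comparison)
            show "(\<lambda>n. 2 * sqrt T * d i (s n) w) \<longlonglongrightarrow> 0" using tendsto_mult_right_zero[OF lim] by simp
            show "\<forall>\<^sub>F n in sequentially. norm (L2_norm ?M (\<lambda>x. eT i (u(i := s n)) x - eT i (u(i := w)) x))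
                \<le> 2 * sqrt T * d i (s n) w"
              using lip(2)[OF us uw, of i] by (simp add: D_upd[OF i])
          qed
        qed
        show ?thesis unfolding J fun_upd_same by (intro tendsto_intros 1 2 3)
      qed
      show "\<exists>m\<in>?X i. ?J i (u(i := m)) + \<alpha> i / 8 * (d i w w')\<^sup>2 \<le> (?J i (u(i := w)) + ?J i (u(i := w'))) / 2"
        if w: "w \<in> ?X i" "w' \<in> ?X i" for w w'
      proof
        let ?m = "\<lambda>p. (w p + w' p) / 2"
        show m: "?m \<in> ?X i" using L2_cmult[OF L2_add[OF w], of "1/2"] by simp
        note um = upd[OF u i m] and uw = upd[OF u i w(1)] and uw' = upd[OF u i w(2)]
        \<comment> \<open>The state of the midpoint control is the midpoint of the two states.\<close>
        have eq: "source N \<omega> f (u(i := ?m)) p - source N \<omega> f (u(i := w)) p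
            = source N \<omega> f (u(i := w')) p - source N \<omega> f (u(i := ?m)) p" for p
          unfolding source_upd_diff[OF i] by (simp add: field_simps)
        note q = weighted_sq_midpoint[OF wQ' eQ_L2[OF i um] eQ_L2[OF i uw] eQ_L2[OF i uw'] second(1)[OF um uw uw' um eq]]
          weighted_sq_midpoint[OF wM eT_L2[OF i um] eT_L2[OF i uw] eT_L2[OF i uw'] second(2)[OF um uw uw' um eq]]
        have "\<alpha> i / 2 * ((L2_norm (cylinder (\<omega> i) T) ?m)\<^sup>2 + (d i w w')\<^sup>2 / 4)
            = \<alpha> i / 2 * (((L2_norm (cylinder (\<omega> i) T) w)\<^sup>2 + (L2_norm (cylinder (\<omega> i) T) w')\<^sup>2) / 2)"
          unfolding d_def L2_norm_midpoint[OF w] ..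
        then show "?J i (u(i := ?m)) + \<alpha> i / 8 * (d i w w')\<^sup>2 \<le> (?J i (u(i := w)) + ?J i (u(i := w'))) / 2"
          using q unfolding J fun_upd_same by (simp add: algebra_simps)
      qed
      show "?J i (u(i := w')) - ?J i (u(i := w)) - ?J i (u'(i := w')) + ?J i (u'(i := w))
          \<le> K * (\<Sum>i=1..N. d i (u i) (u' i)) * d i w w'"
        if u': "u' \<in> ?U" and w: "w \<in> ?X i" "w' \<in> ?X i" for u' w w'
      proof -
        note v = upd[OF u i w(2)] upd[OF u i w(1)] upd[OF u' i w(2)] upd[OF u' i w(1)]
        have eq: "source N \<omega> f (u(i := w')) p - source N \<omega> f (u(i := w)) p
            = source N \<omega> f (u'(i := w')) p - source N \<omega> f (u'(i := w)) p" for p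
          unfolding source_upd_diff[OF i] ..
        have dw: "d i w' w = d i w w'" unfolding d_def by (rule L2_norm_minus_commute)
        have D0: "0 \<le> D u u'" by (simp add: D_def sum_nonneg d_nonneg)
        have lQ: "L2_norm ?Q (\<lambda>p. eQ i (u(i := w')) p - eQ i (u(i := w)) p) \<le> 2 * T * d i w w'"
          "L2_norm ?Q (\<lambda>p. eQ i (u(i := w')) p - eQ i (u'(i := w')) p) \<le> 2 * T * D u u'"
          using lip(1)[OF v(1,2), of i] order_trans[OF lip(1)[OF v(1,3), of i] mult_left_mono[OF D_upd_same]] T
          by (simp_all add: D_upd[OF i] dw)
        have lM: "L2_norm ?M (\<lambda>x. eT i (u(i := w')) x - eT i (u(i := w)) x) \<le> 2 * sqrt T * d i w w'"
          "L2_norm ?M (\<lambda>x. eT i (u(i := w')) x - eT i (u'(i := w')) x) \<le> 2 * sqrt T * D u u'"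
          using lip(2)[OF v(1,2), of i] order_trans[OF lip(2)[OF v(1,3), of i] mult_left_mono[OF D_upd_same]] T
          by (simp_all add: D_upd[OF i] dw)
        let ?wQ = "\<lambda>v. weighted_sq ?Q (\<lambda>p. \<rho> i (fst p)) (eQ i v)" and ?wM = "\<lambda>v. weighted_sq ?M (\<eta> i) (eT i v)"
        have "?wQ (u(i := w')) - ?wQ (u(i := w)) - ?wQ (u'(i := w')) + ?wQ (u'(i := w))
            \<le> 2 * c\<rho> i * (L2_norm ?Q (\<lambda>p. eQ i (u(i := w')) p - eQ i (u(i := w)) p)
                * L2_norm ?Q (\<lambda>p. eQ i (u(i := w')) p - eQ i (u'(i := w')) p))"
          by (rule weighted_sq_second_difference_le[OF wQ' eQ_L2[OF i v(1)] eQ_L2[OF i v(2)] eQ_L2[OF i v(3)]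
                eQ_L2[OF i v(4)] second(1)[OF v eq]])
        also have "\<dots> \<le> 2 * c\<rho> i * ((2 * T * d i w w') * (2 * T * D u u'))"
          using wQ'(4) T d_nonneg[of i w w'] by (intro mult_left_mono mult_mono lQ) auto
        finally have bQ: "?wQ (u(i := w')) - ?wQ (u(i := w)) - ?wQ (u'(i := w')) + ?wQ (u'(i := w))
            \<le> 2 * (4 * T\<^sup>2 * c\<rho> i) * (D u u' * d i w w')" by (simp add: power2_eq_square mult_ac)
        have "?wM (u(i := w')) - ?wM (u(i := w)) - ?wM (u'(i := w')) + ?wM (u'(i := w))
            \<le> 2 * c\<eta> i * (L2_norm ?M (\<lambda>x. eT i (u(i := w')) x - eT i (u(i := w)) x)
                * L2_norm ?M (\<lambda>x. eT i (u(i := w')) x - eT i (u'(i := w')) x))"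
          by (rule weighted_sq_second_difference_le[OF wM eT_L2[OF i v(1)] eT_L2[OF i v(2)] eT_L2[OF i v(3)]
                eT_L2[OF i v(4)] second(2)[OF v eq]])
        also have "\<dots> \<le> 2 * c\<eta> i * ((2 * sqrt T * d i w w') * (2 * sqrt T * D u u'))"
          using wM(4) T d_nonneg[of i w w'] by (intro mult_left_mono mult_mono lM) auto
        also have "\<dots> = 2 * (4 * (sqrt T * sqrt T) * c\<eta> i) * (D u u' * d i w w')" by (simp only: mult_ac)
        finally have bM: "?wM (u(i := w')) - ?wM (u(i := w)) - ?wM (u'(i := w')) + ?wM (u'(i := w))
            \<le> 2 * (4 * T * c\<eta> i) * (D u u' * d i w w')" using T by simp
        have "?J i (u(i := w')) - ?J i (u(i := w)) - ?J i (u'(i := w')) + ?J i (u'(i := w))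
            \<le> (4 * T\<^sup>2 * c\<rho> i + 4 * T * c\<eta> i) * (D u u' * d i w w')"
          using bQ bM unfolding J fun_upd_same distrib_right[of "4 * T\<^sup>2 * c\<rho> i"] by argo
        also have "\<dots> \<le> K * (D u u' * d i w w')"
          by (intro mult_right_mono K_ge i mult_nonneg_nonneg D0 d_nonneg)
        finally show ?thesis by (simp add: D_def mult.assoc)
      qed
    qed
    then obtain u where u: "is_Nash_equilibrium N ?X ?J u"
      and uniq: "\<And>u' i. \<lbrakk>is_Nash_equilibrium N ?X ?J u'; i \<in> {1..N}\<rbrakk> \<Longrightarrow> d i (u' i) (u i) = 0" by blast
    have "AE p in cylinder (\<omega> i) T. u' i p = u i p"
      if u': "is_Nash_equilibrium N ?X ?J u'" and i: "i \<in> {1..N}" for u' i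
    proof -
      have "u' i \<in> ?X i" "u i \<in> ?X i" using u u' i by (auto simp: is_Nash_equilibrium_def PiE_iff)
      from L2_norm_eq_0D[OF L2_diff[OF this]] uniq[OF u' i] show ?thesis by (simp add: d_def)
    qed
    then show "\<exists>u. is_Nash_equilibrium N ?X ?J u \<and>
        (\<forall>u'. is_Nash_equilibrium N ?X ?J u' \<longrightarrow> (\<forall>i\<in>{1..N}. AE p in cylinder (\<omega> i) T. u' i p = u i p))"
      using u by blast
  qed
qed

end
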